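(* Let $\mathbb{G}$ be an arbitrary Carnot group, with Rumin complex $(E_0^\ast,d_c)$. Then the differential part of the Rumin differentials $d_c$ coincides with the sum $\sum_{r\ge 1}\partial_r$ of the differentials $\partial_r$ that appear in the multicomplex spectral sequence generated by considering the filtration by weights over the space of smooth forms $\Omega^\ast$ of $\mathbb{G}$. (All objects, the meaning of "differential part", and the sense of "coincides", namely equality of the explicit formulas of the operators, are given in the context.)
   Context: **Carnot groups and weights.** A Carnot group $\mathbb{G}$ of step $s$ is a connected, simply connected Lie group whose $n$-dimensional Lie algebra has a stratification $\mathfrak{g}=V_1\oplus\cdots\oplus V_s$ with $[V_1,V_i]=V_{i+1}$, $V_s\ne 0$, $V_k=0$ for $k>s$. Fix an inner product on $\mathfrak g$ with mutually orthogonal layers, an orthonormal basis $X_1,\dots,X_n$ adapted to the stratification, and the dual basis $\theta_1,\dots,\theta_n$; the inner product on $\Lambda^h\mathfrak g^\ast$ makes the $\theta_{j_1}\wedge\cdots\wedge\theta_{j_h}$ ($j_1<\dots<j_h$) orthonormal. If $X_j\in V_i$, then $\theta_j$ has weight $i$; the weight of a wedge product of the $\theta_j$ is the sum of the weights of its factors. $\Lambda^{a,b}\mathfrak g^\ast$ is the span of the $(a+b)$-covectors of weight $a$. Identifying covectors with left-invariant forms, $\Omega^h=\Lambda^h\mathfrak g^\ast\otimes C^\infty(\mathbb G)$ is the space of smooth $h$-forms, and $\Omega^{a,b}=\Lambda^{a,b}\mathfrak g^\ast\otimes C^\infty(\mathbb G)$ is the space of smooth $(a+b)$-forms of weight $a$,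 so $\Omega^h=\bigoplus_{a+b=h}\Omega^{a,b}$. Write $\Omega^{p,\ast}=\bigoplus_b\Omega^{p,b}$. Weights range in $\{0,\dots,Q\}$, $Q=\sum_i i\dim V_i$. **Splitting of $d$.** The exterior differential splits as $d=d_0+d_1+\dots+d_s$, where $d_i$ is the component raising the weight by $i$: $d_i(\Omega^{p,h-p})\subset\Omega^{p+i,h+1-p-i}$ (put $d_j=0$ for $j>s$). The map $d_0$ is $C^\infty(\mathbb G)$-linear and agrees with $d$ on left-invariant forms. With the maps $d_i$, $(\Omega^\ast,d)$ is a multicomplex, i.e. $\sum_{i+j=n}d_id_j=0$ for all $n\ge 0$. **The operator $d_0^{-1}$.** For $\beta\in\Lambda^{h+1}\mathfrak g^\ast$, $d_0^{-1}\beta$ is the unique $\alpha\in\Lambda^h\mathfrak g^\ast\cap(\mathrm{Ker}\,d_0)^\perp$ such that $d_0\alpha-\beta\in(\mathrm{Im}\,d_0)^\perp$. It is extended $C^\infty(\mathbb G)$-linearly to $\Omega^{h+1}\to\Omega^h$ and preserves weights. **Rumin complex.** $E_0^h=\mathrm{Ker}\,d_0\cap(\mathrm{Im}\,d_0)^\perp\cap\Omega^h$; $\Pi_{E_0}=\mathrm{Id}-d_0d_0^{-1}-d_0^{-1}d_0$ is the projection onto $E_0^\ast$; $P=\sum_{k=0}^N(-1)^k[d_0^{-1}(d-d_0)]^k$, where $N$ is such that $[d_0^{-1}(d-d_0)]^N=0$; $\Pi_E=\mathrm{Id}-dPd_0^{-1}-Pd_0^{-1}d$; and $d_c=\Pi_{E_0}\,d\,\Pi_E:E_0^h\to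 E_0^{h+1}$. **Spectral sequence.** The weight filtration is $F_p=\bigoplus_{a\ge p}\Omega^{a,\ast}$, stable under $d$. For $r\ge1$, define subspaces of $\Omega^{p,\ast}$: - $x\in Z_r^{p,\ast}$ iff there are $z_{p+j}\in\Omega^{p+j,\ast}$, $1\le j\le r-1$, with $d_0x=0$ and $d_nx=\sum_{i=0}^{n-1}d_iz_{p+n-i}$ for $1\le n\le r-1$. - $x\in B_r^{p,\ast}$ iff there are $c_{p-k}\in\Omega^{p-k,\ast}$, $0\le k\le r-1$, with $x=\sum_{k=0}^{r-1}d_kc_{p-k}$ and $0=\sum_{k=l}^{r-1}d_{k-l}c_{p-k}$ for $1\le l\le r-1$. The $r$-th page of the spectral sequence of $(\Omega^\ast,d,F_\bullet)$ is identified with $Z_r^{p,\ast}/B_r^{p,\ast}$ by sending the class of $y\in F_p\cap d^{-1}(F_{p+r})$ to the class of its weight-$p$ component. Under this identification the $r$-th differential is $\partial_r:Z_r^{p,\ast}/B_r^{p,\ast}\to Z_r^{p+r,\ast}/B_r^{p+r,\ast}$, $\partial_r([x])=\big[d_rx-\sum_{i=1}^{r-1}d_iz_{p+r-i}\big]$. **Explicit expression of $\partial_r$ used in the statement.** For $x\in Z_r^{p,\ast}$ the $z_{p+j}$ are taken in $\Omega^{p+j,\ast}\cap(\mathrm{Ker}\,d_0)^\perp$ and expressed through $x$ by means of $d_0^{-1}$ ($z_{p+1}=d_0^{-1}d_1x$, $z_{p+2}=d_0^{-1}(d_2x-d_1z_{p+1})$, and so on), which gives $$\partial_r([x])=\Big[d_rx-\sum_{i=1}^{r-1}d_i\Big(\sum_{m=1}^{r-i}(-1)^{m-1}\sum_{\substack{(i_1,\dots,i_m)\in\mathbb{N}_+^m\\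 i_1+\cdots+i_m=r-i}}(d_0^{-1}d_{i_1})\cdots(d_0^{-1}d_{i_m})\Big)x\Big].$$ **Sense of the statement.** The "differential part" of $d_c$ is the operator standing between the two algebraic projections $\Pi_{E_0}$ when $d_c(\Pi_{E_0}\alpha)=\Pi_{E_0}\,d\,\Pi_E\,\Pi_{E_0}\alpha$, $\alpha\in\Omega^h$, is written out in terms of the $d_i$ and $d_0^{-1}$ (the terms of $d\Pi_E\Pi_{E_0}\alpha$ beginning with $d_0$ being annihilated by the outer $\Pi_{E_0}$). "Coincides" means that this operator has the same explicit formulation as the sum over $r\ge 1$ of the operators inside the brackets in the expression of $\partial_r$ above, i.e. $$d_c(\Pi_{E_0}\alpha)=\Pi_{E_0}\sum_{r\ge 1}\Big[d_r-\sum_{i=1}^{r-1}d_i\Big(\sum_{m=1}^{r-i}(-1)^{m-1}\sum_{\substack{(i_1,\dots,i_m)\in\mathbb{N}_+^m\\ i_1+\cdots+i_m=r-i}}(d_0^{-1}d_{i_1})\cdots(d_0^{-1}d_{i_m})\Big)\Big]\Pi_{E_0}\alpha .$$ The operators nevertheless act on different spaces: $d_c$ acts on the subspaces $E_0^h$, whose weight-$p$ part is $Z_1^{p,h-p}\cap(B_1^{p,h-p})^\perp$, corresponding to the first page of the spectral sequence, while each $\partial_r$ acts on the quotients $Z_r^{p,\ast}/B_r^{p,\ast}$ of the $r$-th page. *)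

theory Defs
  imports
    "HOL-Analysis.Analysis"
    "HOL-Algebra.Group"
    "HOL-Library.Function_Algebras"
begin

section \<open>Smooth functions, smooth atlases, Lie groups\<close>

primrec Ck_on :: "nat \<Rightarrow> 'a::euclidean_space set \<Rightarrow> ('a \<Rightarrow> 'b::euclidean_space) \<Rightarrow> bool" where
  "Ck_on 0 U f \<longleftrightarrow> continuous_on U f"
| "Ck_on (Suc k) U f \<longleftrightarrow> (\<forall>x\<in>U. f differentiable (at x)) \<and>
     (\<forall>v. Ck_on k U (\<lambda>x. frechet_derivative f (at x) v))"

text \<open>Used only for open \<open>U\<close>.\<close>
definition smooth_on :: "'a::euclidean_space set \<Rightarrow> ('a \<Rightarrow> 'b::euclidean_space) \<Rightarrow> bool" where
  "smooth_on U f \<longleftrightarrow> (\<forall>k. Ck_on k U f)"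

type_synonym ('g, 'e) chart = "'g set \<times> ('g \<Rightarrow> 'e)"

definition smooth_atlas :: "('g::topological_space, 'e::euclidean_space) chart set \<Rightarrow> bool" where
  "smooth_atlas \<A> \<longleftrightarrow>
     (\<Union>(U, \<phi>)\<in>\<A>. U) = UNIV \<and>
     (\<forall>(U, \<phi>)\<in>\<A>. open U \<and> open (\<phi> ` U) \<and> inj_on \<phi> U \<and>
        homeomorphism U (\<phi> ` U) \<phi> (inv_into U \<phi>)) \<and>
     (\<forall>(U, \<phi>)\<in>\<A>. \<forall>(V, \<psi>)\<in>\<A>. smooth_on (\<phi> ` (U \<inter> V)) (\<psi> \<circ> inv_into U \<phi>))"

definition Cinf :: "('g, 'e::euclidean_space) chart set \<Rightarrow> ('g \<Rightarrow> real) set" where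
  "Cinf \<A> = {f. \<forall>(U, \<phi>)\<in>\<A>. smooth_on (\<phi> ` U) (f \<circ> inv_into U \<phi>)}"

definition lie_group ::
  "('g::{t2_space, second_countable_topology}, 'e::euclidean_space) chart set \<Rightarrow> 'g monoid \<Rightarrow> bool" where
  "lie_group \<A> G \<longleftrightarrow> smooth_atlas \<A> \<and> group G \<and> carrier G = UNIV \<and>
     continuous_on UNIV (\<lambda>(x, y). x \<otimes>\<^bsub>G\<^esub> y) \<and>
     continuous_on UNIV (\<lambda>x. inv\<^bsub>G\<^esub> x) \<and>
     (\<forall>(U, \<phi>)\<in>\<A>. \<forall>(V, \<psi>)\<in>\<A>. \<forall>(W, \<xi>)\<in>\<A>.
        smooth_on {(a, b). a \<in> \<phi> ` U \<and> b \<in> \<psi> ` V \<and> inv_into U \<phi> a \<otimes>\<^bsub>G\<^esub> inv_into V \<psi> b \<in> W}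
          (\<lambda>(a, b). \<xi> (inv_into U \<phi> a \<otimes>\<^bsub>G\<^esub> inv_into V \<psi> b))) \<and>
     (\<forall>(U, \<phi>)\<in>\<A>. \<forall>(W, \<xi>)\<in>\<A>.
        smooth_on {a. a \<in> \<phi> ` U \<and> inv\<^bsub>G\<^esub> (inv_into U \<phi> a) \<in> W}
          (\<lambda>a. \<xi> (inv\<^bsub>G\<^esub> (inv_into U \<phi> a))))"


section \<open>The Lie algebra of left-invariant vector fields\<close>

text \<open>
  Both vector fields (\<open>'a = 'g \<Rightarrow> real\<close>) and differential forms (\<open>'a = nat set\<close>, see below) are
  functions \<open>'a \<Rightarrow> 'g \<Rightarrow> real\<close>; addition and zero on them are pointwise.
\<close>
definition scl :: "real \<Rightarrow> ('a \<Rightarrow> 'b \<Rightarrow> real) \<Rightarrow> 'a \<Rightarrow> 'b \<Rightarrow> real" where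
  "scl c F = (\<lambda>a x. c * F a x)"

interpretation vf: vector_space "scl :: real \<Rightarrow> ('a \<Rightarrow> 'b \<Rightarrow> real) \<Rightarrow> 'a \<Rightarrow> 'b \<Rightarrow> real"
  by unfold_locales (simp_all add: scl_def fun_eq_iff algebra_simps)

type_synonym 'g vfield = "('g \<Rightarrow> real) \<Rightarrow> 'g \<Rightarrow> real"

text \<open>
  Smooth vector fields are the derivations of the algebra of smooth functions. As functions in
  HOL are total, a derivation is normalised to be \<open>0\<close> on non-smooth arguments.
\<close>
definition vector_field :: "('g, 'e::euclidean_space) chart set \<Rightarrow> 'g vfield \<Rightarrow> bool" where
  "vector_field \<A> X \<longleftrightarrow>
     (\<forall>f\<in>Cinf \<A>. X f \<in> Cinf \<A>) \<and> (\<forall>f. f \<notin> Cinf \<A> \<longrightarrow> X f = 0) \<and>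
     (\<forall>f\<in>Cinf \<A>. \<forall>h\<in>Cinf \<A>. X (f + h) = X f + X h) \<and>
     (\<forall>c. \<forall>f\<in>Cinf \<A>. X (\<lambda>x. c * f x) = (\<lambda>x. c * X f x)) \<and>
     (\<forall>f\<in>Cinf \<A>. \<forall>h\<in>Cinf \<A>. X (f * h) = f * X h + h * X f)"

definition lie_algebra :: "('g, 'e::euclidean_space) chart set \<Rightarrow> 'g monoid \<Rightarrow> 'g vfield set" where
  "lie_algebra \<A> G = {X. vector_field \<A> X \<and>
     (\<forall>g. \<forall>f\<in>Cinf \<A>. X (\<lambda>x. f (g \<otimes>\<^bsub>G\<^esub> x)) = (\<lambda>x. X f (g \<otimes>\<^bsub>G\<^esub> x)))}"

definition bracket :: "'g vfield \<Rightarrow> 'g vfield \<Rightarrow> 'g vfield" where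
  "bracket X Y = (\<lambda>f. X (Y f) - Y (X f))"


section \<open>Carnot groups with a fixed inner product and adapted orthonormal frame\<close>

text \<open>
  The layers are \<open>layer S 1, \<dots>, layer S (step S)\<close>, the frame is
  \<open>frame S 1, \<dots>, frame S (gdim S)\<close>.
\<close>
record ('g, 'e) carnot =
  charts :: "('g, 'e) chart set"
  grp :: "'g monoid"
  step :: nat
  layer :: "nat \<Rightarrow> 'g vfield set"
  ip :: "'g vfield \<Rightarrow> 'g vfield \<Rightarrow> real"
  gdim :: nat
  frame :: "nat \<Rightarrow> 'g vfield"

definition liealg :: "('g, 'e::euclidean_space) carnot \<Rightarrow> 'g vfield set" where
  "liealg S = lie_algebra (charts S) (grp S)"

definition stratification :: "('g, 'e::euclidean_space) carnot \<Rightarrow> bool" where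
  "stratification S \<longleftrightarrow> 1 \<le> step S \<and>
     (\<forall>i\<ge>1. vf.subspace (layer S i) \<and> layer S i \<subseteq> liealg S) \<and>
     (\<forall>Y\<in>liealg S. \<exists>!v. (\<forall>i\<in>{1..step S}. v i \<in> layer S i) \<and> (\<forall>i. i \<notin> {1..step S} \<longrightarrow> v i = 0) \<and>
        Y = (\<Sum>i=1..step S. v i)) \<and>
     (\<forall>i\<ge>1. vf.span {bracket Y Z | Y Z. Y \<in> layer S 1 \<and> Z \<in> layer S i} = layer S (Suc i)) \<and>
     layer S (step S) \<noteq> {0} \<and> (\<forall>k>step S. layer S k = {0})"

definition inner_product :: "('g, 'e::euclidean_space) carnot \<Rightarrow> bool" where
  "inner_product S \<longleftrightarrow>
     (\<forall>Y\<in>liealg S. \<forall>Z\<in>liealg S. ip S Y Z = ip S Z Y) \<and>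
     (\<forall>Y\<in>liealg S. \<forall>Y'\<in>liealg S. \<forall>Z\<in>liealg S. ip S (Y + Y') Z = ip S Y Z + ip S Y' Z) \<and>
     (\<forall>c. \<forall>Y\<in>liealg S. \<forall>Z\<in>liealg S. ip S (scl c Y) Z = c * ip S Y Z) \<and>
     (\<forall>Y\<in>liealg S. Y \<noteq> 0 \<longrightarrow> 0 < ip S Y Y)"

definition adapted_orthonormal_basis :: "('g, 'e::euclidean_space) carnot \<Rightarrow> bool" where
  "adapted_orthonormal_basis S \<longleftrightarrow>
     inj_on (frame S) {1..gdim S} \<and> vf.independent (frame S ` {1..gdim S}) \<and>
     vf.span (frame S ` {1..gdim S}) = liealg S \<and>
     (\<forall>j\<in>{1..gdim S}. \<forall>k\<in>{1..gdim S}. ip S (frame S j) (frame S k) = (if j = k then 1 else 0)) \<and>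
     (\<forall>j\<in>{1..gdim S}. \<exists>i\<in>{1..step S}. frame S j \<in> layer S i)"

definition carnot_group ::
  "('g::{t2_space, second_countable_topology}, 'e::euclidean_space) carnot \<Rightarrow> bool" where
  "carnot_group S \<longleftrightarrow> lie_group (charts S) (grp S) \<and>
     connected (UNIV :: 'g set) \<and> simply_connected (UNIV :: 'g set) \<and>
     stratification S \<and> inner_product S \<and>
     (\<forall>i\<in>{1..step S}. \<forall>k\<in>{1..step S}. i \<noteq> k \<longrightarrow>
        (\<forall>Y\<in>layer S i. \<forall>Z\<in>layer S k. ip S Y Z = 0)) \<and>
     adapted_orthonormal_basis S"

definition wt :: "('g, 'e::euclidean_space) carnot \<Rightarrow> nat \<Rightarrow> nat" where
  "wt S j = (THE i. i \<in> {1..step S} \<and> frame S j \<in> layer S i)"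

definition wtset :: "('g, 'e::euclidean_space) carnot \<Rightarrow> nat set \<Rightarrow> nat" where
  "wtset S J = (\<Sum>j\<in>J. wt S j)"

definition homdim :: "('g, 'e::euclidean_space) carnot \<Rightarrow> nat" where
  "homdim S = (\<Sum>i=1..step S. i * vf.dim (layer S i))"


section \<open>Differential forms\<close>

text \<open>
  An element of \<open>\<Lambda>\<^sup>h\<g>\<^sup>* \<otimes> C\<^sup>\<infinity>(G)\<close> is represented by its coefficients: \<open>\<alpha> J\<close> is the
  coefficient of \<open>\<theta>\<^sub>J = \<theta>\<^bsub>j\<^sub>1\<^esub> \<and> \<dots> \<and> \<theta>\<^bsub>j\<^sub>h\<^esub>\<close>, where \<open>J = {j\<^sub>1 < \<dots> < j\<^sub>h} \<subseteq> {1..n}\<close>.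
\<close>
type_synonym 'g form = "nat set \<Rightarrow> 'g \<Rightarrow> real"

definition Forms :: "('g, 'e::euclidean_space) carnot \<Rightarrow> 'g form set" where
  "Forms S = {\<alpha>. \<forall>J. \<alpha> J \<in> Cinf (charts S) \<and> (\<alpha> J \<noteq> 0 \<longrightarrow> J \<subseteq> {1..gdim S})}"

definition Forms_deg :: "('g, 'e::euclidean_space) carnot \<Rightarrow> nat \<Rightarrow> 'g form set" where
  "Forms_deg S h = {\<alpha> \<in> Forms S. \<forall>J. \<alpha> J \<noteq> 0 \<longrightarrow> card J = h}"

text \<open>
  \<open>Forms_wt S p\<close> is \<open>\<Omega>\<^bsup>p,*\<^esup>\<close>; integer weights, so that it is \<open>{0}\<close> for negative \<open>p\<close>.
\<close>
definition Forms_wt :: "('g, 'e::euclidean_space) carnot \<Rightarrow> int \<Rightarrow> 'g form set" where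
  "Forms_wt S p = {\<alpha> \<in> Forms S. \<forall>J. \<alpha> J \<noteq> 0 \<longrightarrow> int (wtset S J) = p}"

definition Linv_deg :: "('g, 'e::euclidean_space) carnot \<Rightarrow> nat \<Rightarrow> 'g form set" where
  "Linv_deg S h = {\<alpha> \<in> Forms_deg S h. \<forall>J. \<exists>c. \<alpha> J = (\<lambda>x. c)}"

definition theta :: "nat set \<Rightarrow> 'g form" where
  "theta J = (\<lambda>K. if K = J then 1 else 0)"

definition fmul :: "('g \<Rightarrow> real) \<Rightarrow> 'g form \<Rightarrow> 'g form" where
  "fmul f \<alpha> = (\<lambda>J. f * \<alpha> J)"

text \<open>\<open>\<theta>\<^sub>I \<and> \<theta>\<^sub>J = shuffle_sign I J \<theta>\<^bsub>I\<union>J\<^esub>\<close> for disjoint \<open>I\<close>, \<open>J\<close>.\<close>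
definition shuffle_sign :: "nat set \<Rightarrow> nat set \<Rightarrow> real" where
  "shuffle_sign I J = (-1) ^ card {(i, j). i \<in> I \<and> j \<in> J \<and> j < i}"

definition wedge :: "'g form \<Rightarrow> 'g form \<Rightarrow> 'g form" where
  "wedge \<alpha> \<beta> = (\<lambda>K x. \<Sum>I\<in>Pow K. shuffle_sign I (K - I) * \<alpha> I x * \<beta> (K - I) x)"

text \<open>The inner product on forms, with values in functions, for which the \<open>theta J\<close> are orthonormal.\<close>
definition fip :: "('g, 'e::euclidean_space) carnot \<Rightarrow> 'g form \<Rightarrow> 'g form \<Rightarrow> 'g \<Rightarrow> real" where
  "fip S \<alpha> \<beta> = (\<Sum>J\<in>Pow {1..gdim S}. \<alpha> J * \<beta> J)"


section \<open>The exterior differential and its splitting by weight\<close>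

text \<open>
  The exterior differential is the antiderivation determined by \<open>df = \<Sum>\<^sub>j (X\<^sub>j f) \<theta>\<^sub>j\<close> and the
  Maurer--Cartan equations \<open>d\<theta>\<^sub>k = - \<Sum>\<^bsub>i<j\<^esub> \<theta>\<^sub>k([X\<^sub>i, X\<^sub>j]) \<theta>\<^sub>i \<and> \<theta>\<^sub>j\<close>, i.e. by
  \<open>d\<theta>(X, Y) = X(\<theta>(Y)) - Y(\<theta>(X)) - \<theta>([X, Y])\<close> applied to the left-invariant \<open>\<theta>\<^sub>k\<close>.
\<close>
definition dual :: "('g, 'e::euclidean_space) carnot \<Rightarrow> nat \<Rightarrow> 'g vfield \<Rightarrow> real" where
  "dual S k Y = vf.representation (frame S ` {1..gdim S}) Y (frame S k)"

definition d_fun :: "('g, 'e::euclidean_space) carnot \<Rightarrow> ('g \<Rightarrow> real) \<Rightarrow> 'g form" where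
  "d_fun S f = (\<Sum>j=1..gdim S. fmul (frame S j f) (theta {j}))"

definition d_theta1 :: "('g, 'e::euclidean_space) carnot \<Rightarrow> nat \<Rightarrow> 'g form" where
  "d_theta1 S k = - (\<Sum>(i, j) \<in> {(i, j). i \<in> {1..gdim S} \<and> j \<in> {1..gdim S} \<and> i < j}.
     scl (dual S k (bracket (frame S i) (frame S j))) (wedge (theta {i}) (theta {j})))"

definition d_theta :: "('g, 'e::euclidean_space) carnot \<Rightarrow> nat set \<Rightarrow> 'g form" where
  "d_theta S J = (\<Sum>j\<in>J. scl ((-1) ^ card {i \<in> J. i < j}) (wedge (d_theta1 S j) (theta (J - {j}))))"

definition ext_d :: "('g, 'e::euclidean_space) carnot \<Rightarrow> 'g form \<Rightarrow> 'g form" where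
  "ext_d S \<alpha> = (\<Sum>J\<in>Pow {1..gdim S}. wedge (d_fun S (\<alpha> J)) (theta J) + fmul (\<alpha> J) (d_theta S J))"

definition wpart :: "('g, 'e::euclidean_space) carnot \<Rightarrow> nat \<Rightarrow> 'g form \<Rightarrow> 'g form" where
  "wpart S a \<alpha> = (\<lambda>J. if wtset S J = a then \<alpha> J else 0)"

text \<open>The component \<open>d\<^sub>i\<close> of the exterior differential raising the weight by \<open>i\<close>.\<close>
definition dw :: "('g, 'e::euclidean_space) carnot \<Rightarrow> nat \<Rightarrow> 'g form \<Rightarrow> 'g form" where
  "dw S i \<alpha> = (\<Sum>a=0..homdim S. wpart S (a + i) (ext_d S (wpart S a \<alpha>)))"


section \<open>The Rumin complex\<close>

text \<open>\<open>d\<^sub>0\<^sup>-\<^sup>1 : \<Lambda>\<^bsup>h+1\<^esup>\<g>\<^sup>* \<rightarrow> \<Lambda>\<^sup>h\<g>\<^sup>*\<close>, and then its \<open>C\<^sup>\<infinity>\<close>-linear extension to all forms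
  (zero on functions).\<close>
definition d0inv_cov :: "('g, 'e::euclidean_space) carnot \<Rightarrow> nat \<Rightarrow> 'g form \<Rightarrow> 'g form" where
  "d0inv_cov S h \<beta> = (THE \<alpha>. \<alpha> \<in> Linv_deg S h \<and>
     (\<forall>\<gamma>\<in>Linv_deg S h. dw S 0 \<gamma> = 0 \<longrightarrow> fip S \<alpha> \<gamma> = 0) \<and>
     (\<forall>\<gamma>\<in>Linv_deg S h. fip S (dw S 0 \<alpha> - \<beta>) (dw S 0 \<gamma>) = 0))"

definition d0inv :: "('g, 'e::euclidean_space) carnot \<Rightarrow> 'g form \<Rightarrow> 'g form" where
  "d0inv S \<beta> = (\<Sum>K\<in>Pow {1..gdim S} - {{}}. fmul (\<beta> K) (d0inv_cov S (card K - 1) (theta K)))"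

definition E0_deg :: "('g, 'e::euclidean_space) carnot \<Rightarrow> nat \<Rightarrow> 'g form set" where
  "E0_deg S h = {\<alpha> \<in> Forms_deg S h. dw S 0 \<alpha> = 0 \<and> (\<forall>\<beta>\<in>Forms S. fip S \<alpha> (dw S 0 \<beta>) = 0)}"

definition Pi_E0 :: "('g, 'e::euclidean_space) carnot \<Rightarrow> 'g form \<Rightarrow> 'g form" where
  "Pi_E0 S \<alpha> = \<alpha> - dw S 0 (d0inv S \<alpha>) - d0inv S (dw S 0 \<alpha>)"

definition T_op :: "('g, 'e::euclidean_space) carnot \<Rightarrow> 'g form \<Rightarrow> 'g form" where
  "T_op S \<alpha> = d0inv S (ext_d S \<alpha> - dw S 0 \<alpha>)"

definition T_nilpotent :: "('g, 'e::euclidean_space) carnot \<Rightarrow> nat \<Rightarrow> bool" where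
  "T_nilpotent S N \<longleftrightarrow> (\<forall>\<alpha>\<in>Forms S. (T_op S ^^ N) \<alpha> = 0)"

definition P_op :: "('g, 'e::euclidean_space) carnot \<Rightarrow> nat \<Rightarrow> 'g form \<Rightarrow> 'g form" where
  "P_op S N \<alpha> = (\<Sum>k=0..N. scl ((-1) ^ k) ((T_op S ^^ k) \<alpha>))"

definition Pi_E :: "('g, 'e::euclidean_space) carnot \<Rightarrow> nat \<Rightarrow> 'g form \<Rightarrow> 'g form" where
  "Pi_E S N \<alpha> = \<alpha> - ext_d S (P_op S N (d0inv S \<alpha>)) - P_op S N (d0inv S (ext_d S \<alpha>))"

definition d_c :: "('g, 'e::euclidean_space) carnot \<Rightarrow> nat \<Rightarrow> 'g form \<Rightarrow> 'g form" where
  "d_c S N \<alpha> = Pi_E0 S (ext_d S (Pi_E S N \<alpha>))"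

text \<open>
  The operator between the two projections \<open>\<Pi>\<^bsub>E\<^sub>0\<^esub>\<close> in \<open>\<Pi>\<^bsub>E\<^sub>0\<^esub> d \<Pi>\<^sub>E \<Pi>\<^bsub>E\<^sub>0\<^esub>\<close>, after removal
  of the terms beginning with \<open>d\<^sub>0\<close> (which the outer projection annihilates).
\<close>
definition differential_part :: "('g, 'e::euclidean_space) carnot \<Rightarrow> nat \<Rightarrow> 'g form \<Rightarrow> 'g form" where
  "differential_part S N \<alpha> = ext_d S (Pi_E S N \<alpha>) - dw S 0 (Pi_E S N \<alpha>)"


section \<open>The multicomplex spectral sequence of the weight filtration\<close>

text \<open>
  \<open>z j\<close> stands for \<open>z\<^bsub>p+j\<^esub>\<close> and \<open>c k\<close> for \<open>c\<^bsub>p-k\<^esub>\<close>. Elements of a page are cosets.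
\<close>
definition Z_lift ::
  "('g, 'e::euclidean_space) carnot \<Rightarrow> nat \<Rightarrow> int \<Rightarrow> 'g form \<Rightarrow> (nat \<Rightarrow> 'g form) \<Rightarrow> bool" where
  "Z_lift S r p x z \<longleftrightarrow> x \<in> Forms_wt S p \<and> (\<forall>j\<in>{1..<r}. z j \<in> Forms_wt S (p + int j)) \<and>
     dw S 0 x = 0 \<and> (\<forall>n\<in>{1..<r}. dw S n x = (\<Sum>i=0..n-1. dw S i (z (n - i))))"

definition Zr :: "('g, 'e::euclidean_space) carnot \<Rightarrow> nat \<Rightarrow> int \<Rightarrow> 'g form set" where
  "Zr S r p = {x. \<exists>z. Z_lift S r p x z}"

definition Br :: "('g, 'e::euclidean_space) carnot \<Rightarrow> nat \<Rightarrow> int \<Rightarrow> 'g form set" where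
  "Br S r p = {x \<in> Forms_wt S p. \<exists>c. (\<forall>k\<in>{0..<r}. c k \<in> Forms_wt S (p - int k)) \<and>
     x = (\<Sum>k\<in>{0..<r}. dw S k (c k)) \<and>
     (\<forall>l\<in>{1..<r}. 0 = (\<Sum>k\<in>{l..<r}. dw S (k - l) (c k)))}"

definition cls :: "('g, 'e::euclidean_space) carnot \<Rightarrow> nat \<Rightarrow> int \<Rightarrow> 'g form \<Rightarrow> 'g form set" where
  "cls S r p x = {x + b | b. b \<in> Br S r p}"

definition partial ::
  "('g, 'e::euclidean_space) carnot \<Rightarrow> nat \<Rightarrow> int \<Rightarrow> 'g form set \<Rightarrow> 'g form set" where
  "partial S r p C = (THE D. \<exists>x z. Z_lift S r p x z \<and> C = cls S r p x \<and>
     D = cls S r (p + int r) (dw S r x - (\<Sum>i\<in>{1..<r}. dw S i (z (r - i)))))"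

definition Ker_d0_perp :: "('g, 'e::euclidean_space) carnot \<Rightarrow> 'g form set" where
  "Ker_d0_perp S = {\<alpha> \<in> Forms S. \<forall>\<gamma>\<in>Forms S. dw S 0 \<gamma> = 0 \<longrightarrow> fip S \<alpha> \<gamma> = 0}"

text \<open>
  The explicit operator \<open>partial_op S r\<close> arises from \<open>partial S r\<close> by the choice
  \<open>z\<^bsub>p+n\<^esub> = d\<^sub>0\<^sup>-\<^sup>1(d\<^sub>n x - \<Sum>\<^bsub>1\<le>i<n\<^esub> d\<^sub>i z\<^bsub>p+n-i\<^esub>)\<close>. It raises the weight by \<open>r\<close> and so vanishes for
  \<open>r > homdim S\<close>.
\<close>
definition compositions :: "nat \<Rightarrow> nat \<Rightarrow> nat list set" where
  "compositions m k = {is. length is = m \<and> (\<forall>i\<in>set is. 1 \<le> i) \<and> sum_list is = k}"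

text \<open>\<open>(d\<^sub>0\<^sup>-\<^sup>1 d\<^bsub>i\<^sub>1\<^esub>) \<dots> (d\<^sub>0\<^sup>-\<^sup>1 d\<^bsub>i\<^sub>m\<^esub>)\<close> for the list \<open>[i\<^sub>1, \<dots>, i\<^sub>m]\<close>.\<close>
definition d0inv_word :: "('g, 'e::euclidean_space) carnot \<Rightarrow> nat list \<Rightarrow> 'g form \<Rightarrow> 'g form" where
  "d0inv_word S is = foldr (\<lambda>i F. (\<lambda>\<alpha>. d0inv S (dw S i \<alpha>)) \<circ> F) is id"

definition partial_op :: "('g, 'e::euclidean_space) carnot \<Rightarrow> nat \<Rightarrow> 'g form \<Rightarrow> 'g form" where
  "partial_op S r \<alpha> = dw S r \<alpha> - (\<Sum>i=1..r-1. dw S i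
     (\<Sum>m=1..r-i. scl ((-1) ^ (m - 1)) (\<Sum>is\<in>compositions m (r - i). d0inv_word S is \<alpha>)))"

end

theory Submission
  imports Defs
begin

text \<open>
  The operator \<open>T = d\<^sub>0\<^sup>-\<^sup>1(d - d\<^sub>0) = \<Sum>\<^sub>i d\<^sub>0\<^sup>-\<^sup>1d\<^sub>i\<close> raises the weight, hence is nilpotent, and the equation
  \<open>W = Tx - TW\<close> has at most one solution \<open>W\<close>. Both sides of the theorem are built from this
  solution. If \<open>x\<close> lies in \<open>E\<^sub>0\<close>, then \<open>d\<^sub>0x = 0\<close> and \<open>d\<^sub>0\<^sup>-\<^sup>1x = 0\<close>, so that \<open>\<Pi>\<^sub>E x = x - PTx\<close>; by telescoping,
  the truncated Neumann series \<open>PTx = \<Sum>\<^sub>k (-1)\<^sup>kT\<^sup>k\<^sup>+\<^sup>1x\<close> solves the equation (\<open>P_op_T_equation\<close>). On the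
  other side, let \<open>L\<^sub>n\<close> be the alternating sum of the words \<open>(d\<^sub>0\<^sup>-\<^sup>1d\<^bsub>i\<^sub>1\<^esub>) \<dots> (d\<^sub>0\<^sup>-\<^sup>1d\<^bsub>i\<^sub>m\<^esub>)\<close> over the compositions
  of \<open>n\<close>. Splitting off the first letter gives \<open>L\<^sub>n = d\<^sub>0\<^sup>-\<^sup>1d\<^sub>n - \<Sum>\<^bsub>i<n\<^esub> d\<^sub>0\<^sup>-\<^sup>1d\<^sub>iL\<^bsub>n-i\<^esub>\<close> (\<open>lift_op_recursion\<close>),
  and summing over \<open>n\<close> shows that \<open>\<Sum>\<^sub>n L\<^sub>nx\<close> solves the same equation (\<open>lift_total_equation\<close>). Applying
  \<open>d - d\<^sub>0\<close> to \<open>\<Pi>\<^sub>E x = x - \<Sum>\<^sub>n L\<^sub>nx\<close> and collecting the terms that raise the weight by \<open>r\<close> yields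
  \<open>\<Sum>\<^sub>r (d\<^sub>r - \<Sum>\<^sub>i d\<^sub>iL\<^bsub>r-i\<^esub>)x\<close>, which is the sum of the explicit operators (\<open>differential_part_eq\<close>). The
  remaining term \<open>d\<^sub>0\<Pi>\<^sub>E x\<close> of \<open>d\<Pi>\<^sub>E x\<close> is killed by the outer \<open>\<Pi>\<^bsub>E\<^sub>0\<^esub>\<close>.

  In the spectral sequence, \<open>d\<^sub>0\<^sup>-\<^sup>1d\<^sub>0\<close> is the identity on \<open>(Ker d\<^sub>0)\<^sup>\<bottom>\<close>, so the lifts taken there obey the
  same recursion and are \<open>z\<^bsub>p+n\<^esub> = L\<^sub>nx\<close> (\<open>lift_unique\<close>). It remains to see that \<open>\<partial>\<^sub>r\<close> depends neither on the
  representative nor on the lifts: if \<open>x\<close> is the component of lowest weight of some \<open>dc\<close>, then replacing the total lift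
  \<open>w\<close> of \<open>x\<close> by \<open>w - dc\<close> moves it to higher weights without changing \<open>dw\<close>, because \<open>d\<^sup>2 = 0\<close>
  (\<open>boundary_descends\<close>).

  This rests on three properties of the concrete differential. It satisfies \<open>d\<^sup>2 = 0\<close> (\<open>ext_d_ext_d\<close>): in terms of
  exterior multiplications \<open>e\<^sub>i\<close> and contractions \<open>\<iota>\<^sub>i\<close>, it is \<open>\<Sum>\<^sub>j e\<^sub>jX\<^sub>j - \<onehalf> \<Sum> c\<^sub>i\<^sub>j\<^sup>k e\<^sub>ie\<^sub>j\<iota>\<^sub>k\<close>, and the claim follows from
  \<open>[X\<^sub>i, X\<^sub>j] = \<Sum>\<^sub>k c\<^sub>i\<^sub>j\<^sup>kX\<^sub>k\<close>, the Jacobi identity and the anticommutation relations of the \<open>e\<^sub>i\<close> and \<open>\<iota>\<^sub>i\<close>. It splits by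
  weight with the second sum as \<open>d\<^sub>0\<close> (\<open>dw_eq\<close>), because the structure constants are graded. And \<open>d\<^sub>0\<close>, being
  given by a constant matrix with blocks indexed by degree and weight, has a pseudo-inverse that respects these
  blocks (\<open>d0inv_cov_theta\<close>).
\<close>

section \<open>Smooth functions\<close>

text \<open>
  The derivative at a point of an open set sees only the values on that set. This is what allows
  the sum and scaling rules below to be proved pointwise on \<open>U\<close>, although the total derivative may be anything
  outside \<open>U\<close>.
\<close>
lemma Ck_on_cong:
  assumes "open U" "\<And>x. x \<in> U \<Longrightarrow> f x = g x" "Ck_on k U f"
  shows "Ck_on k U g"
  using assms(2,3)
proof (induction k arbitrary: f g)
  case 0
  then show ?case by (auto cong: continuous_on_cong)
next
  case (Suc k)
  have D: "(g has_derivative frechet_derivative f (at x)) (at x)" if "x \<in> U" for x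
  proof (rule has_derivative_transform_within_open[OF _ assms(1) that])
    show "(f has_derivative frechet_derivative f (at x)) (at x)"
      using Suc.prems(2) that by (auto simp: frechet_derivative_works)
  qed (use Suc.prems(1) in auto)
  then have "frechet_derivative f (at x) v = frechet_derivative g (at x) v" if "x \<in> U" for x v
    using that frechet_derivative_at by metis
  then have "Ck_on k U (\<lambda>x. frechet_derivative g (at x) v)" for v
    using Suc.IH[of "\<lambda>x. frechet_derivative f (at x) v" "\<lambda>x. frechet_derivative g (at x) v"]
      Suc.prems(2) by simp
  with D show ?case by (auto simp: differentiable_def)
qed

lemma Ck_on_const: "Ck_on k U (\<lambda>x. c)"
proof (induction k arbitrary: c)
  case (Suc k)
  have "frechet_derivative (\<lambda>x::'a. c) (at x) = (\<lambda>v. 0)" for x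
    by (rule frechet_derivative_const)
  then show ?case using Suc by simp
qed simp

lemma Ck_on_add:
  assumes "open U" "Ck_on k U f" "Ck_on k U g"
  shows "Ck_on k U (\<lambda>x. f x + g x)"
  using assms(2,3)
proof (induction k arbitrary: f g)
  case 0
  then show ?case by (auto intro: continuous_on_add)
next
  case (Suc k)
  have "Ck_on k U (\<lambda>x. frechet_derivative (\<lambda>x. f x + g x) (at x) v)" for v
  proof (rule Ck_on_cong[OF assms(1)])
    show "Ck_on k U (\<lambda>x. frechet_derivative f (at x) v + frechet_derivative g (at x) v)"
      using Suc by simp
    show "frechet_derivative f (at x) v + frechet_derivative g (at x) v =
          frechet_derivative (\<lambda>x. f x + g x) (at x) v" if "x \<in> U" for x
    proof -
      have "((\<lambda>x. f x + g x) has_derivative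
            (\<lambda>v. frechet_derivative f (at x) v + frechet_derivative g (at x) v)) (at x)"
        using Suc.prems that by (intro has_derivative_add) (simp_all add: frechet_derivative_works[symmetric])
      from fun_cong[OF frechet_derivative_at[OF this]] show ?thesis by simp
    qed
  qed
  moreover have "\<forall>x\<in>U. (\<lambda>x. f x + g x) differentiable (at x)"
    using Suc.prems by (intro ballI differentiable_add) simp_all
  ultimately show ?case by simp
qed

lemma Ck_on_cmult:
  fixes f :: "'a::euclidean_space \<Rightarrow> real"
  assumes "open U" "Ck_on k U f"
  shows "Ck_on k U (\<lambda>x. c * f x)"
  using assms(2)
proof (induction k arbitrary: f)
  case 0
  then show ?case by (auto intro: continuous_on_mult_left)
next
  case (Suc k)
  have "Ck_on k U (\<lambda>x. frechet_derivative (\<lambda>x. c * f x) (at x) v)" for v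
  proof (rule Ck_on_cong[OF assms(1)])
    show "Ck_on k U (\<lambda>x. c * frechet_derivative f (at x) v)"
      using Suc by simp
    show "c * frechet_derivative f (at x) v = frechet_derivative (\<lambda>x. c * f x) (at x) v"
      if "x \<in> U" for x
    proof -
      have "((\<lambda>x. c * f x) has_derivative (\<lambda>v. c * frechet_derivative f (at x) v)) (at x)"
        using Suc.prems that by (intro has_derivative_mult_right) (simp_all add: frechet_derivative_works[symmetric])
      from fun_cong[OF frechet_derivative_at[OF this]] show ?thesis by simp
    qed
  qed
  moreover have "\<forall>x\<in>U. (\<lambda>x. c * f x) differentiable (at x)"
    using Suc.prems by (intro ballI differentiable_mult) simp_all
  ultimately show ?case by simp
qed

locale carnot_frame =
  fixes S :: "('g::{t2_space, second_countable_topology}, 'e::euclidean_space) carnot"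
  assumes carnot: "carnot_group S"
begin

abbreviation "N \<equiv> {1..gdim S}"
abbreviation "Csm \<equiv> Cinf (charts S)"
abbreviation "X \<equiv> frame S"
abbreviation "Q \<equiv> homdim S"

lemma chart_open: "(U, \<phi>) \<in> charts S \<Longrightarrow> open (\<phi> ` U)"
  using carnot unfolding carnot_group_def lie_group_def smooth_atlas_def by (elim conjE) blast

lemma Cinf_const: "(\<lambda>x. c) \<in> Csm"
  by (auto simp: Cinf_def smooth_on_def comp_def Ck_on_const)

lemma Cinf_0: "0 \<in> Csm"
  using Cinf_const[of 0] by (simp add: zero_fun_def)

lemma Cinf_add:
  assumes "f \<in> Csm" "g \<in> Csm"
  shows "f + g \<in> Csm"
  unfolding Cinf_def smooth_on_def
proof safe
  fix U \<phi> k assume ch: "(U, \<phi>) \<in> charts S"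
  then have "Ck_on k (\<phi> ` U) (f \<circ> inv_into U \<phi>)" "Ck_on k (\<phi> ` U) (g \<circ> inv_into U \<phi>)"
    using assms unfolding Cinf_def smooth_on_def by auto
  from Ck_on_add[OF chart_open[OF ch] this] show "Ck_on k (\<phi> ` U) ((f + g) \<circ> inv_into U \<phi>)"
    by (simp add: comp_def)
qed

lemma Cinf_cmult:
  assumes "f \<in> Csm"
  shows "(\<lambda>x. c * f x) \<in> Csm"
  unfolding Cinf_def smooth_on_def
proof safe
  fix U \<phi> k assume ch: "(U, \<phi>) \<in> charts S"
  then have "Ck_on k (\<phi> ` U) (f \<circ> inv_into U \<phi>)"
    using assms unfolding Cinf_def smooth_on_def by auto
  from Ck_on_cmult[OF chart_open[OF ch] this, of c] show "Ck_on k (\<phi> ` U) ((\<lambda>x. c * f x) \<circ> inv_into U \<phi>)"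
    by (simp add: comp_def)
qed

lemma Cinf_minus: "f \<in> Csm \<Longrightarrow> - f \<in> Csm"
  using Cinf_cmult[of f "-1"] by (simp add: fun_Compl_def)

lemma liealg_D:
  assumes "Y \<in> liealg S"
  shows "f \<in> Csm \<Longrightarrow> Y f \<in> Csm" "f \<notin> Csm \<Longrightarrow> Y f = 0"
    "f \<in> Csm \<Longrightarrow> g \<in> Csm \<Longrightarrow> Y (f + g) = Y f + Y g"
    "f \<in> Csm \<Longrightarrow> Y (\<lambda>x. c * f x) = (\<lambda>x. c * Y f x)"
  using assms unfolding liealg_def lie_algebra_def vector_field_def by auto

lemma liealg_0: "Y \<in> liealg S \<Longrightarrow> Y 0 = 0"
  using liealg_D(4)[of Y "0" 0] Cinf_0 by (simp add: zero_fun_def)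

lemma liealg_minus: "Y \<in> liealg S \<Longrightarrow> f \<in> Csm \<Longrightarrow> Y (- f) = - Y f"
  using liealg_D(4)[of Y f "-1"] by (simp add: fun_Compl_def)

lemma liealg_diff: "Y \<in> liealg S \<Longrightarrow> f \<in> Csm \<Longrightarrow> g \<in> Csm \<Longrightarrow> Y (f - g) = Y f - Y g"
  using liealg_D(3)[of Y f "- g"] liealg_minus[of Y g] Cinf_minus[of g] by simp

section \<open>The graded Lie algebra and its structure constants\<close>

lemma strat: "stratification S"
  using carnot[unfolded carnot_group_def] by (elim conjE)

lemma inner: "inner_product S"
  using carnot[unfolded carnot_group_def] by (elim conjE)

lemma basis: "adapted_orthonormal_basis S"
  using carnot[unfolded carnot_group_def] by (elim conjE)

lemma layers_orthogonal:
  assumes "i \<in> {1..step S}" "k \<in> {1..step S}" "i \<noteq> k" "Y \<in> layer S i" "Z \<in> layer S k"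
  shows "ip S Y Z = 0"
proof -
  have "\<forall>i\<in>{1..step S}. \<forall>k\<in>{1..step S}. i \<noteq> k \<longrightarrow> (\<forall>Y\<in>layer S i. \<forall>Z\<in>layer S k. ip S Y Z = 0)"
    using carnot[unfolded carnot_group_def] by (elim conjE)
  then show ?thesis using assms by blast
qed

lemma layer_subspace: "1 \<le> i \<Longrightarrow> vf.subspace (layer S i)"
  using strat[unfolded stratification_def] by simp

lemma layer_liealg: "1 \<le> i \<Longrightarrow> layer S i \<subseteq> liealg S"
  using strat[unfolded stratification_def] by simp

lemma layer_generated:
  assumes "1 \<le> i"
  shows "vf.span {bracket Y Z | Y Z. Y \<in> layer S 1 \<and> Z \<in> layer S i} = layer S (Suc i)"
proof -
  have "\<forall>i\<ge>1. vf.span {bracket Y Z | Y Z. Y \<in> layer S 1 \<and> Z \<in> layer S i} = layer S (Suc i)"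
    using strat[unfolded stratification_def] by (elim conjE)
  then show ?thesis using assms by blast
qed

lemma layer_beyond: "k > step S \<Longrightarrow> layer S k = {0}"
  using strat[unfolded stratification_def] by simp

lemma liealg_subspace: "vf.subspace (liealg S)"
  using basis unfolding adapted_orthonormal_basis_def by (metis vf.subspace_span)

lemma bracket_add_left:
  assumes "A \<in> liealg S" "B \<in> liealg S" "Z \<in> liealg S"
  shows "bracket (A + B) Z = bracket A Z + bracket B Z"
proof
  fix f show "bracket (A + B) Z f = (bracket A Z + bracket B Z) f"
    by (cases "f \<in> Csm")
       (simp_all add: bracket_def liealg_D[OF assms(1)] liealg_D[OF assms(2)] liealg_D[OF assms(3)]
         liealg_0[OF assms(1)] liealg_0[OF assms(2)] liealg_0[OF assms(3)])
qed

lemma bracket_scl_left: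
  assumes "A \<in> liealg S" "Z \<in> liealg S"
  shows "bracket (scl a A) Z = scl a (bracket A Z)"
proof
  fix f show "bracket (scl a A) Z f = scl a (bracket A Z) f"
  proof (cases "f \<in> Csm")
    case True
    have "Z (\<lambda>x. a * A f x) = (\<lambda>x. a * Z (A f) x)"
      by (intro liealg_D[OF assms(2)] liealg_D[OF assms(1)] True)
    then show ?thesis by (simp add: bracket_def scl_def fun_eq_iff algebra_simps)
  next
    case False
    then have "A f = 0" "Z f = 0" using assms liealg_D(2) by auto
    moreover have "(\<lambda>x. a * A f x) = 0" using \<open>A f = 0\<close> by (simp add: fun_eq_iff)
    ultimately show ?thesis
      using liealg_0[OF assms(1)] liealg_0[OF assms(2)] by (simp add: bracket_def scl_def zero_fun_def)
  qed
qed

lemma bracket_anti: "bracket Y Z = - bracket Z Y"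
  by (simp add: bracket_def fun_eq_iff)

text \<open>
  Only additivity on smooth functions enters; on other arguments all terms vanish, since a vector
  field is normalised to be \<open>0\<close> there.
\<close>
lemma bracket_Jacobi:
  assumes "A \<in> liealg S" "B \<in> liealg S" "Z \<in> liealg S"
  shows "bracket (bracket A B) Z = bracket A (bracket B Z) - bracket B (bracket A Z)"
proof
  fix f show "bracket (bracket A B) Z f = (bracket A (bracket B Z) - bracket B (bracket A Z)) f"
    by (cases "f \<in> Csm")
       (simp_all add: bracket_def liealg_diff[OF assms(1)] liealg_diff[OF assms(2)] liealg_diff[OF assms(3)]
         liealg_D[OF assms(1)] liealg_D[OF assms(2)] liealg_D[OF assms(3)]
         liealg_0[OF assms(1)] liealg_0[OF assms(2)] liealg_0[OF assms(3)])
qed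

text \<open>
  The stratification only describes brackets with \<open>V\<^sub>1\<close>. Since \<open>V\<^bsub>i+1\<^esub>\<close> is spanned by the brackets
  \<open>[A, C]\<close> with \<open>A\<close> in \<open>V\<^sub>1\<close> and \<open>C\<close> in \<open>V\<^sub>i\<close>, the Jacobi identity \<open>[[A, C], Z] = [A, [C, Z]] - [C, [A, Z]]\<close> reduces the
  general case to it. This also yields that the Lie algebra is closed under the brackets of homogeneous
  elements.
\<close>
lemma bracket_layers:
  assumes "1 \<le> i" "1 \<le> j" "Y \<in> layer S i" "Z \<in> layer S j"
  shows "bracket Y Z \<in> layer S (i + j)"
  using assms
proof (induction i arbitrary: j Y Z rule: nat_induct_at_least)
  case (base j Y Z)
  have "bracket Y Z \<in> vf.span {bracket Y Z | Y Z. Y \<in> layer S 1 \<and> Z \<in> layer S j}"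
    using base by (intro vf.span_base) auto
  then show ?case using layer_generated base by simp
next
  case (Suc i j Y Z)
  have Z: "Z \<in> liealg S" using Suc layer_liealg by blast
  have one: "bracket A C \<in> layer S (Suc k)" if "A \<in> layer S 1" "C \<in> layer S k" "1 \<le> k" for A C k
    using that layer_generated[of k] by (metis (mono_tags, lifting) mem_Collect_eq vf.span_base)
  have sub: "vf.subspace (layer S (Suc i + j))" by (intro layer_subspace) simp
  have "Y \<in> vf.span {bracket Y Z | Y Z. Y \<in> layer S 1 \<and> Z \<in> layer S i}"
    using Suc layer_generated by simp
  then have "Y \<in> liealg S \<and> bracket Y Z \<in> layer S (Suc i + j)"
  proof (induction rule: vf.span_induct_alt)
    case base
    have "bracket 0 Z = 0" using liealg_0[OF Z] by (simp add: bracket_def fun_eq_iff)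
    then show ?case using sub vf.subspace_0 liealg_subspace by metis
  next
    case (step a B y)
    then obtain A C where AC: "B = bracket A C" "A \<in> layer S 1" "C \<in> layer S i" by blast
    have L: "A \<in> liealg S" "C \<in> liealg S" using AC layer_liealg Suc.hyps by auto
    have B: "B \<in> liealg S" using one[OF AC(2,3)] AC(1) Suc.hyps layer_liealg[of "Suc i"] by auto
    have "bracket A (bracket C Z) \<in> layer S (Suc (i + j))"
      using one[OF AC(2) Suc.IH[OF Suc.prems(1) AC(3) Suc.prems(3)]] Suc.hyps by simp
    moreover have "bracket C (bracket A Z) \<in> layer S (i + Suc j)"
      using one[OF AC(2) Suc.prems(3,1)] by (intro Suc.IH AC(3)) auto
    ultimately have "bracket B Z \<in> layer S (Suc i + j)"
      unfolding AC(1) bracket_Jacobi[OF L Z] using vf.subspace_diff[OF sub] by simp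
    moreover have "bracket (scl a B + y) Z = scl a (bracket B Z) + bracket y Z"
      using B step Z by (simp add: bracket_add_left bracket_scl_left vf.subspace_scale[OF liealg_subspace])
    ultimately show ?case
      by (metis step(2) B sub liealg_subspace vf.subspace_add vf.subspace_scale)
  qed
  then show ?case by blast
qed

lemma frame_inj: "inj_on X N"
  using basis[unfolded adapted_orthonormal_basis_def] by (elim conjE)

lemma frame_indep: "vf.independent (X ` N)"
  using basis[unfolded adapted_orthonormal_basis_def] by (elim conjE)

lemma frame_span: "vf.span (X ` N) = liealg S"
  using basis[unfolded adapted_orthonormal_basis_def] by (elim conjE)

lemma frame_orthonormal:
  assumes "j \<in> N" "k \<in> N"
  shows "ip S (X j) (X k) = (if j = k then 1 else 0)"
proof -
  have "\<forall>j\<in>N. \<forall>k\<in>N. ip S (X j) (X k) = (if j = k then 1 else 0)"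
    using basis[unfolded adapted_orthonormal_basis_def] by (elim conjE)
  then show ?thesis using assms by simp
qed

lemma frame_layer_ex:
  assumes "j \<in> N"
  shows "\<exists>i\<in>{1..step S}. X j \<in> layer S i"
proof -
  have "\<forall>j\<in>N. \<exists>i\<in>{1..step S}. X j \<in> layer S i"
    using basis[unfolded adapted_orthonormal_basis_def] by (elim conjE)
  then show ?thesis by (rule bspec[OF _ assms])
qed

lemma frame_liealg: "j \<in> N \<Longrightarrow> X j \<in> liealg S"
  unfolding frame_span[symmetric] by (intro vf.span_base imageI)

text \<open>
  Different layers are orthogonal, so a unit vector lies in at most one of them.
\<close>
lemma wt_layer:
  assumes "j \<in> N" shows "wt S j \<in> {1..step S}" "X j \<in> layer S (wt S j)"
proof -
  obtain i where i: "i \<in> {1..step S}" "X j \<in> layer S i"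
    using frame_layer_ex[OF assms] by auto
  have "i' = i" if "i' \<in> {1..step S} \<and> X j \<in> layer S i'" for i'
  proof (rule ccontr)
    assume "i' \<noteq> i"
    then have "ip S (X j) (X j) = 0" using that i by (intro layers_orthogonal[of i' i]) auto
    then show False using frame_orthonormal[OF assms assms] by simp
  qed
  with i have "wt S j = i" unfolding wt_def by (intro the_equality conjI)
  with i show "wt S j \<in> {1..step S}" "X j \<in> layer S (wt S j)" by simp_all
qed

lemma wt_pos: "j \<in> N \<Longrightarrow> 1 \<le> wt S j"
  using wt_layer by fastforce

text \<open>
  The structure constants \<open>c\<^sub>i\<^sub>j\<^sup>k\<close> of \<open>[X\<^sub>i, X\<^sub>j] = \<Sum>\<^sub>k c\<^sub>i\<^sub>j\<^sup>kX\<^sub>k\<close>.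
\<close>
definition sc :: "nat \<Rightarrow> nat \<Rightarrow> nat \<Rightarrow> real" where
  "sc i j k = dual S k (bracket (X i) (X j))"

lemma liealg_expand:
  assumes "Y \<in> liealg S" shows "Y = (\<Sum>k\<in>N. scl (dual S k Y) (X k))"
proof -
  have "(\<Sum>b\<in>X ` N. scl (vf.representation (X ` N) Y b) b) = Y"
    using assms frame_span by (intro vf.sum_representation_eq frame_indep) auto
  then show ?thesis unfolding sum.reindex[OF frame_inj] dual_def comp_def by (rule sym)
qed

lemma dual_add: "Y \<in> liealg S \<Longrightarrow> Z \<in> liealg S \<Longrightarrow> dual S k (Y + Z) = dual S k Y + dual S k Z"
  unfolding dual_def using frame_span by (subst vf.representation_add[OF frame_indep]) auto

lemma dual_minus: "Y \<in> liealg S \<Longrightarrow> dual S k (- Y) = - dual S k Y"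
  unfolding dual_def using frame_span by (subst vf.representation_neg[OF frame_indep]) auto

lemma dual_scl: "Y \<in> liealg S \<Longrightarrow> dual S k (scl a Y) = a * dual S k Y"
  unfolding dual_def using frame_span by (subst vf.representation_scale[OF frame_indep]) auto

lemma dual_0: "dual S k 0 = 0"
  unfolding dual_def vf.representation_zero by simp

lemma dual_sum:
  assumes "\<And>i. i \<in> I \<Longrightarrow> F i \<in> liealg S"
  shows "dual S k (sum F I) = (\<Sum>i\<in>I. dual S k (F i))"
  using assms
proof (induction I rule: infinite_finite_induct)
  case (insert i I)
  have "F i \<in> liealg S" "sum F I \<in> liealg S"
    using insert.prems by (auto intro: vf.subspace_sum[OF liealg_subspace])
  moreover have "dual S k (sum F I) = (\<Sum>i\<in>I. dual S k (F i))"
    using insert.prems by (intro insert.IH) simp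
  ultimately show ?case unfolding sum.insert[OF insert.hyps(1,2)] by (simp only: dual_add)
qed (simp_all add: dual_0)

lemma bracket_frame_layer:
  assumes "i \<in> N" "j \<in> N" shows "bracket (X i) (X j) \<in> layer S (wt S i + wt S j)"
  using assms by (intro bracket_layers wt_pos wt_layer)

lemma bracket_frame:
  assumes "i \<in> N" "j \<in> N"
  shows "bracket (X i) (X j) \<in> liealg S" "bracket (X i) (X j) = (\<Sum>k\<in>N. scl (sc i j k) (X k))"
proof -
  show *: "bracket (X i) (X j) \<in> liealg S"
    using bracket_frame_layer[OF assms] layer_liealg[of "wt S i + wt S j"] wt_pos[OF assms(1)] by auto
  show "bracket (X i) (X j) = (\<Sum>k\<in>N. scl (sc i j k) (X k))"
    unfolding sc_def by (rule liealg_expand[OF *])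
qed

lemma sc_anti: "i \<in> N \<Longrightarrow> j \<in> N \<Longrightarrow> sc j i k = - sc i j k"
  unfolding sc_def using bracket_anti[of "X j" "X i"] dual_minus bracket_frame(1) by metis

lemma sc_diag: "i \<in> N \<Longrightarrow> sc i i k = 0"
  using sc_anti[of i i k] by simp

lemma ip_add: "Y \<in> liealg S \<Longrightarrow> Y' \<in> liealg S \<Longrightarrow> Z \<in> liealg S \<Longrightarrow> ip S (Y + Y') Z = ip S Y Z + ip S Y' Z"
  using inner[unfolded inner_product_def] by simp

lemma ip_scl: "Y \<in> liealg S \<Longrightarrow> Z \<in> liealg S \<Longrightarrow> ip S (scl a Y) Z = a * ip S Y Z"
  using inner[unfolded inner_product_def] by simp

lemma ip_0: "Z \<in> liealg S \<Longrightarrow> ip S 0 Z = 0"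
  using ip_scl[of 0 Z 0] vf.subspace_0[OF liealg_subspace] by simp

lemma ip_expand:
  assumes "\<And>i. i \<in> I \<Longrightarrow> F i \<in> liealg S" "Z \<in> liealg S"
  shows "ip S (\<Sum>i\<in>I. scl (a i) (F i)) Z = (\<Sum>i\<in>I. a i * ip S (F i) Z)"
  using assms(1)
proof (induction I rule: infinite_finite_induct)
  case (insert i I)
  have F: "F i \<in> liealg S" using insert.prems by simp
  have "(\<Sum>i\<in>I. scl (a i) (F i)) \<in> liealg S"
    using insert.prems by (intro vf.subspace_sum[OF liealg_subspace] vf.subspace_scale[OF liealg_subspace]) simp
  moreover have "ip S (\<Sum>i\<in>I. scl (a i) (F i)) Z = (\<Sum>i\<in>I. a i * ip S (F i) Z)"
    using insert.prems by (intro insert.IH) simp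
  ultimately show ?case using F unfolding sum.insert[OF insert.hyps(1,2)]
    by (simp only: ip_add ip_scl vf.subspace_scale[OF liealg_subspace] assms(2))
qed (simp_all add: ip_0 assms(2))

text \<open>
  By orthonormality \<open>c\<^sub>i\<^sub>j\<^sup>k\<close> is the inner product of \<open>[X\<^sub>i, X\<^sub>j]\<close> with \<open>X\<^sub>k\<close>, and different layers are
  orthogonal.
\<close>
lemma sc_graded:
  assumes "i \<in> N" "j \<in> N" "k \<in> N" "sc i j k \<noteq> 0"
  shows "wt S k = wt S i + wt S j"
proof (rule ccontr)
  assume ne: "wt S k \<noteq> wt S i + wt S j"
  have "sc i j k = ip S (bracket (X i) (X j)) (X k)"
  proof -
    have "ip S (bracket (X i) (X j)) (X k) = (\<Sum>l\<in>N. sc i j l * ip S (X l) (X k))"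
      unfolding bracket_frame(2)[OF assms(1,2)] by (intro ip_expand frame_liealg assms(3))
    also have "\<dots> = (\<Sum>l\<in>N. if l = k then sc i j l else 0)"
      using assms(3) by (intro sum.cong) (auto simp: frame_orthonormal)
    finally show ?thesis using assms(3) by simp
  qed
  moreover have "ip S (bracket (X i) (X j)) (X k) = 0" if "wt S i + wt S j \<le> step S"
    using layers_orthogonal[OF _ wt_layer(1)[OF assms(3)] ne[symmetric] bracket_frame_layer[OF assms(1,2)]
        wt_layer(2)[OF assms(3)]] that wt_pos[OF assms(1)] by auto
  moreover have "wt S i + wt S j \<le> step S"
  proof (rule ccontr)
    assume "\<not> ?thesis"
    then have "bracket (X i) (X j) = 0"
      using layer_beyond[of "wt S i + wt S j"] bracket_frame_layer[OF assms(1,2)] by auto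
    then show False using assms(4) by (simp add: sc_def dual_0)
  qed
  ultimately show False using assms(4) by simp
qed

text \<open>
  The coordinates of an iterated bracket, which turn the Jacobi identity into a quadratic
  identity for the structure constants.
\<close>
lemma sc_iterated:
  assumes "i \<in> N" "j \<in> N" "b \<in> N"
  shows "bracket (bracket (X i) (X j)) (X b) \<in> liealg S"
    and "dual S l (bracket (bracket (X i) (X j)) (X b)) = (\<Sum>k\<in>N. sc i j k * sc k b l)"
proof -
  have *: "bracket (\<Sum>k\<in>I. scl (sc i j k) (X k)) (X b) = (\<Sum>k\<in>I. scl (sc i j k) (bracket (X k) (X b)))"
    if "I \<subseteq> N" for I
  proof -
    have "finite I" using that finite_subset by blast
    then show ?thesis using that
    proof induction
      case empty
      then show ?case using liealg_0[OF frame_liealg[OF assms(3)]] by (simp add: bracket_def zero_fun_def)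
    next
      case (insert k I)
      have "(\<Sum>k\<in>I. scl (sc i j k) (X k)) \<in> liealg S" "scl (sc i j k) (X k) \<in> liealg S"
        using insert.prems liealg_subspace frame_liealg by (auto intro!: vf.subspace_sum vf.subspace_scale)
      then show ?case using insert assms(3) frame_liealg
        unfolding sum.insert[OF insert.hyps(1,2)]
        by (simp only: bracket_add_left bracket_scl_left insert_subset)
    qed
  qed
  have eq: "bracket (bracket (X i) (X j)) (X b) = (\<Sum>k\<in>N. scl (sc i j k) (bracket (X k) (X b)))"
    unfolding bracket_frame(2)[OF assms(1,2)] by (rule *) simp
  have mem: "scl (sc i j k) (bracket (X k) (X b)) \<in> liealg S" if "k \<in> N" for k
    using that assms bracket_frame(1) liealg_subspace by (auto intro: vf.subspace_scale)
  show "bracket (bracket (X i) (X j)) (X b) \<in> liealg S"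
    unfolding eq using mem liealg_subspace by (auto intro: vf.subspace_sum)
  show "dual S l (bracket (bracket (X i) (X j)) (X b)) = (\<Sum>k\<in>N. sc i j k * sc k b l)"
    unfolding eq by (subst dual_sum) (use mem assms bracket_frame(1) in \<open>auto simp: dual_scl sc_def\<close>)
qed

lemma sc_Jacobi:
  assumes "i \<in> N" "j \<in> N" "b \<in> N"
  shows "(\<Sum>k\<in>N. sc i j k * sc k b l) + (\<Sum>k\<in>N. sc j b k * sc k i l) + (\<Sum>k\<in>N. sc b i k * sc k j l) = 0"
proof -
  note L = frame_liealg[OF assms(1)] frame_liealg[OF assms(2)] frame_liealg[OF assms(3)]
  have "bracket (bracket (X i) (X j)) (X b) + bracket (bracket (X j) (X b)) (X i)
      + bracket (bracket (X b) (X i)) (X j) = 0"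
  proof -
    have 1: "bracket (bracket (X j) (X b)) (X i) = - bracket (X i) (bracket (X j) (X b))"
      by (rule bracket_anti)
    have "bracket (X b) (X i) = - bracket (X i) (X b)" by (rule bracket_anti)
    moreover have "bracket (- bracket (X i) (X b)) (X j) = - bracket (bracket (X i) (X b)) (X j)"
      using bracket_scl_left[OF bracket_frame(1)[OF assms(1,3)] L(2), of "-1"] by simp
    ultimately have 2: "bracket (bracket (X b) (X i)) (X j) = bracket (X j) (bracket (X i) (X b))"
      using bracket_anti[of "bracket (X i) (X b)" "X j"] by simp
    show ?thesis unfolding 1 2 bracket_Jacobi[OF L] by simp
  qed
  then have "dual S l (bracket (bracket (X i) (X j)) (X b) + bracket (bracket (X j) (X b)) (X i)
      + bracket (bracket (X b) (X i)) (X j)) = 0"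
    by (simp add: dual_0)
  then show ?thesis
    using sc_iterated[OF assms(1,2,3)] sc_iterated[OF assms(2,3,1)] sc_iterated[OF assms(3,1,2)]
    by (simp add: dual_add vf.subspace_add[OF liealg_subspace])
qed

text \<open>
  The frame vectors in a layer form an independent subset of it. Its extension to a basis of the layer is
  finite, as it is independent inside the span of the finite frame; without this, \<open>dim\<close> could be the junk
  value \<open>0\<close>.
\<close>
lemma card_layer_le:
  assumes "1 \<le> i" shows "card {j \<in> N. wt S j = i} \<le> vf.dim (layer S i)"
proof -
  let ?B = "X ` {j \<in> N. wt S j = i}"
  have 1: "?B \<subseteq> layer S i" using wt_layer(2) by auto
  have 2: "vf.independent ?B" by (rule vf.independent_mono[OF frame_indep]) auto
  obtain C where C: "?B \<subseteq> C" "C \<subseteq> layer S i" "vf.independent C" "layer S i \<subseteq> vf.span C"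
    by (rule vf.maximal_independent_subset_extend[OF 1 2])
  have "C \<subseteq> vf.span (X ` N)"
    unfolding frame_span using C(2) layer_liealg[OF assms] by (rule subset_trans)
  then have fin: "finite C" using vf.independent_span_bound[OF _ C(3), of "X ` N"] by simp
  have "card {j \<in> N. wt S j = i} = card ?B"
    using frame_inj by (intro card_image[symmetric]) (rule inj_on_subset, auto)
  also have "\<dots> \<le> card C" by (rule card_mono[OF fin C(1)])
  also have "\<dots> = vf.dim (layer S i)"
    by (rule vf.dim_unique[OF C(2,4,3), symmetric]) simp
  finally show ?thesis .
qed

text \<open>
  Every form therefore has weights in \<open>{0..Q}\<close>, which is what makes operators raising the weight
  nilpotent.
\<close>
lemma sum_wt_le: "(\<Sum>j\<in>N. wt S j) \<le> Q"
proof -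
  have "(\<Sum>j\<in>N. wt S j) = (\<Sum>i\<in>{1..step S}. \<Sum>j\<in>{j \<in> N. wt S j = i}. wt S j)"
    using wt_layer(1) by (intro sum.group[symmetric]) auto
  also have "\<dots> = (\<Sum>i\<in>{1..step S}. i * card {j \<in> N. wt S j = i})"
    by (intro sum.cong) auto
  also have "\<dots> \<le> Q" unfolding homdim_def by (intro sum_mono mult_left_mono card_layer_le) auto
  finally show ?thesis .
qed

lemma wtset_le: "J \<subseteq> N \<Longrightarrow> wtset S J \<le> Q"
  unfolding wtset_def using sum_mono2[of N J "wt S"] sum_wt_le by auto

lemma wt_le: "j \<in> N \<Longrightarrow> wt S j \<le> Q"
  using wtset_le[of "{j}"] by (simp add: wtset_def)

end

section \<open>Exterior multiplication and contraction\<close>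

lemma additive_sum:
  fixes F :: "'a::ab_group_add \<Rightarrow> 'b::ab_group_add"
  assumes "\<And>a b. F (a + b) = F a + F b"
  shows "F (\<Sum>i\<in>I. g i) = (\<Sum>i\<in>I. F (g i))"
proof (induction I rule: infinite_finite_induct)
  case empty
  have "F 0 + F 0 = F 0 + 0" using assms[of 0 0] by simp
  then show ?case by simp
next
  case (infinite I)
  have "F 0 + F 0 = F 0 + 0" using assms[of 0 0] by simp
  with infinite show ?case by simp
qed (simp add: assms)

lemma sum_fun_apply2: "(\<Sum>i\<in>I. F i) K x = (\<Sum>i\<in>I. (F i :: 'a \<Rightarrow> 'b \<Rightarrow> real) K x)"
  by (induction I rule: infinite_finite_induct) simp_all

text \<open>
  The sign of moving \<open>\<theta>\<^sub>j\<close> past the factors of \<open>\<theta>\<^sub>K\<close> with a smaller index.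
\<close>
definition ord_sign :: "nat \<Rightarrow> nat set \<Rightarrow> real" where
  "ord_sign j K = (-1) ^ card {i \<in> K. i < j}"

lemma ord_sign_square: "ord_sign j K * ord_sign j K = 1"
  unfolding ord_sign_def by (simp flip: power_add)

lemma ord_sign_insert:
  assumes "i \<notin> K"
  shows "ord_sign j (insert i K) = (if i < j then - ord_sign j K else ord_sign j K)"
proof (cases "i < j")
  case True
  have "{l \<in> insert i K. l < j} = insert i {l \<in> K. l < j}" using True by auto
  with assms True show ?thesis by (simp add: ord_sign_def)
next
  case False
  then have "{l \<in> insert i K. l < j} = {l \<in> K. l < j}" by auto
  with False show ?thesis by (simp add: ord_sign_def)
qed

lemma ord_sign_remove:
  assumes "i \<in> K"
  shows "ord_sign j (K - {i}) = (if i < j then - ord_sign j K else ord_sign j K)"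
  using ord_sign_insert[of i "K - {i}" j] assms by (auto simp: insert_absorb split: if_splits)

definition emul :: "nat \<Rightarrow> 'g form \<Rightarrow> 'g form" where
  "emul j \<alpha> = (\<lambda>K x. if j \<in> K then ord_sign j K * \<alpha> (K - {j}) x else 0)"

definition contr :: "nat \<Rightarrow> 'g form \<Rightarrow> 'g form" where
  "contr j \<alpha> = (\<lambda>K x. if j \<in> K then 0 else ord_sign j K * \<alpha> (insert j K) x)"

lemma emul_add: "emul j (\<alpha> + \<beta>) = emul j \<alpha> + emul j \<beta>"
  and emul_scl: "emul j (scl c \<alpha>) = scl c (emul j \<alpha>)"
  and emul_fmul: "emul j (fmul f \<alpha>) = fmul f (emul j \<alpha>)"
  and emul_minus: "emul j (- \<alpha>) = - emul j \<alpha>"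
  and contr_add: "contr j (\<alpha> + \<beta>) = contr j \<alpha> + contr j \<beta>"
  and contr_scl: "contr j (scl c \<alpha>) = scl c (contr j \<alpha>)"
  and contr_fmul: "contr j (fmul f \<alpha>) = fmul f (contr j \<alpha>)"
  by (auto simp: emul_def contr_def scl_def fmul_def fun_eq_iff algebra_simps)

lemmas emul_sum = additive_sum[of "emul j" for j, OF emul_add]
lemmas contr_sum = additive_sum[of "contr j" for j, OF contr_add]

lemma emul_anti: "emul i (emul j \<alpha>) = - emul j (emul i \<alpha>)"
proof (intro ext)
  fix K x
  have "K - {i} - {j} = K - {j} - {i}" by auto
  then show "emul i (emul j \<alpha>) K x = (- emul j (emul i \<alpha>)) K x"
    by (auto simp: emul_def ord_sign_remove)
qed

lemma contr_anti: "contr i (contr j \<alpha>) = - contr j (contr i \<alpha>)"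
proof (intro ext)
  fix K x
  show "contr i (contr j \<alpha>) K x = (- contr j (contr i \<alpha>)) K x"
    by (auto simp: contr_def ord_sign_insert insert_commute)
qed

text \<open>
  The canonical anticommutation relation \<open>e\<^sub>i\<iota>\<^sub>j + \<iota>\<^sub>je\<^sub>i = \<delta>\<^sub>i\<^sub>j\<close>.
\<close>
lemma emul_contr: "emul i (contr j \<alpha>) + contr j (emul i \<alpha>) = (if i = j then \<alpha> else 0)"
proof (intro ext)
  fix K x
  show "(emul i (contr j \<alpha>) + contr j (emul i \<alpha>)) K x = (if i = j then \<alpha> else 0) K x"
  proof (cases "i = j")
    case True
    have sq: "ord_sign j K * (ord_sign j K * a) = a" for a
      by (simp add: ord_sign_square flip: mult.assoc)
    show ?thesis
      using True sq by (cases "i \<in> K") (simp_all add: emul_def contr_def ord_sign_insert ord_sign_remove insert_absorb)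
  next
    case False
    have "insert j (K - {i}) = insert j K - {i}" using False by auto
    with False show ?thesis
      by (auto simp: emul_def contr_def ord_sign_insert ord_sign_remove)
  qed
qed

lemma contr_emul: "contr k (emul i \<alpha>) = (if i = k then \<alpha> else 0) - emul i (contr k \<alpha>)"
  using emul_contr[of i k \<alpha>] unfolding eq_diff_eq by (subst add.commute)

lemma contr_theta: "contr k (theta J) = (if k \<in> J then scl (ord_sign k J) (theta (J - {k})) else 0)"
proof (intro ext)
  fix K x
  have "insert k K = J \<longleftrightarrow> k \<in> J \<and> K = J - {k}" if "k \<notin> K" using that by auto
  then show "contr k (theta J) K x = (if k \<in> J then scl (ord_sign k J) (theta (J - {k})) else 0) K x"
    by (auto simp: contr_def theta_def scl_def ord_sign_remove)
qed

lemma shuffle_sign_single: "shuffle_sign {j} M = ord_sign j M"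
proof -
  have "{(i, j'). i \<in> {j} \<and> j' \<in> M \<and> j' < i} = (\<lambda>l. (j, l)) ` {i \<in> M. i < j}" by auto
  then have "card {(i, j'). i \<in> {j} \<and> j' \<in> M \<and> j' < i} = card {i \<in> M. i < j}"
    by (simp add: card_image inj_on_def)
  then show ?thesis by (simp add: shuffle_sign_def ord_sign_def)
qed

lemma shuffle_sign_pair:
  assumes "i < j" shows "shuffle_sign {i, j} M = ord_sign i M * ord_sign j M"
proof -
  have "{(a, b). a \<in> {i, j} \<and> b \<in> M \<and> b < a} = (\<lambda>l. (i, l)) ` {l \<in> M. l < i} \<union> (\<lambda>l. (j, l)) ` {l \<in> M. l < j}"
    by auto
  moreover have "card ((\<lambda>l. (i, l)) ` {l \<in> M. l < i} \<union> (\<lambda>l. (j, l)) ` {l \<in> M. l < j})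
      = card {l \<in> M. l < i} + card {l \<in> M. l < j}"
    using assms by (subst card_Un_disjoint) (auto simp: card_image inj_on_def)
  ultimately show ?thesis by (simp add: shuffle_sign_def ord_sign_def power_add)
qed

lemma wedge_theta:
  assumes "finite K"
  shows "wedge (theta J) \<beta> K x = (if J \<subseteq> K then shuffle_sign J (K - J) * \<beta> (K - J) x else 0)"
proof -
  have "wedge (theta J) \<beta> K x = (\<Sum>I\<in>Pow K. if I = J then shuffle_sign J (K - J) * \<beta> (K - J) x else 0)"
    unfolding wedge_def by (intro sum.cong) (auto simp: theta_def)
  then show ?thesis using assms by simp
qed

text \<open>
  A wedge product vanishes on infinite index sets, since it is a sum over an infinite power set there,
  whereas \<open>emul\<close> need not. The two agree on forms with this property.
\<close>
definition fin_form :: "'g form \<Rightarrow> bool" where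
  "fin_form \<beta> \<longleftrightarrow> (\<forall>K. infinite K \<longrightarrow> \<beta> K = 0)"

lemma wedge_infinite: "infinite K \<Longrightarrow> wedge \<alpha> \<beta> K = 0"
  by (simp add: wedge_def fun_eq_iff)

lemma wedge_theta_single:
  assumes "fin_form \<beta>" shows "wedge (theta {j}) \<beta> = emul j \<beta>"
proof (intro ext)
  fix K x show "wedge (theta {j}) \<beta> K x = emul j \<beta> K x"
    using assms by (cases "finite K")
      (simp_all add: wedge_theta emul_def shuffle_sign_single ord_sign_remove wedge_infinite fin_form_def)
qed

lemma fin_form_theta: "finite J \<Longrightarrow> fin_form (theta J)"
  by (auto simp: fin_form_def theta_def fun_eq_iff)

lemma fin_form_emul: "fin_form \<beta> \<Longrightarrow> fin_form (emul j \<beta>)"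
  by (auto simp: fin_form_def emul_def fun_eq_iff)

lemma wedge_theta_theta: "i < j \<Longrightarrow> wedge (theta {i}) (theta {j}) = theta {i, j}"
proof (intro ext)
  fix K x assume "i < j"
  then have *: "i \<in> K \<and> K - {i} = {j} \<longleftrightarrow> K = {i, j}" by auto
  have **: "ord_sign i {i, j} = 1" if "i < j"
  proof -
    have "{l \<in> {i, j}. l < i} = {}" using that by auto
    then show ?thesis by (simp only: ord_sign_def card.empty power_0)
  qed
  show "wedge (theta {i}) (theta {j}) K x = theta {i, j} K x"
    using * ** \<open>i < j\<close> by (simp add: wedge_theta_single fin_form_theta emul_def) (auto simp: theta_def)
qed

lemma wedge_theta_pair:
  assumes "i < j" "fin_form \<beta>" shows "wedge (theta {i, j}) \<beta> = emul i (emul j \<beta>)"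
proof (intro ext)
  fix K x
  show "wedge (theta {i, j}) \<beta> K x = emul i (emul j \<beta>) K x"
  proof (cases "finite K \<and> i \<in> K \<and> j \<in> K")
    case True
    have eq: "K - {i, j} = K - {i} - {j}" by auto
    have "ord_sign i (K - {i} - {j}) = ord_sign i K" "ord_sign j (K - {i} - {j}) = - ord_sign j K"
      "ord_sign j (K - {i}) = - ord_sign j K"
      using True assms(1) by (simp_all add: ord_sign_remove)
    then show ?thesis using True assms(1)
      by (simp add: wedge_theta shuffle_sign_pair eq) (simp add: emul_def)
  next
    case False
    have "infinite K \<Longrightarrow> emul i (emul j \<beta>) K x = 0"
      using fin_form_emul[OF fin_form_emul[OF assms(2)]] by (simp add: fin_form_def)
    with False show ?thesis
      by (cases "finite K") (auto simp: wedge_theta wedge_infinite emul_def)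
  qed
qed

lemma wedge_add_left: "wedge (\<alpha> + \<alpha>') \<beta> = wedge \<alpha> \<beta> + wedge \<alpha>' \<beta>"
  by (simp add: wedge_def fun_eq_iff algebra_simps sum.distrib)

lemma wedge_minus_left: "wedge (- \<alpha>) \<beta> = - wedge \<alpha> \<beta>"
  by (simp add: wedge_def fun_eq_iff sum_negf)

lemma wedge_scl_left: "wedge (scl c \<alpha>) \<beta> = scl c (wedge \<alpha> \<beta>)"
  by (simp add: wedge_def scl_def fun_eq_iff sum_distrib_left mult_ac)

lemma wedge_fmul_left: "wedge (fmul f \<alpha>) \<beta> = fmul f (wedge \<alpha> \<beta>)"
  by (simp add: wedge_def fmul_def fun_eq_iff sum_distrib_left mult_ac)

lemmas wedge_sum_left = additive_sum[of "\<lambda>\<alpha>. wedge \<alpha> \<beta>" for \<beta>, OF wedge_add_left]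

lemma fmul_add: "fmul f (\<alpha> + \<beta>) = fmul f \<alpha> + fmul f \<beta>"
  by (simp add: fmul_def fun_eq_iff algebra_simps)

lemma fmul_scl: "fmul f (scl c \<alpha>) = scl c (fmul f \<alpha>)"
  by (simp add: fmul_def scl_def fun_eq_iff)

lemmas fmul_sum = additive_sum[of "fmul f" for f, OF fmul_add]

lemma scl_add: "scl c (\<alpha> + \<beta>) = scl c \<alpha> + scl c \<beta>"
  by (rule vf.scale_right_distrib)

text \<open>
  Passes from sums over all pairs of indices, for which calculations are symmetric, to the sums over
  \<open>i < j\<close> that appear in the Maurer--Cartan equations.
\<close>
lemma sum_offdiag:
  fixes G :: "nat \<Rightarrow> nat \<Rightarrow> 'a::comm_monoid_add"
  assumes "finite M" "\<And>i. i \<in> M \<Longrightarrow> G i i = 0"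
  shows "(\<Sum>i\<in>M. \<Sum>j\<in>M. G i j) = (\<Sum>(i, j) \<in> {(i, j). i \<in> M \<and> j \<in> M \<and> i < j}. G i j + G j i)"
proof -
  let ?U = "{(i, j). i \<in> M \<and> j \<in> M \<and> i < j}" and ?L = "{(i, j). i \<in> M \<and> j \<in> M \<and> j < i}"
    and ?D = "{(i, j). i \<in> M \<and> j \<in> M \<and> i = j}"
  have fin: "finite ?U" "finite ?L" "finite ?D"
    using assms(1) by (auto intro: finite_subset[of _ "M \<times> M"])
  have "(\<Sum>i\<in>M. \<Sum>j\<in>M. G i j) = (\<Sum>(i, j)\<in>M \<times> M. G i j)"
    by (rule sum.cartesian_product)
  also have "M \<times> M = (?U \<union> ?L) \<union> ?D" by auto
  also have "(\<Sum>(i, j)\<in>(?U \<union> ?L) \<union> ?D. G i j) = (\<Sum>(i, j)\<in>?U \<union> ?L. G i j) + (\<Sum>(i, j)\<in>?D. G i j)"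
    using fin by (intro sum.union_disjoint) auto
  also have "(\<Sum>(i, j)\<in>?D. G i j) = 0"
    using assms(2) by (intro sum.neutral) auto
  also have "(\<Sum>(i, j)\<in>?U \<union> ?L. G i j) = (\<Sum>(i, j)\<in>?U. G i j) + (\<Sum>(i, j)\<in>?L. G i j)"
    using fin by (intro sum.union_disjoint) auto
  also have "(\<Sum>(i, j)\<in>?L. G i j) = (\<Sum>(i, j)\<in>?U. G j i)"
    by (rule sum.reindex_bij_witness[of _ prod.swap prod.swap]) auto
  finally show ?thesis by (simp only: sum.distrib case_prod_unfold add_0_right)
qed

text \<open>
  The combinatorial core of \<open>d\<^sub>0\<^sup>2 = 0\<close>. With \<open>E3\<close> standing for \<open>e\<^sub>ie\<^sub>je\<^sub>b\<iota>\<^sub>l\<close> and \<open>E4\<close> for \<open>e\<^sub>ie\<^sub>je\<^sub>ae\<^sub>b\<iota>\<^sub>k\<iota>\<^sub>l\<close>, the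
  summand is \<open>e\<^sub>ie\<^sub>j\<iota>\<^sub>ke\<^sub>ae\<^sub>b\<iota>\<^sub>l\<close> with \<open>\<iota>\<^sub>k\<close> moved to the right. The \<open>E4\<close> terms cancel because exchanging the two
  triples of indices changes the sign. By antisymmetry of \<open>s\<close>, the two \<open>E3\<close> terms contribute the same
  sum \<open>A\<close>, and the average of \<open>A\<close> over the cyclic rotations of \<open>(i, j, b)\<close> vanishes by the Jacobi
  identity.
\<close>
lemma Jacobi_sum_zero:
  fixes s :: "nat \<Rightarrow> nat \<Rightarrow> nat \<Rightarrow> real" and E3 :: "nat \<Rightarrow> nat \<Rightarrow> nat \<Rightarrow> nat \<Rightarrow> real"
    and E4 :: "nat \<Rightarrow> nat \<Rightarrow> nat \<Rightarrow> nat \<Rightarrow> nat \<Rightarrow> nat \<Rightarrow> real"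
  assumes "finite M"
    and anti: "\<And>i j k. i \<in> M \<Longrightarrow> j \<in> M \<Longrightarrow> s j i k = - s i j k"
    and Jac: "\<And>i j b l. \<lbrakk>i \<in> M; j \<in> M; b \<in> M\<rbrakk> \<Longrightarrow>
      (\<Sum>k\<in>M. s i j k * s k b l) + (\<Sum>k\<in>M. s j b k * s k i l) + (\<Sum>k\<in>M. s b i k * s k j l) = 0"
    and cyc: "\<And>i j b l. E3 i j b l = E3 j b i l"
    and anti4: "\<And>i j k a b l. E4 i j k a b l = - E4 a b l i j k"
  shows "(\<Sum>i\<in>M. \<Sum>j\<in>M. \<Sum>k\<in>M. \<Sum>a\<in>M. \<Sum>b\<in>M. \<Sum>l\<in>M. s i j k * s a b l *
     ((if k = a then E3 i j b l else 0) - (if k = b then E3 i j a l else 0) + E4 i j k a b l)) = 0"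
proof -
  define A where "A = (\<Sum>i\<in>M. \<Sum>j\<in>M. \<Sum>k\<in>M. \<Sum>b\<in>M. \<Sum>l\<in>M. s i j k * s k b l * E3 i j b l)"
  define C where "C = (\<Sum>i\<in>M. \<Sum>j\<in>M. \<Sum>k\<in>M. \<Sum>a\<in>M. \<Sum>b\<in>M. \<Sum>l\<in>M. s i j k * s a b l * E4 i j k a b l)"
  have 1: "(\<Sum>a\<in>M. \<Sum>b\<in>M. \<Sum>l\<in>M. s i j k * s a b l * (if k = a then E3 i j b l else 0))
      = (\<Sum>b\<in>M. \<Sum>l\<in>M. s i j k * s k b l * E3 i j b l)" if "k \<in> M" for i j k
  proof -
    have "(\<Sum>a\<in>M. \<Sum>b\<in>M. \<Sum>l\<in>M. s i j k * s a b l * (if k = a then E3 i j b l else 0))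
       = (\<Sum>a\<in>M. if k = a then (\<Sum>b\<in>M. \<Sum>l\<in>M. s i j k * s k b l * E3 i j b l) else 0)"
      by (intro sum.cong) auto
    then show ?thesis using that assms(1) by simp
  qed
  have 2: "(\<Sum>a\<in>M. \<Sum>b\<in>M. \<Sum>l\<in>M. s i j k * s a b l * (if k = b then E3 i j a l else 0))
      = - (\<Sum>b\<in>M. \<Sum>l\<in>M. s i j k * s k b l * E3 i j b l)" if "k \<in> M" for i j k
  proof -
    have "(\<Sum>b\<in>M. \<Sum>l\<in>M. s i j k * s a b l * (if k = b then E3 i j a l else 0))
        = - (\<Sum>l\<in>M. s i j k * s k a l * E3 i j a l)" if "a \<in> M" for a
    proof -
      have "(\<Sum>b\<in>M. \<Sum>l\<in>M. s i j k * s a b l * (if k = b then E3 i j a l else 0))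
        = (\<Sum>b\<in>M. if k = b then (\<Sum>l\<in>M. s i j k * s a k l * E3 i j a l) else 0)"
        by (intro sum.cong) auto
      also have "\<dots> = (\<Sum>l\<in>M. s i j k * s a k l * E3 i j a l)"
        using \<open>k \<in> M\<close> assms(1) by simp
      also have "\<dots> = (\<Sum>l\<in>M. - (s i j k * s k a l * E3 i j a l))"
        using anti[OF \<open>k \<in> M\<close> \<open>a \<in> M\<close>] by (intro sum.cong) simp_all
      finally show ?thesis by (simp add: sum_negf)
    qed
    then show ?thesis by (simp add: sum_negf)
  qed
  have "(\<Sum>i\<in>M. \<Sum>j\<in>M. \<Sum>k\<in>M. \<Sum>a\<in>M. \<Sum>b\<in>M. \<Sum>l\<in>M. s i j k * s a b l *
     ((if k = a then E3 i j b l else 0) - (if k = b then E3 i j a l else 0) + E4 i j k a b l))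
    = (\<Sum>i\<in>M. \<Sum>j\<in>M. \<Sum>k\<in>M. 
        (\<Sum>a\<in>M. \<Sum>b\<in>M. \<Sum>l\<in>M. s i j k * s a b l * (if k = a then E3 i j b l else 0))
      - (\<Sum>a\<in>M. \<Sum>b\<in>M. \<Sum>l\<in>M. s i j k * s a b l * (if k = b then E3 i j a l else 0))
      + (\<Sum>a\<in>M. \<Sum>b\<in>M. \<Sum>l\<in>M. s i j k * s a b l * E4 i j k a b l))"
    by (simp only: distrib_left right_diff_distrib sum.distrib sum_subtractf)
  also have "\<dots> = (\<Sum>i\<in>M. \<Sum>j\<in>M. \<Sum>k\<in>M. 
        (\<Sum>b\<in>M. \<Sum>l\<in>M. s i j k * s k b l * E3 i j b l)
      + (\<Sum>b\<in>M. \<Sum>l\<in>M. s i j k * s k b l * E3 i j b l)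
      + (\<Sum>a\<in>M. \<Sum>b\<in>M. \<Sum>l\<in>M. s i j k * s a b l * E4 i j k a b l))"
    by (intro sum.cong refl) (simp add: 1 2)
  also have "\<dots> = A + A + C"
    by (simp only: sum.distrib A_def C_def)
  also have "C = 0"
  proof -
    let ?M = "M \<times> M \<times> M"
    define F where "F p q = (case (p, q) of ((i, j, k), (a, b, l)) \<Rightarrow> s i j k * s a b l * E4 i j k a b l)" for p q
    have t: "(\<Sum>p\<in>?M. f p) = (\<Sum>i\<in>M. \<Sum>j\<in>M. \<Sum>k\<in>M. f (i, j, k))" for f :: "nat \<times> nat \<times> nat \<Rightarrow> real"
      by (simp add: sum.cartesian_product case_prod_unfold)
    have C: "C = (\<Sum>p\<in>?M. \<Sum>q\<in>?M. F p q)"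
      unfolding C_def F_def t by simp
    also have "\<dots> = (\<Sum>q\<in>?M. \<Sum>p\<in>?M. F p q)" by (rule sum.swap)
    also have "\<dots> = (\<Sum>q\<in>?M. \<Sum>p\<in>?M. - F q p)"
    proof (intro sum.cong refl)
      fix p q :: "nat \<times> nat \<times> nat"
      obtain i j k a b l where pq: "p = (i, j, k)" "q = (a, b, l)" by (metis prod_cases3)
      show "F p q = - F q p" unfolding pq F_def using anti4[of i j k a b l] by simp
    qed
    also have "\<dots> = - C" unfolding C by (simp add: sum_negf)
    finally show ?thesis by simp
  qed
  also have "A = 0"
  proof -
    define T where "T i j b l = (\<Sum>k\<in>M. s i j k * s k b l)" for i j b l
    have A: "A = (\<Sum>i\<in>M. \<Sum>j\<in>M. \<Sum>b\<in>M. \<Sum>l\<in>M. T i j b l * E3 i j b l)"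
    proof -
      have "(\<Sum>k\<in>M. \<Sum>b\<in>M. \<Sum>l\<in>M. s i j k * s k b l * E3 i j b l)
         = (\<Sum>b\<in>M. \<Sum>l\<in>M. T i j b l * E3 i j b l)" for i j
      proof -
        have "(\<Sum>k\<in>M. \<Sum>b\<in>M. \<Sum>l\<in>M. s i j k * s k b l * E3 i j b l)
           = (\<Sum>b\<in>M. \<Sum>k\<in>M. \<Sum>l\<in>M. s i j k * s k b l * E3 i j b l)" by (rule sum.swap)
        also have "\<dots> = (\<Sum>b\<in>M. \<Sum>l\<in>M. \<Sum>k\<in>M. s i j k * s k b l * E3 i j b l)"
          by (intro sum.cong refl sum.swap)
        finally show ?thesis by (simp add: T_def sum_distrib_right)
      qed
      then show ?thesis by (simp add: A_def)
    qed
    have rot: "(\<Sum>i\<in>M. \<Sum>j\<in>M. \<Sum>b\<in>M. H i j b) = (\<Sum>i\<in>M. \<Sum>j\<in>M. \<Sum>b\<in>M. H j b i)" for H :: "nat \<Rightarrow> nat \<Rightarrow> nat \<Rightarrow> real"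
    proof -
      have "(\<Sum>i\<in>M. \<Sum>j\<in>M. \<Sum>b\<in>M. H j b i) = (\<Sum>j\<in>M. \<Sum>i\<in>M. \<Sum>b\<in>M. H j b i)" by (rule sum.swap)
      also have "\<dots> = (\<Sum>j\<in>M. \<Sum>b\<in>M. \<Sum>i\<in>M. H j b i)" by (intro sum.cong refl sum.swap)
      finally show ?thesis by simp
    qed
    have B: "A = (\<Sum>i\<in>M. \<Sum>j\<in>M. \<Sum>b\<in>M. \<Sum>l\<in>M. T j b i l * E3 i j b l)"
      unfolding A by (subst rot) (simp add: cyc[symmetric])
    have C: "A = (\<Sum>i\<in>M. \<Sum>j\<in>M. \<Sum>b\<in>M. \<Sum>l\<in>M. T b i j l * E3 i j b l)"
      unfolding B by (subst rot[of "\<lambda>i j b. \<Sum>l\<in>M. T j b i l * E3 i j b l"]) (simp add: cyc[symmetric])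
    have "A + A + A = (\<Sum>i\<in>M. \<Sum>j\<in>M. \<Sum>b\<in>M. \<Sum>l\<in>M. (T i j b l + T j b i l + T b i j l) * E3 i j b l)"
      by (subst (3) C, subst (2) B, subst A) (simp only: sum.distrib[symmetric] distrib_right)
    also have "\<dots> = 0"
      using Jac by (intro sum.neutral ballI) (simp add: T_def)
    finally show ?thesis by simp
  qed
  finally show ?thesis by simp
qed

lemma additive_on_sum:
  fixes F :: "'a::ab_group_add \<Rightarrow> 'b::ab_group_add"
  assumes "\<And>a b. a \<in> V \<Longrightarrow> b \<in> V \<Longrightarrow> F (a + b) = F a + F b"
    and "0 \<in> V" "\<And>a b. a \<in> V \<Longrightarrow> b \<in> V \<Longrightarrow> a + b \<in> V" "\<And>i. i \<in> I \<Longrightarrow> g i \<in> V"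
  shows "F (\<Sum>i\<in>I. g i) = (\<Sum>i\<in>I. F (g i))"
proof -
  have F0: "F 0 = 0" using assms(1)[OF assms(2,2)] by simp
  have "(\<Sum>i\<in>I. g i) \<in> V \<and> F (\<Sum>i\<in>I. g i) = (\<Sum>i\<in>I. F (g i))"
    using assms(4)
  proof (induction I rule: infinite_finite_induct)
    case (insert i I)
    then show ?case using assms(1,3) by simp
  qed (simp_all add: F0 assms(2))
  then show ?thesis ..
qed

text \<open>
  Two transpositions, hence no sign.
\<close>
lemma emul_rotate: "emul i (emul j (emul l \<beta>)) = emul l (emul i (emul j \<beta>))"
proof -
  have "emul l (emul i (emul j \<beta>)) = - emul i (emul l (emul j \<beta>))" by (rule emul_anti)
  also have "emul l (emul j \<beta>) = - emul j (emul l \<beta>)" by (rule emul_anti)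
  finally show ?thesis by (simp only: emul_minus minus_minus)
qed

context carnot_frame
begin

section \<open>Forms with prescribed support\<close>

text \<open>
  Forms of a given weight and forms of a given degree are both of this kind, so closure properties
  are proved once for all of them.
\<close>
definition FS :: "nat set set \<Rightarrow> 'g form set" where
  "FS A = {\<alpha> \<in> Forms S. \<forall>J. \<alpha> J \<noteq> 0 \<longrightarrow> J \<in> A}"

lemma FS_UNIV: "Forms S = FS UNIV"
  by (auto simp: FS_def)

lemma Forms_wt_FS: "Forms_wt S p = FS {J. int (wtset S J) = p}"
  by (simp add: FS_def Forms_wt_def)

lemma Forms_deg_FS: "Forms_deg S h = FS {J. card J = h}"
  by (simp add: FS_def Forms_deg_def)

lemma FS_iff: "\<alpha> \<in> FS A \<longleftrightarrow> (\<forall>J. \<alpha> J \<in> Csm) \<and> (\<forall>J. \<alpha> J \<noteq> 0 \<longrightarrow> J \<subseteq> N \<and> J \<in> A)"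
  by (auto simp: FS_def Forms_def)

lemma FS_I:
  assumes "\<And>J. \<alpha> J \<in> Csm" "\<And>J x. \<alpha> J x \<noteq> 0 \<Longrightarrow> J \<subseteq> N \<and> J \<in> A"
  shows "\<alpha> \<in> FS A"
  using assms by (auto simp: FS_iff fun_eq_iff)

lemma FS_Csm: "\<alpha> \<in> FS A \<Longrightarrow> \<alpha> J \<in> Csm"
  by (simp add: FS_iff)

lemma FS_D: "\<alpha> \<in> FS A \<Longrightarrow> \<alpha> J x \<noteq> 0 \<Longrightarrow> J \<subseteq> N \<and> J \<in> A"
  by (auto simp: FS_iff fun_eq_iff)

lemma FS_Forms: "\<alpha> \<in> FS A \<Longrightarrow> \<alpha> \<in> Forms S"
  by (simp add: FS_def)

lemma Forms_Csm: "\<alpha> \<in> Forms S \<Longrightarrow> \<alpha> J \<in> Csm"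
  by (simp add: Forms_def)

lemma FS_mono: "\<alpha> \<in> FS A \<Longrightarrow> A \<inter> Pow N \<subseteq> B \<Longrightarrow> \<alpha> \<in> FS B"
  by (auto simp: FS_iff)

lemma FS_0: "0 \<in> FS A"
  using Cinf_0 by (simp add: FS_iff)

lemma FS_add:
  assumes "\<alpha> \<in> FS A" "\<beta> \<in> FS A" shows "\<alpha> + \<beta> \<in> FS A"
proof (rule FS_I)
  fix J x
  show "(\<alpha> + \<beta>) J \<in> Csm"
    using Cinf_add[OF FS_Csm[OF assms(1)] FS_Csm[OF assms(2)]] by simp
  assume "(\<alpha> + \<beta>) J x \<noteq> 0"
  then have "\<alpha> J x \<noteq> 0 \<or> \<beta> J x \<noteq> 0" by auto
  then show "J \<subseteq> N \<and> J \<in> A" using FS_D[OF assms(1)] FS_D[OF assms(2)] by blast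
qed

lemma FS_scl:
  assumes "\<alpha> \<in> FS A" shows "scl c \<alpha> \<in> FS A"
proof (rule FS_I)
  fix J x
  show "scl c \<alpha> J \<in> Csm" unfolding scl_def by (rule Cinf_cmult[OF FS_Csm[OF assms]])
  show "scl c \<alpha> J x \<noteq> 0 \<Longrightarrow> J \<subseteq> N \<and> J \<in> A"
    using FS_D[OF assms, of J x] by (simp add: scl_def)
qed

lemma FS_minus: "\<alpha> \<in> FS A \<Longrightarrow> - \<alpha> \<in> FS A"
  using FS_scl[of \<alpha> A "-1"] by simp

lemma FS_diff: "\<alpha> \<in> FS A \<Longrightarrow> \<beta> \<in> FS A \<Longrightarrow> \<alpha> - \<beta> \<in> FS A"
  using FS_add[of \<alpha> A "- \<beta>"] FS_minus[of \<beta> A] by simp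

lemma FS_sum: "(\<And>i. i \<in> I \<Longrightarrow> F i \<in> FS A) \<Longrightarrow> sum F I \<in> FS A"
proof (induction I rule: infinite_finite_induct)
  case (insert i I)
  then show ?case unfolding sum.insert[OF insert.hyps(1,2)] by (intro FS_add) simp_all
qed (simp_all add: FS_0)

lemmas Forms_add = FS_add[where A = UNIV, folded FS_UNIV]
  and Forms_scl = FS_scl[where A = UNIV, folded FS_UNIV]
  and Forms_minus = FS_minus[where A = UNIV, folded FS_UNIV]
  and Forms_diff = FS_diff[where A = UNIV, folded FS_UNIV]
  and Forms_sum = FS_sum[where A = UNIV, folded FS_UNIV]
  and Forms_0 = FS_0[where A = UNIV, folded FS_UNIV]

lemma FS_emul:
  assumes "j \<in> N" "\<alpha> \<in> FS A" "\<And>K. j \<in> K \<Longrightarrow> K \<subseteq> N \<Longrightarrow> K - {j} \<in> A \<Longrightarrow> K \<in> B"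
  shows "emul j \<alpha> \<in> FS B"
proof (rule FS_I)
  fix K x
  show "emul j \<alpha> K \<in> Csm"
    unfolding emul_def by (cases "j \<in> K") (simp_all add: Cinf_cmult FS_Csm[OF assms(2)] Cinf_const)
  assume "emul j \<alpha> K x \<noteq> 0"
  then have j: "j \<in> K" and "\<alpha> (K - {j}) x \<noteq> 0" by (auto simp: emul_def split: if_splits)
  from FS_D[OF assms(2) this(2)] have "K - {j} \<subseteq> N" "K - {j} \<in> A" by auto
  moreover from this(1) have "K \<subseteq> N" using assms(1) by blast
  ultimately show "K \<subseteq> N \<and> K \<in> B" using assms(3)[OF j] by blast
qed

lemma FS_contr:
  assumes "\<alpha> \<in> FS A" "\<And>K. j \<notin> K \<Longrightarrow> insert j K \<subseteq> N \<Longrightarrow> insert j K \<in> A \<Longrightarrow> K \<in> B"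
  shows "contr j \<alpha> \<in> FS B"
proof (rule FS_I)
  fix K x
  show "contr j \<alpha> K \<in> Csm"
    unfolding contr_def by (cases "j \<in> K") (simp_all add: Cinf_cmult FS_Csm[OF assms(1)] Cinf_const)
  assume "contr j \<alpha> K x \<noteq> 0"
  then have j: "j \<notin> K" and "\<alpha> (insert j K) x \<noteq> 0" by (auto simp: contr_def split: if_splits)
  from FS_D[OF assms(1) this(2)] show "K \<subseteq> N \<and> K \<in> B" using assms(2)[OF j] by blast
qed

definition cder :: "nat \<Rightarrow> 'g form \<Rightarrow> 'g form" where
  "cder j \<alpha> = (\<lambda>K. X j (\<alpha> K))"

lemma FS_cder:
  assumes "j \<in> N" "\<alpha> \<in> FS A" shows "cder j \<alpha> \<in> FS A"
proof (rule FS_I)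
  fix K x
  show "cder j \<alpha> K \<in> Csm"
    unfolding cder_def by (rule liealg_D(1)[OF frame_liealg[OF assms(1)] FS_Csm[OF assms(2)]])
  assume *: "cder j \<alpha> K x \<noteq> 0"
  have "\<alpha> K \<noteq> 0"
  proof
    assume "\<alpha> K = 0"
    then show False using * liealg_0[OF frame_liealg[OF assms(1)]] by (simp add: cder_def)
  qed
  then show "K \<subseteq> N \<and> K \<in> A" using assms(2) by (simp add: FS_iff)
qed

lemma Forms_emul: "j \<in> N \<Longrightarrow> \<alpha> \<in> Forms S \<Longrightarrow> emul j \<alpha> \<in> Forms S"
  unfolding FS_UNIV by (erule FS_emul) auto

lemma Forms_contr: "\<alpha> \<in> Forms S \<Longrightarrow> contr j \<alpha> \<in> Forms S"
  unfolding FS_UNIV by (erule FS_contr) auto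

lemma Forms_cder: "j \<in> N \<Longrightarrow> \<alpha> \<in> Forms S \<Longrightarrow> cder j \<alpha> \<in> Forms S"
  unfolding FS_UNIV by (rule FS_cder)

lemma cder_add:
  assumes "j \<in> N" "\<alpha> \<in> Forms S" "\<beta> \<in> Forms S"
  shows "cder j (\<alpha> + \<beta>) = cder j \<alpha> + cder j \<beta>"
  using liealg_D(3)[OF frame_liealg[OF assms(1)] Forms_Csm[OF assms(2)] Forms_Csm[OF assms(3)]]
  by (simp add: cder_def fun_eq_iff)

lemma cder_scl:
  assumes "j \<in> N" "\<alpha> \<in> Forms S"
  shows "cder j (scl c \<alpha>) = scl c (cder j \<alpha>)"
  using liealg_D(4)[OF frame_liealg[OF assms(1)] Forms_Csm[OF assms(2)]]
  by (simp add: cder_def scl_def)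

lemma cder_emul:
  assumes "j \<in> N" "\<alpha> \<in> Forms S"
  shows "cder j (emul i \<alpha>) = emul i (cder j \<alpha>)"
proof
  fix K show "cder j (emul i \<alpha>) K = emul i (cder j \<alpha>) K"
    using liealg_D(4)[OF frame_liealg[OF assms(1)] Forms_Csm[OF assms(2)]] liealg_0[OF frame_liealg[OF assms(1)]]
    by (cases "i \<in> K") (simp_all add: cder_def emul_def zero_fun_def)
qed

lemma cder_contr:
  assumes "j \<in> N" "\<alpha> \<in> Forms S"
  shows "cder j (contr i \<alpha>) = contr i (cder j \<alpha>)"
proof
  fix K show "cder j (contr i \<alpha>) K = contr i (cder j \<alpha>) K"
    using liealg_D(4)[OF frame_liealg[OF assms(1)] Forms_Csm[OF assms(2)]] liealg_0[OF frame_liealg[OF assms(1)]]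
    by (cases "i \<in> K") (simp_all add: cder_def contr_def zero_fun_def)
qed

lemma cder_sum:
  assumes "j \<in> N" "\<And>i. i \<in> I \<Longrightarrow> F i \<in> Forms S"
  shows "cder j (\<Sum>i\<in>I. F i) = (\<Sum>i\<in>I. cder j (F i))"
  by (rule additive_on_sum[where V = "Forms S"]) ((assumption | rule cder_add assms Forms_0 Forms_add)+)

lemma cder_commutator:
  assumes "i \<in> N" "j \<in> N"
  shows "cder i (cder j \<alpha>) - cder j (cder i \<alpha>) = (\<Sum>k\<in>N. scl (sc i j k) (cder k \<alpha>))"
proof (intro ext)
  fix K x
  have "(cder i (cder j \<alpha>) - cder j (cder i \<alpha>)) K x = bracket (X i) (X j) (\<alpha> K) x"
    by (simp add: cder_def bracket_def)
  also have "\<dots> = (\<Sum>k\<in>N. scl (sc i j k) (X k)) (\<alpha> K) x"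
    by (simp only: bracket_frame(2)[OF assms, symmetric])
  also have "\<dots> = (\<Sum>k\<in>N. scl (sc i j k) (cder k \<alpha>)) K x"
    by (simp only: sum_fun_apply2) (simp add: cder_def scl_def)
  finally show "(cder i (cder j \<alpha>) - cder j (cder i \<alpha>)) K x = (\<Sum>k\<in>N. scl (sc i j k) (cder k \<alpha>)) K x" .
qed

section \<open>The exterior differential and \<open>d\<^sup>2 = 0\<close>\<close>

text \<open>
  The part of \<open>d\<close> that differentiates coefficients; it is \<open>d\<^sub>1 + \<dots> + d\<^sub>s\<close>.
\<close>
definition dcoef :: "'g form \<Rightarrow> 'g form" where
  "dcoef \<alpha> = (\<Sum>j\<in>N. emul j (cder j \<alpha>))"

text \<open>
  The part of \<open>d\<close> coming from the Maurer--Cartan equations; it will turn out to be \<open>d\<^sub>0\<close>.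
\<close>
definition d0op :: "'g form \<Rightarrow> 'g form" where
  "d0op \<alpha> = (\<Sum>i\<in>N. \<Sum>j\<in>N. \<Sum>k\<in>N. scl (- sc i j k / 2) (emul i (emul j (contr k \<alpha>))))"

lemma form_expand:
  assumes "\<alpha> \<in> Forms S" shows "(\<Sum>J\<in>Pow N. fmul (\<alpha> J) (theta J)) = \<alpha>"
proof (intro ext)
  fix K x
  have "(\<Sum>J\<in>Pow N. fmul (\<alpha> J) (theta J)) K x = (\<Sum>J\<in>Pow N. if J = K then \<alpha> K x else 0)"
    unfolding sum_fun_apply2 by (intro sum.cong) (auto simp: fmul_def theta_def)
  also have "\<dots> = \<alpha> K x"
    using assms FS_D[of \<alpha> UNIV K x] unfolding FS_UNIV by (auto simp: sum.delta)
  finally show "(\<Sum>J\<in>Pow N. fmul (\<alpha> J) (theta J)) K x = \<alpha> K x" .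
qed

lemma d0op_add: "d0op (\<alpha> + \<beta>) = d0op \<alpha> + d0op \<beta>"
  by (simp only: d0op_def contr_add emul_add scl_add sum.distrib)

lemma d0op_fmul: "d0op (fmul f \<alpha>) = fmul f (d0op \<alpha>)"
  by (simp only: d0op_def contr_fmul emul_fmul fmul_scl fmul_sum)

lemma d0op_scl: "d0op (scl c \<alpha>) = scl c (d0op \<alpha>)"
  using d0op_fmul[of "\<lambda>_. c" \<alpha>] by (simp add: fmul_def scl_def times_fun_def)

lemmas d0op_sum = additive_sum[of d0op, OF d0op_add]

text \<open>
  The exterior product with \<open>d\<theta>\<^sub>k\<close>.
\<close>
definition d0k :: "nat \<Rightarrow> 'g form \<Rightarrow> 'g form" where
  "d0k k \<beta> = - (\<Sum>(i, j) \<in> {(i, j). i \<in> N \<and> j \<in> N \<and> i < j}. scl (sc i j k) (emul i (emul j \<beta>)))"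

lemma d0k_scl: "d0k k (scl c \<beta>) = scl c (d0k k \<beta>)"
  by (simp add: d0k_def emul_scl vf.scale_sum_right case_prod_unfold mult.commute)

lemma wedge_d_theta1:
  assumes "fin_form \<beta>" shows "wedge (d_theta1 S k) \<beta> = d0k k \<beta>"
  unfolding d_theta1_def d0k_def wedge_minus_left wedge_sum_left case_prod_unfold wedge_scl_left
  by (intro arg_cong[where f = uminus] sum.cong refl)
     (auto simp: wedge_theta_theta wedge_theta_pair assms sc_def)

lemma d0op_d0k: "d0op \<beta> = (\<Sum>k\<in>N. d0k k (contr k \<beta>))"
proof -
  let ?U = "{(i, j). i \<in> N \<and> j \<in> N \<and> i < j}"
  define G where "G i j = (\<Sum>k\<in>N. scl (- sc i j k / 2) (emul i (emul j (contr k \<beta>))))" for i j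
  have "d0op \<beta> = (\<Sum>(i, j)\<in>?U. G i j + G j i)"
    unfolding d0op_def G_def[symmetric] by (rule sum_offdiag) (simp_all add: G_def sc_diag)
  also have "\<dots> = (\<Sum>(i, j)\<in>?U. \<Sum>k\<in>N. - scl (sc i j k) (emul i (emul j (contr k \<beta>))))"
  proof (intro sum.cong refl, safe)
    fix i j assume ij: "i \<in> N" "j \<in> N"
    show "G i j + G j i = (\<Sum>k\<in>N. - scl (sc i j k) (emul i (emul j (contr k \<beta>))))"
      unfolding G_def sum.distrib[symmetric]
    proof (intro sum.cong refl)
      fix k
      show "scl (- sc i j k / 2) (emul i (emul j (contr k \<beta>))) + scl (- sc j i k / 2) (emul j (emul i (contr k \<beta>)))
        = - scl (sc i j k) (emul i (emul j (contr k \<beta>)))"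
        unfolding sc_anti[OF ij] emul_anti[of j i] by (simp add: scl_def fun_eq_iff)
    qed
  qed
  also have "\<dots> = (\<Sum>k\<in>N. \<Sum>(i, j)\<in>?U. - scl (sc i j k) (emul i (emul j (contr k \<beta>))))"
    unfolding case_prod_unfold by (rule sum.swap)
  finally show ?thesis by (simp add: d0k_def sum_negf case_prod_unfold)
qed

text \<open>
  The alternating sum over the factors of \<open>\<theta>\<^sub>J\<close> in the Leibniz rule is the sum over the contractions
  \<open>\<iota>\<^sub>k\<theta>\<^sub>J\<close>.
\<close>
lemma d_theta_d0op:
  assumes "J \<subseteq> N" shows "d_theta S J = d0op (theta J)"
proof -
  have fin: "finite J" using assms finite_subset by blast
  have "d_theta S J = (\<Sum>k\<in>J. scl (ord_sign k J) (d0k k (theta (J - {k}))))"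
    unfolding d_theta_def ord_sign_def[symmetric] using fin
    by (intro sum.cong refl) (simp add: wedge_d_theta1 fin_form_theta)
  also have "\<dots> = (\<Sum>k\<in>J. d0k k (contr k (theta J)))"
    by (intro sum.cong refl) (simp add: contr_theta d0k_scl)
  also have "\<dots> = (\<Sum>k\<in>N. d0k k (contr k (theta J)))"
  proof (rule sum.mono_neutral_left)
    have "d0k k 0 = 0" for k using d0k_scl[of k 0 0] by simp
    then show "\<forall>k\<in>N - J. d0k k (contr k (theta J)) = 0" by (simp add: contr_theta)
  qed (use assms in auto)
  finally show ?thesis by (simp add: d0op_d0k)
qed

lemma ext_d_eq:
  assumes "\<alpha> \<in> Forms S" shows "ext_d S \<alpha> = dcoef \<alpha> + d0op \<alpha>"
proof -
  have "ext_d S \<alpha> = (\<Sum>J\<in>Pow N. wedge (d_fun S (\<alpha> J)) (theta J)) + (\<Sum>J\<in>Pow N. fmul (\<alpha> J) (d_theta S J))"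
    unfolding ext_d_def by (rule sum.distrib)
  also have "(\<Sum>J\<in>Pow N. fmul (\<alpha> J) (d_theta S J)) = (\<Sum>J\<in>Pow N. d0op (fmul (\<alpha> J) (theta J)))"
    by (intro sum.cong refl) (simp add: d_theta_d0op d0op_fmul)
  also have "\<dots> = d0op \<alpha>" by (simp only: d0op_sum[symmetric] form_expand[OF assms])
  also have "(\<Sum>J\<in>Pow N. wedge (d_fun S (\<alpha> J)) (theta J)) = (\<Sum>J\<in>Pow N. \<Sum>j\<in>N. emul j (fmul (cder j \<alpha> J) (theta J)))"
  proof (intro sum.cong refl)
    fix J assume "J \<in> Pow N"
    then have "finite J" using finite_subset by blast
    then show "wedge (d_fun S (\<alpha> J)) (theta J) = (\<Sum>j\<in>N. emul j (fmul (cder j \<alpha> J) (theta J)))"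
      unfolding d_fun_def wedge_sum_left wedge_fmul_left
      by (simp add: wedge_theta_single fin_form_theta emul_fmul cder_def)
  qed
  also have "\<dots> = (\<Sum>j\<in>N. \<Sum>J\<in>Pow N. emul j (fmul (cder j \<alpha> J) (theta J)))" by (rule sum.swap)
  also have "\<dots> = dcoef \<alpha>"
    unfolding dcoef_def by (intro sum.cong refl) (simp only: emul_sum[symmetric] form_expand Forms_cder assms)
  finally show ?thesis .
qed

lemma dcoef_add: "\<alpha> \<in> Forms S \<Longrightarrow> \<beta> \<in> Forms S \<Longrightarrow> dcoef (\<alpha> + \<beta>) = dcoef \<alpha> + dcoef \<beta>"
  unfolding dcoef_def sum.distrib[symmetric] by (intro sum.cong refl) (simp only: cder_add emul_add)

lemma dcoef_scl: "\<alpha> \<in> Forms S \<Longrightarrow> dcoef (scl c \<alpha>) = scl c (dcoef \<alpha>)"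
  unfolding dcoef_def vf.scale_sum_right by (intro sum.cong refl) (simp only: cder_scl emul_scl)

lemma dcoef_sum:
  "(\<And>i. i \<in> I \<Longrightarrow> F i \<in> Forms S) \<Longrightarrow> dcoef (\<Sum>i\<in>I. F i) = (\<Sum>i\<in>I. dcoef (F i))"
  by (rule additive_on_sum[where V = "Forms S"]) ((assumption | rule dcoef_add Forms_0 Forms_add)+)

lemma Forms_dcoef: "\<alpha> \<in> Forms S \<Longrightarrow> dcoef \<alpha> \<in> Forms S"
  unfolding dcoef_def by (intro Forms_sum Forms_emul Forms_cder)

lemma Forms_d0op: "\<alpha> \<in> Forms S \<Longrightarrow> d0op \<alpha> \<in> Forms S"
  unfolding d0op_def by (intro Forms_sum Forms_scl Forms_emul Forms_contr)

text \<open>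
  Antisymmetry of \<open>e\<^sub>ie\<^sub>j\<close> turns \<open>X\<^sub>iX\<^sub>j\<close> into the commutator. The square is doubled in order to avoid
  halves; the cross terms below are minus half of the result.
\<close>
lemma dcoef_dcoef_double:
  assumes "\<alpha> \<in> Forms S"
  shows "dcoef (dcoef \<alpha>) + dcoef (dcoef \<alpha>) = (\<Sum>i\<in>N. \<Sum>j\<in>N. \<Sum>k\<in>N. scl (sc i j k) (emul i (emul j (cder k \<alpha>))))"
proof -
  have 1: "dcoef (dcoef \<alpha>) = (\<Sum>i\<in>N. \<Sum>j\<in>N. emul i (emul j (cder i (cder j \<alpha>))))"
    unfolding dcoef_def
  proof (intro sum.cong refl)
    fix i assume i: "i \<in> N"
    have "cder i (\<Sum>j\<in>N. emul j (cder j \<alpha>)) = (\<Sum>j\<in>N. cder i (emul j (cder j \<alpha>)))"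
      by (intro cder_sum i Forms_emul Forms_cder assms)
    also have "\<dots> = (\<Sum>j\<in>N. emul j (cder i (cder j \<alpha>)))"
      by (intro sum.cong refl cder_emul Forms_cder i assms)
    finally show "emul i (cder i (\<Sum>j\<in>N. emul j (cder j \<alpha>))) = (\<Sum>j\<in>N. emul i (emul j (cder i (cder j \<alpha>))))"
      by (simp only: emul_sum)
  qed
  also have "\<dots> = (\<Sum>j\<in>N. \<Sum>i\<in>N. emul i (emul j (cder i (cder j \<alpha>))))" by (rule sum.swap)
  also have "\<dots> = (\<Sum>i\<in>N. \<Sum>j\<in>N. emul i (emul j (- cder j (cder i \<alpha>))))"
    unfolding emul_minus by (intro sum.cong refl emul_anti)
  finally have 2: "dcoef (dcoef \<alpha>) = (\<Sum>i\<in>N. \<Sum>j\<in>N. emul i (emul j (- cder j (cder i \<alpha>))))" .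
  have "dcoef (dcoef \<alpha>) + dcoef (dcoef \<alpha>) = (\<Sum>i\<in>N. \<Sum>j\<in>N. emul i (emul j (cder i (cder j \<alpha>) - cder j (cder i \<alpha>))))"
    by (subst 1, subst 2) (simp only: sum.distrib[symmetric] emul_add[symmetric] diff_conv_add_uminus)
  also have "\<dots> = (\<Sum>i\<in>N. \<Sum>j\<in>N. \<Sum>k\<in>N. scl (sc i j k) (emul i (emul j (cder k \<alpha>))))"
    by (intro sum.cong refl) (simp only: cder_commutator emul_sum emul_scl)
  finally show ?thesis .
qed

text \<open>
  Moving \<open>e\<^sub>l\<close> past \<open>e\<^sub>ie\<^sub>j\<close> costs no sign, so the two orders combine to the anticommutator
  \<open>e\<^sub>l\<iota>\<^sub>k + \<iota>\<^sub>ke\<^sub>l = \<delta>\<^sub>k\<^sub>l\<close>.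
\<close>
lemma dcoef_d0op_cross:
  assumes "\<alpha> \<in> Forms S"
  shows "dcoef (d0op \<alpha>) + d0op (dcoef \<alpha>) = (\<Sum>i\<in>N. \<Sum>j\<in>N. \<Sum>k\<in>N. scl (- sc i j k / 2) (emul i (emul j (cder k \<alpha>))))"
proof -
  have F: "emul i (emul j (contr k \<alpha>)) \<in> Forms S" if "i \<in> N" "j \<in> N" for i j k
    using that assms by (intro Forms_emul Forms_contr)
  have A: "dcoef (d0op \<alpha>) = (\<Sum>i\<in>N. \<Sum>j\<in>N. \<Sum>k\<in>N. scl (- sc i j k / 2) (dcoef (emul i (emul j (contr k \<alpha>)))))"
  proof -
    have "dcoef (d0op \<alpha>) = (\<Sum>i\<in>N. dcoef (\<Sum>j\<in>N. \<Sum>k\<in>N. scl (- sc i j k / 2) (emul i (emul j (contr k \<alpha>)))))"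
      unfolding d0op_def by (intro dcoef_sum Forms_sum Forms_scl F)
    also have "\<dots> = (\<Sum>i\<in>N. \<Sum>j\<in>N. dcoef (\<Sum>k\<in>N. scl (- sc i j k / 2) (emul i (emul j (contr k \<alpha>)))))"
      by (intro sum.cong refl dcoef_sum Forms_sum Forms_scl F)
    also have "\<dots> = (\<Sum>i\<in>N. \<Sum>j\<in>N. \<Sum>k\<in>N. dcoef (scl (- sc i j k / 2) (emul i (emul j (contr k \<alpha>)))))"
      by (intro sum.cong refl dcoef_sum Forms_sum Forms_scl F)
    also have "\<dots> = (\<Sum>i\<in>N. \<Sum>j\<in>N. \<Sum>k\<in>N. scl (- sc i j k / 2) (dcoef (emul i (emul j (contr k \<alpha>)))))"
      by (intro sum.cong refl dcoef_scl F)
    finally show ?thesis .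
  qed
  have B: "dcoef (emul i (emul j (contr k \<alpha>))) + emul i (emul j (contr k (dcoef \<alpha>))) = emul i (emul j (cder k \<alpha>))"
    if ijk: "i \<in> N" "j \<in> N" "k \<in> N" for i j k
  proof -
    have "dcoef (emul i (emul j (contr k \<alpha>))) = (\<Sum>l\<in>N. emul l (emul i (emul j (contr k (cder l \<alpha>)))))"
      unfolding dcoef_def using ijk assms
      by (intro sum.cong refl) (simp only: cder_emul cder_contr Forms_emul Forms_contr)
    also have "\<dots> = (\<Sum>l\<in>N. emul i (emul j (emul l (contr k (cder l \<alpha>)))))"
      by (intro sum.cong refl emul_rotate[symmetric])
    finally have "dcoef (emul i (emul j (contr k \<alpha>))) + emul i (emul j (contr k (dcoef \<alpha>)))
      = (\<Sum>l\<in>N. emul i (emul j (emul l (contr k (cder l \<alpha>)) + contr k (emul l (cder l \<alpha>)))))"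
      unfolding dcoef_def contr_sum emul_sum emul_add sum.distrib by simp
    also have "\<dots> = emul i (emul j (\<Sum>l\<in>N. if l = k then cder l \<alpha> else 0))"
      by (simp only: emul_contr emul_sum)
    finally show ?thesis using ijk by (simp add: sum.delta)
  qed
  have "dcoef (d0op \<alpha>) + d0op (dcoef \<alpha>) = (\<Sum>i\<in>N. \<Sum>j\<in>N. \<Sum>k\<in>N. scl (- sc i j k / 2)
      (dcoef (emul i (emul j (contr k \<alpha>))) + emul i (emul j (contr k (dcoef \<alpha>)))))"
    unfolding A d0op_def[of "dcoef \<alpha>"] sum.distrib[symmetric] scl_add ..
  also have "\<dots> = (\<Sum>i\<in>N. \<Sum>j\<in>N. \<Sum>k\<in>N. scl (- sc i j k / 2) (emul i (emul j (cder k \<alpha>))))"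
    by (intro sum.cong refl) (simp only: B)
  finally show ?thesis .
qed

lemma d0op_d0op: "d0op (d0op \<alpha>) = 0"
proof (intro ext)
  fix K x
  define E3 where "E3 i j b l = emul i (emul j (emul b (contr l \<alpha>))) K x" for i j b l
  define E4 where "E4 i j k a b l = emul i (emul j (emul a (emul b (contr k (contr l \<alpha>))))) K x" for i j k a b l
  let ?E = "\<lambda>i j k a b l. (if k = a then E3 i j b l else 0) - (if k = b then E3 i j a l else 0) + E4 i j k a b l"
  have "d0op (d0op \<alpha>) K x = (\<Sum>i\<in>N. \<Sum>j\<in>N. \<Sum>k\<in>N. \<Sum>a\<in>N. \<Sum>b\<in>N. \<Sum>l\<in>N. (1/4) * (sc i j k * sc a b l *
     ?E i j k a b l))"
  proof -
    have step: "emul i (emul j (contr k (emul a (emul b (contr l \<alpha>))))) K x = ?E i j k a b l" for i j k a b l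
    proof -
      have e0: "emul i 0 = 0" for i by (simp add: emul_def fun_eq_iff)
      have ed: "emul i (\<beta> - \<gamma>) = emul i \<beta> - emul i \<gamma>" for i \<beta> \<gamma>
        using emul_add[of i \<beta> "- \<gamma>"] by (simp add: emul_minus)
      have "contr k (emul a (emul b (contr l \<alpha>))) = (if k = a then emul b (contr l \<alpha>) else 0)
          - ((if k = b then emul a (contr l \<alpha>) else 0) - emul a (emul b (contr k (contr l \<alpha>))))"
        by (simp add: contr_emul ed e0)
      then show ?thesis by (simp add: ed e0 E3_def E4_def)
    qed
    have quarter: "(- a / 2) * ((- b / 2) * c) = (1/4) * (a * b * c)" for a b c :: real by simp
    have "d0op (d0op \<alpha>) = (\<Sum>i\<in>N. \<Sum>j\<in>N. \<Sum>k\<in>N. \<Sum>a\<in>N. \<Sum>b\<in>N. \<Sum>l\<in>N. scl (- sc i j k / 2)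
       (scl (- sc a b l / 2) (emul i (emul j (contr k (emul a (emul b (contr l \<alpha>))))))))"
      by (simp only: d0op_def contr_sum emul_sum contr_scl emul_scl vf.scale_sum_right)
    then have "d0op (d0op \<alpha>) K x = (\<Sum>i\<in>N. \<Sum>j\<in>N. \<Sum>k\<in>N. \<Sum>a\<in>N. \<Sum>b\<in>N. \<Sum>l\<in>N. (- sc i j k / 2) *
       ((- sc a b l / 2) * (emul i (emul j (contr k (emul a (emul b (contr l \<alpha>)))))) K x))"
      by (simp only: sum_fun_apply2) (simp only: scl_def)
    then show ?thesis unfolding step quarter .
  qed
  also have "\<dots> = (1/4) * (\<Sum>i\<in>N. \<Sum>j\<in>N. \<Sum>k\<in>N. \<Sum>a\<in>N. \<Sum>b\<in>N. \<Sum>l\<in>N. sc i j k * sc a b l *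
     ?E i j k a b l)"
    by (simp only: sum_distrib_left)
  also have "(\<Sum>i\<in>N. \<Sum>j\<in>N. \<Sum>k\<in>N. \<Sum>a\<in>N. \<Sum>b\<in>N. \<Sum>l\<in>N. sc i j k * sc a b l *
     ?E i j k a b l) = 0"
  proof (rule Jacobi_sum_zero)
    show "E3 i j b l = E3 j b i l" for i j b l
      unfolding E3_def by (simp only: emul_rotate[of j b i])
    show "E4 i j k a b l = - E4 a b l i j k" for i j k a b l
      unfolding E4_def contr_anti[of k l] emul_minus emul_rotate[of i j a] emul_rotate[of i j b] by (simp only: fun_Compl_def minus_minus)
  qed (rule finite_atLeastAtMost | (rule sc_anti; assumption) | (rule sc_Jacobi; assumption))+
  finally show "d0op (d0op \<alpha>) K x = 0 K x" by simp
qed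

lemma ext_d_ext_d:
  assumes "\<alpha> \<in> Forms S" shows "ext_d S (ext_d S \<alpha>) = 0"
proof -
  define V where "V = dcoef (dcoef \<alpha>) + (dcoef (d0op \<alpha>) + d0op (dcoef \<alpha>))"
  have "ext_d S (ext_d S \<alpha>) = V"
    using assms by (simp add: ext_d_eq Forms_add Forms_dcoef Forms_d0op dcoef_add d0op_add d0op_d0op V_def algebra_simps)
  moreover have "V + V = 0"
  proof -
    have "V + V = (dcoef (dcoef \<alpha>) + dcoef (dcoef \<alpha>)) + ((dcoef (d0op \<alpha>) + d0op (dcoef \<alpha>)) + (dcoef (d0op \<alpha>) + d0op (dcoef \<alpha>)))"
      by (simp add: V_def algebra_simps)
    also have "\<dots> = (\<Sum>i\<in>N. \<Sum>j\<in>N. \<Sum>k\<in>N. scl (sc i j k) (emul i (emul j (cder k \<alpha>)))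
      + (scl (- sc i j k / 2) (emul i (emul j (cder k \<alpha>))) + scl (- sc i j k / 2) (emul i (emul j (cder k \<alpha>)))))"
      unfolding dcoef_dcoef_double[OF assms] dcoef_d0op_cross[OF assms] by (simp only: sum.distrib)
    also have "\<dots> = 0"
      by (intro sum.neutral ballI) (simp add: scl_def fun_eq_iff)
    finally show ?thesis .
  qed
  then have "V = 0" by (simp add: fun_eq_iff)
  ultimately show ?thesis by simp
qed


section \<open>The splitting of \<open>d\<close> by weight\<close>

lemma wtset_insert: "finite K \<Longrightarrow> j \<notin> K \<Longrightarrow> wtset S (insert j K) = wt S j + wtset S K"
  by (simp add: wtset_def)

lemma wtset_remove: "finite K \<Longrightarrow> j \<in> K \<Longrightarrow> wtset S K = wt S j + wtset S (K - {j})"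
  by (simp add: wtset_def sum.remove)

lemma finite_sub_N: "K \<subseteq> N \<Longrightarrow> finite K"
  using finite_subset by blast

lemma emul_wt: "j \<in> N \<Longrightarrow> \<alpha> \<in> Forms_wt S p \<Longrightarrow> emul j \<alpha> \<in> Forms_wt S (p + int (wt S j))"
  unfolding Forms_wt_FS by (erule (1) FS_emul) (auto simp: wtset_remove finite_sub_N)

lemma contr_wt: "\<alpha> \<in> Forms_wt S p \<Longrightarrow> contr j \<alpha> \<in> Forms_wt S (p - int (wt S j))"
  unfolding Forms_wt_FS by (erule FS_contr) (auto simp: wtset_insert finite_sub_N)

lemma emul_deg: "j \<in> N \<Longrightarrow> \<alpha> \<in> Forms_deg S h \<Longrightarrow> emul j \<alpha> \<in> Forms_deg S (Suc h)"
  unfolding Forms_deg_FS by (erule (1) FS_emul) (metis card.remove finite_sub_N mem_Collect_eq)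

lemmas Forms_wt_scl = FS_scl[where A = "{J. int (wtset S J) = p}" for p, folded Forms_wt_FS]
  and Forms_wt_minus = FS_minus[where A = "{J. int (wtset S J) = p}" for p, folded Forms_wt_FS]
  and Forms_wt_diff = FS_diff[where A = "{J. int (wtset S J) = p}" for p, folded Forms_wt_FS]
  and Forms_wt_sum = FS_sum[where A = "{J. int (wtset S J) = p}" for p, folded Forms_wt_FS]
  and Forms_wt_0 = FS_0[where A = "{J. int (wtset S J) = p}" for p, folded Forms_wt_FS]
  and Forms_deg_scl = FS_scl[where A = "{J. card J = h}" for h, folded Forms_deg_FS]
  and Forms_deg_diff = FS_diff[where A = "{J. card J = h}" for h, folded Forms_deg_FS]
  and Forms_deg_sum = FS_sum[where A = "{J. card J = h}" for h, folded Forms_deg_FS]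

lemma Forms_wt_Forms: "\<alpha> \<in> Forms_wt S p \<Longrightarrow> \<alpha> \<in> Forms S"
  by (simp add: Forms_wt_def)

lemma Forms_deg_Forms: "\<alpha> \<in> Forms_deg S h \<Longrightarrow> \<alpha> \<in> Forms S"
  by (simp add: Forms_deg_def)

text \<open>
  The term \<open>e\<^sub>ie\<^sub>j\<iota>\<^sub>k\<close> changes the weight by \<open>w\<^sub>i + w\<^sub>j - w\<^sub>k\<close>, which is \<open>0\<close> whenever \<open>c\<^sub>i\<^sub>j\<^sup>k \<noteq> 0\<close>.
\<close>
lemma d0op_wt:
  assumes "\<alpha> \<in> Forms_wt S p" shows "d0op \<alpha> \<in> Forms_wt S p"
  unfolding d0op_def
proof (intro Forms_wt_sum)
  fix i j k assume ijk: "i \<in> N" "j \<in> N" "k \<in> N"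
  show "scl (- sc i j k / 2) (emul i (emul j (contr k \<alpha>))) \<in> Forms_wt S p"
  proof (cases "sc i j k = 0")
    case False
    have "emul i (emul j (contr k \<alpha>)) \<in> Forms_wt S (p - int (wt S k) + int (wt S j) + int (wt S i))"
      by (intro emul_wt contr_wt ijk assms)
    then show ?thesis using sc_graded[OF ijk False] by (intro Forms_wt_scl) simp
  qed (simp add: Forms_wt_0)
qed

lemma d0op_deg:
  assumes "\<alpha> \<in> Forms_deg S h" shows "d0op \<alpha> \<in> Forms_deg S (Suc h)"
  unfolding d0op_def
proof (intro Forms_deg_sum Forms_deg_scl emul_deg)
  fix i j k assume ijk: "i \<in> N" "j \<in> N"
  have "contr k \<alpha> \<in> FS {K. Suc (card K) = h}"
    using assms unfolding Forms_deg_FS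
    by (erule_tac FS_contr) (metis (no_types, lifting) card_insert_disjoint finite_insert finite_sub_N mem_Collect_eq)
  then have "emul j (contr k \<alpha>) \<in> FS {K. card K = h}"
    by (rule FS_emul[OF ijk(2)]) (metis (no_types, lifting) card.remove finite_sub_N mem_Collect_eq)
  then show "emul j (contr k \<alpha>) \<in> Forms_deg S h" by (simp only: Forms_deg_FS)
qed

text \<open>
  A closed formula for \<open>d\<^sub>m\<close>, valid on forms: see \<open>dw_eq\<close>.
\<close>
definition dwt :: "nat \<Rightarrow> 'g form \<Rightarrow> 'g form" where
  "dwt m \<alpha> = (if m = 0 then d0op \<alpha> else \<Sum>j\<in>{j \<in> N. wt S j = m}. emul j (cder j \<alpha>))"

lemma dwt_wt:
  assumes "\<alpha> \<in> Forms_wt S p" shows "dwt m \<alpha> \<in> Forms_wt S (p + int m)"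
proof (cases "m = 0")
  case False
  have "emul j (cder j \<alpha>) \<in> Forms_wt S (p + int m)" if "j \<in> {j \<in> N. wt S j = m}" for j
  proof -
    have "cder j \<alpha> \<in> Forms_wt S p"
      using that assms unfolding Forms_wt_FS by (intro FS_cder) simp_all
    then show ?thesis using emul_wt[of j "cder j \<alpha>" p] that by simp
  qed
  then have "(\<Sum>j\<in>{j \<in> N. wt S j = m}. emul j (cder j \<alpha>)) \<in> Forms_wt S (p + int m)"
    by (rule Forms_wt_sum)
  with False show ?thesis by (simp only: dwt_def if_False simp_thms)
qed (simp add: dwt_def d0op_wt assms)

lemma dwt_add:
  assumes "\<alpha> \<in> Forms S" "\<beta> \<in> Forms S" shows "dwt m (\<alpha> + \<beta>) = dwt m \<alpha> + dwt m \<beta>"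
proof (cases "m = 0")
  case False
  have "(\<Sum>j\<in>{j \<in> N. wt S j = m}. emul j (cder j (\<alpha> + \<beta>)))
     = (\<Sum>j\<in>{j \<in> N. wt S j = m}. emul j (cder j \<alpha>) + emul j (cder j \<beta>))"
  proof (intro sum.cong refl)
    fix j assume "j \<in> {j \<in> N. wt S j = m}"
    then have "j \<in> N" by simp
    from cder_add[OF this assms] show "emul j (cder j (\<alpha> + \<beta>)) = emul j (cder j \<alpha>) + emul j (cder j \<beta>)"
      by (simp only: emul_add)
  qed
  with False show ?thesis by (simp only: dwt_def if_False sum.distrib)
qed (simp only: dwt_def d0op_add if_True simp_thms)

lemma dwt_scl:
  assumes "\<alpha> \<in> Forms S" shows "dwt m (scl c \<alpha>) = scl c (dwt m \<alpha>)"
proof (cases "m = 0")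
  case False
  have "(\<Sum>j\<in>{j \<in> N. wt S j = m}. emul j (cder j (scl c \<alpha>)))
     = (\<Sum>j\<in>{j \<in> N. wt S j = m}. scl c (emul j (cder j \<alpha>)))"
  proof (intro sum.cong refl)
    fix j assume "j \<in> {j \<in> N. wt S j = m}"
    then have "j \<in> N" by simp
    from cder_scl[OF this assms] show "emul j (cder j (scl c \<alpha>)) = scl c (emul j (cder j \<alpha>))"
      by (simp only: emul_scl)
  qed
  with False show ?thesis by (simp only: dwt_def if_False vf.scale_sum_right)
qed (simp only: dwt_def d0op_scl if_True simp_thms)

lemma Forms_dwt: "\<alpha> \<in> Forms S \<Longrightarrow> dwt m \<alpha> \<in> Forms S"
  unfolding dwt_def by (cases "m = 0") (simp_all only: if_True if_False simp_thms, auto intro!: Forms_d0op Forms_sum Forms_emul Forms_cder)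

lemma dwt_sum:
  "(\<And>i. i \<in> I \<Longrightarrow> F i \<in> Forms S) \<Longrightarrow> dwt m (\<Sum>i\<in>I. F i) = (\<Sum>i\<in>I. dwt m (F i))"
  by (rule additive_on_sum[where V = "Forms S"]) ((assumption | rule dwt_add Forms_0 Forms_add)+)

lemma ext_d_dwt:
  assumes "\<alpha> \<in> Forms S" "Q \<le> L" shows "ext_d S \<alpha> = (\<Sum>m=0..L. dwt m \<alpha>)"
proof -
  have "dcoef \<alpha> = (\<Sum>m\<in>{1..L}. \<Sum>j\<in>{j \<in> N. wt S j = m}. emul j (cder j \<alpha>))"
    unfolding dcoef_def
  proof (rule sum.group[symmetric])
    show "wt S ` N \<subseteq> {1..L}" using order_trans[OF wt_le assms(2)] wt_pos by auto
  qed simp_all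
  also have "\<dots> = (\<Sum>m\<in>{1..L}. dwt m \<alpha>)"
    by (intro sum.cong refl) (simp add: dwt_def)
  finally have D: "dcoef \<alpha> = (\<Sum>m\<in>{1..L}. dwt m \<alpha>)" .
  have "(\<Sum>m=0..L. dwt m \<alpha>) = dwt 0 \<alpha> + (\<Sum>m\<in>{1..L}. dwt m \<alpha>)"
    by (simp only: sum.atLeast_Suc_atMost[OF le0] One_nat_def)
  moreover have "dwt 0 \<alpha> = d0op \<alpha>" by (simp only: dwt_def if_True simp_thms)
  ultimately show ?thesis unfolding ext_d_eq[OF assms(1)] D by (simp only: add.commute)
qed

lemma wpart_add: "wpart S a (\<alpha> + \<beta>) = wpart S a \<alpha> + wpart S a \<beta>"
  by (simp add: wpart_def fun_eq_iff)

lemmas wpart_sum = additive_sum[of "wpart S a" for a, OF wpart_add]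

lemma wpart_wt:
  assumes "\<alpha> \<in> Forms S" shows "wpart S a \<alpha> \<in> Forms_wt S (int a)"
  using assms Cinf_0 by (auto simp: Forms_wt_def Forms_def wpart_def)

lemma wpart_pure:
  assumes "\<alpha> \<in> Forms_wt S p" shows "wpart S a \<alpha> = (if p = int a then \<alpha> else 0)"
  using assms by (auto simp: Forms_wt_def wpart_def fun_eq_iff)

lemma wpart_total:
  assumes "\<alpha> \<in> Forms S" shows "(\<Sum>a=0..Q. wpart S a \<alpha>) = \<alpha>"
proof (intro ext)
  fix J x
  have "(\<Sum>a=0..Q. wpart S a \<alpha>) J x = (\<Sum>a=0..Q. if wtset S J = a then \<alpha> J x else 0)"
    unfolding sum_fun_apply2 by (intro sum.cong refl) (simp add: wpart_def)
  also have "\<dots> = \<alpha> J x"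
    using FS_D[of \<alpha> UNIV J x] assms wtset_le[of J] unfolding FS_UNIV by (auto simp: sum.delta)
  finally show "(\<Sum>a=0..Q. wpart S a \<alpha>) J x = \<alpha> J x" .
qed

lemma dw_eq:
  assumes "\<alpha> \<in> Forms S" shows "dw S m \<alpha> = dwt m \<alpha>"
proof -
  have "dw S m \<alpha> = (\<Sum>a=0..Q. dwt m (wpart S a \<alpha>))"
    unfolding dw_def
  proof (intro sum.cong refl)
    fix a
    \<comment> \<open>The bound is enlarged so that the sum contains the index \<open>m\<close> also when \<open>m > Q\<close>.\<close>
    let ?\<beta> = "wpart S a \<alpha>" and ?L = "max Q m"
    have b: "?\<beta> \<in> Forms_wt S (int a)" by (rule wpart_wt[OF assms])
    have "wpart S (a + m) (ext_d S ?\<beta>) = (\<Sum>l=0..?L. wpart S (a + m) (dwt l ?\<beta>))"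
      unfolding ext_d_dwt[OF Forms_wt_Forms[OF b] max.cobounded1[of Q m]] by (rule wpart_sum)
    also have "\<dots> = (\<Sum>l=0..?L. if l = m then dwt m ?\<beta> else 0)"
      by (intro sum.cong refl) (auto simp: wpart_pure[OF dwt_wt[OF b]])
    also have "\<dots> = dwt m ?\<beta>" by (simp add: sum.delta)
    finally show "wpart S (a + m) (ext_d S ?\<beta>) = dwt m ?\<beta>" .
  qed
  also have "\<dots> = dwt m \<alpha>"
    using dwt_sum[of "{0..Q}" "\<lambda>a. wpart S a \<alpha>" m] Forms_wt_Forms[OF wpart_wt[OF assms]]
    by (simp only: wpart_total[OF assms])
  finally show ?thesis .
qed

subsection \<open>Operators raising the weight\<close>

definition lin_op :: "('g form \<Rightarrow> 'g form) \<Rightarrow> bool" where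
  "lin_op F \<longleftrightarrow> (\<forall>\<alpha>\<in>Forms S. F \<alpha> \<in> Forms S) \<and>
     (\<forall>\<alpha>\<in>Forms S. \<forall>\<beta>\<in>Forms S. F (\<alpha> + \<beta>) = F \<alpha> + F \<beta>) \<and>
     (\<forall>c. \<forall>\<alpha>\<in>Forms S. F (scl c \<alpha>) = scl c (F \<alpha>))"

definition raises :: "nat \<Rightarrow> ('g form \<Rightarrow> 'g form) \<Rightarrow> bool" where
  "raises s F \<longleftrightarrow> lin_op F \<and> (\<forall>p. \<forall>\<alpha>\<in>Forms_wt S p. F \<alpha> \<in> Forms_wt S (p + int s))"

lemma lin_op_Forms: "lin_op F \<Longrightarrow> \<alpha> \<in> Forms S \<Longrightarrow> F \<alpha> \<in> Forms S"
  unfolding lin_op_def by (elim conjE) (erule (1) bspec)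

lemma lin_op_add: "lin_op F \<Longrightarrow> \<alpha> \<in> Forms S \<Longrightarrow> \<beta> \<in> Forms S \<Longrightarrow> F (\<alpha> + \<beta>) = F \<alpha> + F \<beta>"
  unfolding lin_op_def by (elim conjE) (drule (1) bspec, erule (1) bspec)

lemma lin_op_scl: "lin_op F \<Longrightarrow> \<alpha> \<in> Forms S \<Longrightarrow> F (scl c \<alpha>) = scl c (F \<alpha>)"
  unfolding lin_op_def by (elim conjE allE[where x = c]) (erule (1) bspec)

lemma lin_op_0: assumes "lin_op F" shows "F 0 = 0"
  using lin_op_add[OF assms Forms_0 Forms_0] by simp

lemma lin_op_minus: assumes "lin_op F" "\<alpha> \<in> Forms S" shows "F (- \<alpha>) = - F \<alpha>"
proof -
  have "F \<alpha> + F (- \<alpha>) = F (\<alpha> + - \<alpha>)"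
    by (rule lin_op_add[OF assms Forms_minus[OF assms(2)], symmetric])
  also have "\<alpha> + - \<alpha> = 0" by (rule add.right_inverse)
  also have "F 0 = 0" by (rule lin_op_0[OF assms(1)])
  finally have "- F \<alpha> = F (- \<alpha>)" by (rule minus_unique)
  then show ?thesis by (rule sym)
qed

lemma lin_op_diff:
  assumes "lin_op F" "\<alpha> \<in> Forms S" "\<beta> \<in> Forms S" shows "F (\<alpha> - \<beta>) = F \<alpha> - F \<beta>"
  unfolding diff_conv_add_uminus lin_op_add[OF assms(1,2) Forms_minus[OF assms(3)]]
    lin_op_minus[OF assms(1,3)] ..

lemma lin_op_sum:
  assumes "lin_op F" "\<And>i. i \<in> I \<Longrightarrow> g i \<in> Forms S"
  shows "F (\<Sum>i\<in>I. g i) = (\<Sum>i\<in>I. F (g i))"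
  by (rule additive_on_sum[where V = "Forms S"])
     ((assumption | rule assms lin_op_add[OF assms(1)] Forms_0 Forms_add)+)

lemma lin_op_comp:
  assumes "lin_op F" "lin_op G" shows "lin_op (\<lambda>\<alpha>. F (G \<alpha>))"
  unfolding lin_op_def
proof (intro conjI allI ballI)
  fix \<alpha> \<beta> c assume a: "\<alpha> \<in> Forms S"
  note Ga = lin_op_Forms[OF assms(2) a]
  show "F (G \<alpha>) \<in> Forms S" by (rule lin_op_Forms[OF assms(1) Ga])
  show "F (G (scl c \<alpha>)) = scl c (F (G \<alpha>))"
    unfolding lin_op_scl[OF assms(2) a] by (rule lin_op_scl[OF assms(1) Ga])
  assume b: "\<beta> \<in> Forms S"
  show "F (G (\<alpha> + \<beta>)) = F (G \<alpha>) + F (G \<beta>)"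
    unfolding lin_op_add[OF assms(2) a b] by (rule lin_op_add[OF assms(1) Ga lin_op_Forms[OF assms(2) b]])
qed

lemma raises_lin: "raises s F \<Longrightarrow> lin_op F"
  unfolding raises_def by (rule conjunct1)

lemma raises_wt: "raises s F \<Longrightarrow> \<alpha> \<in> Forms_wt S p \<Longrightarrow> F \<alpha> \<in> Forms_wt S (p + int s)"
  unfolding raises_def by (elim conjE allE[where x = p]) (erule (1) bspec)

lemma raises_comp:
  assumes "raises s F" "raises t G" shows "raises (t + s) (\<lambda>\<alpha>. F (G \<alpha>))"
  unfolding raises_def
proof (intro conjI allI ballI)
  show "lin_op (\<lambda>\<alpha>. F (G \<alpha>))" by (rule lin_op_comp[OF raises_lin[OF assms(1)] raises_lin[OF assms(2)]])
  fix p \<alpha> assume "\<alpha> \<in> Forms_wt S p"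
  from raises_wt[OF assms(1) raises_wt[OF assms(2) this]]
  show "F (G \<alpha>) \<in> Forms_wt S (p + int (t + s))" by (simp only: of_nat_add add.assoc)
qed

lemma raises_sum:
  assumes "\<And>i. i \<in> I \<Longrightarrow> raises s (F i)" shows "raises s (\<lambda>\<alpha>. \<Sum>i\<in>I. F i \<alpha>)"
  unfolding raises_def lin_op_def
proof (intro conjI allI ballI)
  note L = raises_lin[OF assms]
  fix \<alpha> \<beta> c assume a: "\<alpha> \<in> Forms S"
  show "(\<Sum>i\<in>I. F i \<alpha>) \<in> Forms S"
    by (rule Forms_sum) (rule lin_op_Forms[OF L a])
  show "(\<Sum>i\<in>I. F i (scl c \<alpha>)) = scl c (\<Sum>i\<in>I. F i \<alpha>)"
    unfolding vf.scale_sum_right by (rule sum.cong[OF refl]) (rule lin_op_scl[OF L a])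
  assume b: "\<beta> \<in> Forms S"
  show "(\<Sum>i\<in>I. F i (\<alpha> + \<beta>)) = (\<Sum>i\<in>I. F i \<alpha>) + (\<Sum>i\<in>I. F i \<beta>)"
    unfolding sum.distrib[symmetric] by (rule sum.cong[OF refl]) (rule lin_op_add[OF L a b])
next
  fix p \<alpha> assume a: "\<alpha> \<in> Forms_wt S p"
  show "(\<Sum>i\<in>I. F i \<alpha>) \<in> Forms_wt S (p + int s)"
    by (rule Forms_wt_sum) (rule raises_wt[OF assms a])
qed

lemma raises_scl: 
  assumes "raises s F" shows "raises s (\<lambda>\<alpha>. scl c (F \<alpha>))"
  unfolding raises_def lin_op_def
proof (intro conjI allI ballI)
  note L = raises_lin[OF assms]
  fix \<alpha> \<beta> d assume a: "\<alpha> \<in> Forms S"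
  show "scl c (F \<alpha>) \<in> Forms S" by (rule Forms_scl[OF lin_op_Forms[OF L a]])
  show "scl c (F (scl d \<alpha>)) = scl d (scl c (F \<alpha>))"
    unfolding lin_op_scl[OF L a] by (rule vf.scale_left_commute)
  assume b: "\<beta> \<in> Forms S"
  show "scl c (F (\<alpha> + \<beta>)) = scl c (F \<alpha>) + scl c (F \<beta>)"
    unfolding lin_op_add[OF L a b] by (rule scl_add)
next
  fix p \<alpha> assume a: "\<alpha> \<in> Forms_wt S p"
  show "scl c (F \<alpha>) \<in> Forms_wt S (p + int s)"
    by (rule Forms_wt_scl[OF raises_wt[OF assms a]])
qed

lemma raises_diff:
  assumes "raises s F" "raises s G" shows "raises s (\<lambda>\<alpha>. F \<alpha> - G \<alpha>)"
proof -
  have "raises s (if b then F else (\<lambda>\<alpha>. scl (-1) (G \<alpha>)))" for b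
    using assms(1) raises_scl[OF assms(2)] by (cases b) (simp_all only: if_True if_False)
  then have "raises s (\<lambda>\<alpha>. \<Sum>b\<in>UNIV. (if b then F else (\<lambda>\<alpha>. scl (-1) (G \<alpha>))) \<alpha>)"
    by (rule raises_sum)
  moreover have "(\<Sum>b\<in>UNIV. (if b then F else (\<lambda>\<alpha>. scl (-1) (G \<alpha>))) \<alpha>) = F \<alpha> - G \<alpha>" for \<alpha>
    by (simp add: UNIV_bool)
  ultimately show ?thesis by (simp only:)
qed

lemma Forms_wt_beyond:
  assumes "\<alpha> \<in> Forms_wt S p" "p > int Q" shows "\<alpha> = 0"
proof (intro ext)
  fix J x show "\<alpha> J x = 0 J x"
  proof (rule ccontr)
    assume "\<alpha> J x \<noteq> 0 J x"
    then have "\<alpha> J x \<noteq> 0" by simp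
    from FS_D[OF assms(1)[unfolded Forms_wt_FS] this] have "J \<subseteq> N" "int (wtset S J) = p" by auto
    with wtset_le[OF this(1)] assms(2) show False by linarith
  qed
qed

text \<open>
  All weights of forms lie between \<open>0\<close> and \<open>Q\<close>.
\<close>
lemma raises_vanish:
  assumes "raises s F" "s > Q" "\<alpha> \<in> Forms S" shows "F \<alpha> = 0"
proof -
  have "F (\<Sum>a=0..Q. wpart S a \<alpha>) = (\<Sum>a=0..Q. F (wpart S a \<alpha>))"
    by (rule lin_op_sum[OF raises_lin[OF assms(1)] Forms_wt_Forms[OF wpart_wt[OF assms(3)]]])
  then have "F \<alpha> = (\<Sum>a=0..Q. F (wpart S a \<alpha>))"
    unfolding wpart_total[OF assms(3)] .
  also have "\<dots> = 0"
  proof (intro sum.neutral ballI)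
    fix a
    show "F (wpart S a \<alpha>) = 0"
      by (rule Forms_wt_beyond[OF raises_wt[OF assms(1) wpart_wt[OF assms(3), of a]]]) (use assms(2) in simp)
  qed
  finally show ?thesis .
qed

lemma raises_dw: "raises m (dw S m)"
  unfolding raises_def lin_op_def
proof (intro conjI allI ballI)
  fix \<alpha> \<beta> c assume a: "\<alpha> \<in> Forms S"
  show "dw S m \<alpha> \<in> Forms S" unfolding dw_eq[OF a] by (rule Forms_dwt[OF a])
  show "dw S m (scl c \<alpha>) = scl c (dw S m \<alpha>)"
    unfolding dw_eq[OF a] dw_eq[OF Forms_scl[OF a]] by (rule dwt_scl[OF a])
  assume b: "\<beta> \<in> Forms S"
  show "dw S m (\<alpha> + \<beta>) = dw S m \<alpha> + dw S m \<beta>"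
    unfolding dw_eq[OF a] dw_eq[OF b] dw_eq[OF Forms_add[OF a b]] by (rule dwt_add[OF a b])
next
  fix p \<alpha> assume a: "\<alpha> \<in> Forms_wt S p"
  show "dw S m \<alpha> \<in> Forms_wt S (p + int m)"
    unfolding dw_eq[OF Forms_wt_Forms[OF a]] by (rule dwt_wt[OF a])
qed

lemmas dw_lin = raises_lin[OF raises_dw]
lemmas Forms_dw = lin_op_Forms[OF dw_lin]

lemma dw_0: "\<alpha> \<in> Forms S \<Longrightarrow> dw S 0 \<alpha> = d0op \<alpha>"
  by (simp only: dw_eq dwt_def if_True simp_thms)

lemma ext_d_dw: "\<alpha> \<in> Forms S \<Longrightarrow> Q \<le> L \<Longrightarrow> ext_d S \<alpha> = (\<Sum>m=0..L. dw S m \<alpha>)"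
  by (simp only: ext_d_dwt dw_eq)

lemma ext_d_minus_dw0:
  assumes "\<alpha> \<in> Forms S" shows "ext_d S \<alpha> - dw S 0 \<alpha> = (\<Sum>m=1..Q. dw S m \<alpha>)"
  unfolding ext_d_dw[OF assms order_refl] sum.atLeast_Suc_atMost[OF le0] One_nat_def
  by (rule add_diff_cancel_left')

lemma dw_deg:
  assumes "\<alpha> \<in> Forms_deg S h" shows "dw S m \<alpha> \<in> Forms_deg S (Suc h)"
proof -
  have "emul j (cder j \<alpha>) \<in> Forms_deg S (Suc h)" if "j \<in> N" for j
    using that assms by (intro emul_deg) (simp_all add: Forms_deg_FS FS_cder)
  then have "(\<Sum>j\<in>{j \<in> N. wt S j = m}. emul j (cder j \<alpha>)) \<in> Forms_deg S (Suc h)"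
    by (intro Forms_deg_sum) blast
  then show ?thesis unfolding dw_eq[OF Forms_deg_Forms[OF assms]] dwt_def
    using d0op_deg[OF assms] by (cases "m = 0") (simp_all only: if_True if_False simp_thms)
qed

text \<open>
  Forms of different weights are linearly independent.
\<close>
lemma component_zero:
  assumes "finite M" "(\<Sum>m\<in>M. f m) = 0" "\<And>m. m \<in> M \<Longrightarrow> f m \<in> Forms_wt S (q m)" "inj_on q M" "n \<in> M"
  shows "f n = 0"
proof (intro ext)
  fix J x
  show "f n J x = 0 J x"
  proof (rule ccontr)
    assume "f n J x \<noteq> 0 J x"
    then have ne: "f n J x \<noteq> 0" by simp
    have wt: "int (wtset S J) = q m" if "m \<in> M" "f m J x \<noteq> 0" for m
      using FS_D[OF assms(3)[OF that(1), unfolded Forms_wt_FS] that(2)] by simp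
    have "f m J x = 0" if "m \<in> M - {n}" for m
    proof (rule ccontr)
      assume "f m J x \<noteq> 0"
      then have "q m = q n" using that wt[OF assms(5) ne] wt[of m] by simp
      then show False using that inj_onD[OF assms(4)] assms(5) by blast
    qed
    then have "(\<Sum>m\<in>M. f m J x) = f n J x"
      using assms(1,5) by (simp add: sum.remove)
    then have "(\<Sum>m\<in>M. f m) J x = f n J x" by (simp only: sum_fun_apply2)
    then show False using ne assms(2) by simp
  qed
qed

text \<open>
  The component of \<open>d\<^sup>2\<alpha> = 0\<close> in weight \<open>p + n\<close>.
\<close>
lemma multicomplex:
  assumes "\<alpha> \<in> Forms_wt S p" shows "(\<Sum>i=0..n. dw S i (dw S (n - i) \<alpha>)) = 0"
proof -
  \<comment> \<open>large enough for \<open>d\<close> to be the sum of the \<open>d\<^sub>i\<close> with \<open>i \<le> ?L\<close>, and for \<open>n\<close> to be in range\<close>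
  let ?L = "max Q n"
  define g where "g x = dw S (fst x) (dw S (snd x) \<alpha>)" for x
  define f where "f s = (\<Sum>x\<in>{x \<in> {0..?L} \<times> {0..?L}. fst x + snd x = s}. g x)" for s
  have a: "\<alpha> \<in> Forms S" by (rule Forms_wt_Forms[OF assms])
  have "ext_d S (ext_d S \<alpha>) = (\<Sum>i=0..?L. dw S i (\<Sum>j=0..?L. dw S j \<alpha>))"
    unfolding ext_d_dw[OF a max.cobounded1[of Q n]]
    by (rule ext_d_dw[OF Forms_sum[OF Forms_dw[OF a]] max.cobounded1])
  also have "\<dots> = (\<Sum>i=0..?L. \<Sum>j=0..?L. dw S i (dw S j \<alpha>))"
    by (rule sum.cong[OF refl]) (rule lin_op_sum[OF dw_lin Forms_dw[OF a]])
  also have "\<dots> = (\<Sum>x\<in>{0..?L} \<times> {0..?L}. g x)"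
    unfolding g_def sum.cartesian_product by (simp only: case_prod_unfold)
  also have "\<dots> = (\<Sum>s\<in>{0..?L + ?L}. f s)"
    unfolding f_def by (rule sum.group[symmetric]) auto
  finally have "(\<Sum>s\<in>{0..?L + ?L}. f s) = 0" by (simp only: ext_d_ext_d[OF a])
  then have "f n = 0"
  proof (rule component_zero[where f = f and q = "\<lambda>s. p + int s" and M = "{0..?L + ?L}", rotated])
    fix s
    show "f s \<in> Forms_wt S (p + int s)"
      unfolding f_def
    proof (intro Forms_wt_sum)
      fix x assume "x \<in> {x \<in> {0..?L} \<times> {0..?L}. fst x + snd x = s}"
      then have "int (snd x) + int (fst x) = int s" by auto
      then have "p + int (snd x) + int (fst x) = p + int s" by simp
      moreover have "g x \<in> Forms_wt S (p + int (snd x) + int (fst x))"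
        unfolding g_def by (rule raises_wt[OF raises_dw raises_wt[OF raises_dw assms]])
      ultimately show "g x \<in> Forms_wt S (p + int s)" by (simp only:)
    qed
  qed (auto simp: inj_on_def)
  moreover have "f n = (\<Sum>i=0..n. dw S i (dw S (n - i) \<alpha>))"
    unfolding f_def g_def
    by (rule sum.reindex_bij_witness[of _ "\<lambda>i. (i, n - i)" fst]) auto
  ultimately show ?thesis by simp
qed

end

section \<open>Pseudo-inverses of matrices\<close>

text \<open>
  Least squares: the orthogonal projection of \<open>v\<close> to the span of finitely many vectors \<open>a j\<close> exists.
  The induction is one Gram--Schmidt step: \<open>a'\<close> is \<open>a j0\<close> made orthogonal to the previous vectors, and the
  residual \<open>r\<close> is corrected by its projection to \<open>a'\<close>.
\<close>
lemma normal_equations: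
  fixes a :: "'j \<Rightarrow> 'i \<Rightarrow> real" and v :: "'i \<Rightarrow> real"
  assumes "finite J" "finite B"
  shows "\<exists>c. \<forall>j\<in>J. (\<Sum>i\<in>B. (v i - (\<Sum>l\<in>J. c l * a l i)) * a j i) = 0"
  using assms(1)
proof (induction J arbitrary: v rule: finite_induct)
  case (insert j0 J)
  obtain c where c: "\<forall>j\<in>J. (\<Sum>i\<in>B. (v i - (\<Sum>l\<in>J. c l * a l i)) * a j i) = 0"
    using insert.IH[of v] by blast
  obtain e where e: "\<forall>j\<in>J. (\<Sum>i\<in>B. (a j0 i - (\<Sum>l\<in>J. e l * a l i)) * a j i) = 0"
    using insert.IH[of "a j0"] by blast
  define r where "r i = v i - (\<Sum>l\<in>J. c l * a l i)" for i
  define a' where "a' i = a j0 i - (\<Sum>l\<in>J. e l * a l i)" for i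
  \<comment> \<open>If \<open>a'\<close> vanishes on \<open>B\<close>, then \<open>t = 0\<close> by the convention for division by zero, which is the right value.\<close>
  define t where "t = (\<Sum>i\<in>B. r i * a' i) / (\<Sum>i\<in>B. a' i * a' i)"
  define c' where "c' = (\<lambda>l. c l - t * e l)(j0 := t)"
  have res: "v i - (\<Sum>l\<in>insert j0 J. c' l * a l i) = r i - t * a' i" for i
  proof -
    have "(\<Sum>l\<in>J. c' l * a l i) = (\<Sum>l\<in>J. c l * a l i - t * (e l * a l i))"
      using insert.hyps by (intro sum.cong refl) (auto simp: c'_def algebra_simps)
    then have "(\<Sum>l\<in>J. c' l * a l i) = (\<Sum>l\<in>J. c l * a l i) - t * (\<Sum>l\<in>J. e l * a l i)"
      by (simp only: sum_subtractf sum_distrib_left)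
    then show ?thesis using insert.hyps by (simp add: c'_def r_def a'_def algebra_simps)
  qed
  have orth: "(\<Sum>i\<in>B. (r i - t * a' i) * a j i) = 0" if "j \<in> J" for j
  proof -
    have "(\<Sum>i\<in>B. (r i - t * a' i) * a j i) = (\<Sum>i\<in>B. r i * a j i) - t * (\<Sum>i\<in>B. a' i * a j i)"
      by (simp only: left_diff_distrib sum_subtractf sum_distrib_left mult.assoc)
    then show ?thesis using c e that by (simp add: r_def a'_def)
  qed
  have "(\<Sum>i\<in>B. (r i - t * a' i) * a' i) = (\<Sum>i\<in>B. r i * a' i) - t * (\<Sum>i\<in>B. a' i * a' i)"
    by (simp only: left_diff_distrib sum_subtractf sum_distrib_left mult.assoc)
  also have "\<dots> = 0"
  proof (cases "(\<Sum>i\<in>B. a' i * a' i) = 0")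
    case True
    then have "\<forall>i\<in>B. a' i = 0" using assms(2) by (simp add: sum_nonneg_eq_0_iff)
    then show ?thesis by simp
  qed (simp add: t_def)
  finally have orth': "(\<Sum>i\<in>B. (r i - t * a' i) * a' i) = 0" .
  have "(\<Sum>i\<in>B. (r i - t * a' i) * a j0 i) = 0"
  proof -
    have "(\<Sum>i\<in>B. (r i - t * a' i) * (\<Sum>l\<in>J. e l * a l i)) = (\<Sum>i\<in>B. \<Sum>l\<in>J. e l * ((r i - t * a' i) * a l i))"
      by (simp add: sum_distrib_left mult_ac)
    also have "\<dots> = (\<Sum>l\<in>J. \<Sum>i\<in>B. e l * ((r i - t * a' i) * a l i))" by (rule sum.swap)
    also have "\<dots> = (\<Sum>l\<in>J. e l * (\<Sum>i\<in>B. (r i - t * a' i) * a l i))" by (simp only: sum_distrib_left)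
    also have "\<dots> = 0" by (intro sum.neutral ballI) (simp add: orth)
    finally have "(\<Sum>i\<in>B. (r i - t * a' i) * (\<Sum>l\<in>J. e l * a l i)) = 0" .
    moreover have "(\<Sum>i\<in>B. (r i - t * a' i) * a j0 i)
        = (\<Sum>i\<in>B. (r i - t * a' i) * a' i) + (\<Sum>i\<in>B. (r i - t * a' i) * (\<Sum>l\<in>J. e l * a l i))"
      unfolding sum.distrib[symmetric] by (intro sum.cong refl) (simp add: a'_def algebra_simps)
    ultimately show ?thesis using orth' by simp
  qed
  with orth show ?case by (intro exI[of _ c']) (auto simp only: res insert_iff)
qed simp

text \<open>
  The value \<open>u\<close> of the Moore--Penrose inverse of \<open>M\<close> at \<open>b\<close>: it lies in the image of the transpose, hence
  is orthogonal to the kernel of \<open>M\<close>, and \<open>M u - b\<close> is orthogonal to the image of \<open>M\<close>. It arises by projecting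
  twice: first \<open>b\<close> to the image of \<open>M\<close>, giving \<open>M c\<close>, and then \<open>c\<close> to the image of the transpose, which does
  not change \<open>M c\<close>.
\<close>
lemma pseudo_inverse_vector:
  fixes M :: "'i \<Rightarrow> 'j \<Rightarrow> real" and b :: "'i \<Rightarrow> real"
  assumes "finite A" "finite B"
  shows "\<exists>u y. (\<forall>j\<in>A. u j = (\<Sum>i\<in>B. M i j * y i)) \<and>
    (\<forall>j\<in>A. (\<Sum>i\<in>B. M i j * ((\<Sum>l\<in>A. M i l * u l) - b i)) = 0)"
proof -
  obtain c where c: "\<forall>j\<in>A. (\<Sum>i\<in>B. (b i - (\<Sum>l\<in>A. c l * M i l)) * M i j) = 0"
    using normal_equations[OF assms, of b "\<lambda>j i. M i j"] by blast
  obtain y where y: "\<forall>i\<in>B. (\<Sum>j\<in>A. (c j - (\<Sum>l\<in>B. y l * M l j)) * M i j) = 0"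
    using normal_equations[OF assms(2,1), of c M] by blast
  define u where "u j = (\<Sum>i\<in>B. M i j * y i)" for j
  have u: "(\<Sum>l\<in>A. M i l * u l) = (\<Sum>l\<in>A. c l * M i l)" if "i \<in> B" for i
  proof -
    have "(\<Sum>j\<in>A. c j * M i j - M i j * u j) = (\<Sum>j\<in>A. (c j - (\<Sum>l\<in>B. y l * M l j)) * M i j)"
      by (intro sum.cong refl) (simp add: u_def algebra_simps)
    with y that show ?thesis by (simp add: sum_subtractf)
  qed
  have "(\<Sum>i\<in>B. M i j * ((\<Sum>l\<in>A. M i l * u l) - b i)) = 0" if "j \<in> A" for j
  proof -
    have "(\<Sum>i\<in>B. M i j * ((\<Sum>l\<in>A. M i l * u l) - b i)) = (\<Sum>i\<in>B. - ((b i - (\<Sum>l\<in>A. c l * M i l)) * M i j))"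
      by (intro sum.cong refl) (simp only: u, simp add: algebra_simps)
    with c that show ?thesis by (simp add: sum_negf)
  qed
  then show ?thesis by (intro exI[of _ u] exI[of _ y]) (simp add: u_def)
qed

lemma sum_fun_apply1: "(\<Sum>i\<in>I. F i) x = (\<Sum>i\<in>I. (F i :: 'a \<Rightarrow> real) x)"
  by (induction I rule: infinite_finite_induct) simp_all

context carnot_frame
begin

section \<open>The operator \<open>d\<^sub>0\<^sup>-\<^sup>1\<close>\<close>

lemma fip_apply: "fip S \<alpha> \<beta> x = (\<Sum>J\<in>Pow N. \<alpha> J x * \<beta> J x)"
  unfolding fip_def sum_fun_apply1 times_fun_def ..

lemma fip_sum_left: "fip S (\<Sum>i\<in>I. F i) \<gamma> x = (\<Sum>i\<in>I. fip S (F i) \<gamma> x)"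
proof -
  have "fip S (\<Sum>i\<in>I. F i) \<gamma> x = (\<Sum>J\<in>Pow N. \<Sum>i\<in>I. F i J x * \<gamma> J x)"
    unfolding fip_apply sum_fun_apply2 sum_distrib_right ..
  also have "\<dots> = (\<Sum>i\<in>I. fip S (F i) \<gamma> x)" unfolding fip_apply by (rule sum.swap)
  finally show ?thesis .
qed

lemma fip_diff_left: "fip S (\<alpha> - \<beta>) \<gamma> x = fip S \<alpha> \<gamma> x - fip S \<beta> \<gamma> x"
  by (simp add: fip_apply left_diff_distrib sum_subtractf)

lemma fip_fmul_left: "fip S (fmul f \<alpha>) \<gamma> x = f x * fip S \<alpha> \<gamma> x"
  by (simp add: fip_apply fmul_def sum_distrib_left mult.assoc)

lemma fip_definite:
  assumes "\<alpha> \<in> Forms S" "\<And>x. fip S \<alpha> \<alpha> x = 0" shows "\<alpha> = 0"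
proof (intro ext)
  fix J x
  show "\<alpha> J x = 0 J x"
  proof (cases "J \<subseteq> N")
    case True
    have "(\<Sum>J\<in>Pow N. \<alpha> J x * \<alpha> J x) = 0" using assms(2)[of x] by (simp only: fip_apply)
    then have "\<forall>J\<in>Pow N. \<alpha> J x * \<alpha> J x = 0" by (subst (asm) sum_nonneg_eq_0_iff) simp_all
    then have "\<alpha> J x * \<alpha> J x = 0" using True by blast
    then show ?thesis by simp
  next
    case False
    then have "\<alpha> J = 0" using assms(1) by (auto simp: Forms_def)
    then show ?thesis by simp
  qed
qed

text \<open>
  Replaces the coefficients by their values at the point \<open>y\<close>. That \<open>d\<^sub>0\<close> commutes with this operation shows
  that it is given by a matrix of constants.
\<close>
definition freeze :: "'g \<Rightarrow> 'g form \<Rightarrow> 'g form" where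
  "freeze y \<alpha> = (\<lambda>J x. \<alpha> J y)"

lemma d0op_freeze: "d0op (freeze y \<alpha>) = freeze y (d0op \<alpha>)"
proof (intro ext)
  fix K x
  have "emul i (emul j (contr k (freeze y \<alpha>))) K x = emul i (emul j (contr k \<alpha>)) K y" for i j k
    by (simp add: emul_def contr_def freeze_def)
  then show "d0op (freeze y \<alpha>) K x = freeze y (d0op \<alpha>) K x"
    by (simp only: d0op_def freeze_def sum_fun_apply2) (simp only: scl_def)
qed

text \<open>
  The matrix of \<open>d\<^sub>0\<close>; the coefficient is constant, so the point at which it is taken is immaterial.
\<close>
definition dmat :: "nat set \<Rightarrow> nat set \<Rightarrow> real" where
  "dmat K J = d0op (theta J) K undefined"

lemma d0op_theta: "d0op (theta J) K x = dmat K J"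
proof -
  have "freeze y (theta J) = theta J" for y by (simp add: freeze_def theta_def fun_eq_iff)
  then have "d0op (theta J) = freeze undefined (d0op (theta J))" using d0op_freeze by metis
  then have "d0op (theta J) K x = freeze undefined (d0op (theta J)) K x" by simp
  then show ?thesis by (simp only: freeze_def dmat_def)
qed

lemma d0op_matrix:
  assumes "\<alpha> \<in> Forms S" shows "d0op \<alpha> K x = (\<Sum>J\<in>Pow N. dmat K J * \<alpha> J x)"
proof -
  have "d0op \<alpha> = (\<Sum>J\<in>Pow N. d0op (fmul (\<alpha> J) (theta J)))"
    by (simp only: d0op_sum[symmetric] form_expand[OF assms])
  then have "d0op \<alpha> K x = (\<Sum>J\<in>Pow N. fmul (\<alpha> J) (d0op (theta J)) K x)"
    by (simp only: d0op_fmul sum_fun_apply2)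
  then show ?thesis by (simp add: fmul_def d0op_theta mult.commute)
qed

lemma theta_FS: "J \<subseteq> N \<Longrightarrow> theta J \<in> FS {J}"
  by (rule FS_I) (auto simp: theta_def Cinf_const Cinf_0 one_fun_def Cinf_const[of 1, folded one_fun_def] split: if_splits)

lemma dmat_support:
  assumes "J \<subseteq> N" "dmat K J \<noteq> 0"
  shows "K \<subseteq> N \<and> card K = Suc (card J) \<and> wtset S K = wtset S J"
proof -
  have ne: "d0op (theta J) K undefined \<noteq> 0" using assms(2) unfolding dmat_def .
  have "theta J \<in> Forms_deg S (card J)" "theta J \<in> Forms_wt S (int (wtset S J))"
    unfolding Forms_deg_FS Forms_wt_FS by (auto intro: FS_mono[OF theta_FS[OF assms(1)]])
  from FS_D[OF d0op_deg[OF this(1), unfolded Forms_deg_FS] ne]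
    FS_D[OF d0op_wt[OF this(2), unfolded Forms_wt_FS] ne]
  show ?thesis by simp
qed

text \<open>
  Restricting the matrix of \<open>d\<^sub>0\<close> to the block of degree \<open>card K - 1\<close> and of the weight of \<open>\<theta>\<^sub>K\<close> produces a
  left-invariant form \<open>n\<close> that is supported in this block and satisfies the defining conditions of \<open>d\<^sub>0\<^sup>-\<^sup>1\<theta>\<^sub>K\<close>, not
  only against left-invariant forms but, as \<open>d\<^sub>0\<close> is a constant matrix, against all forms. Uniqueness holds
  because the difference \<open>e\<close> of two solutions has \<open>d\<^sub>0e\<close> orthogonal to itself and then \<open>e\<close> orthogonal to
  itself.
\<close>
lemma d0inv_cov_theta:
  fixes K :: "nat set"
  assumes K: "K \<subseteq> N" "K \<noteq> {}"
  defines "\<nu> \<equiv> d0inv_cov S (card K - 1) (theta K)"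
  shows "\<exists>u. \<forall>J x. \<nu> J x = u J"
    and "\<nu> \<in> FS {J. Suc (card J) = card K \<and> wtset S J = wtset S K}"
    and "\<And>\<gamma> x. \<lbrakk>\<gamma> \<in> Forms S; d0op \<gamma> = 0\<rbrakk> \<Longrightarrow> fip S \<nu> \<gamma> x = 0"
    and "\<And>\<gamma> x. \<gamma> \<in> Forms S \<Longrightarrow> fip S (d0op \<nu> - theta K) (d0op \<gamma>) x = 0"
proof -
  have finK: "finite K" using K(1) by (rule finite_sub_N)
  define h where "h = card K - 1"
  have h: "card K = Suc h" unfolding h_def using K(2) finK by (simp add: card_gt_0_iff)
  define A where "A = {J \<in> Pow N. card J = h \<and> wtset S J = wtset S K}"
  define B where "B = {J \<in> Pow N. card J = card K \<and> wtset S J = wtset S K}"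
  have fin: "finite A" "finite B" unfolding A_def B_def by simp_all
  have AN: "A \<subseteq> Pow N" and BN: "B \<subseteq> Pow N" unfolding A_def B_def by blast+
  \<comment> \<open>\<open>A\<close> and \<open>B\<close> index the columns and the rows of one block.\<close>
  have block: "J \<in> A \<longleftrightarrow> K' \<in> B" if "J \<in> Pow N" "dmat K' J \<noteq> 0" for J K'
    using dmat_support[of J K'] that h unfolding A_def B_def by auto
  obtain u y where u: "\<forall>j\<in>A. u j = (\<Sum>i\<in>B. dmat i j * y i)"
    and normal: "\<forall>j\<in>A. (\<Sum>i\<in>B. dmat i j * ((\<Sum>l\<in>A. dmat i l * u l) - (if i = K then 1 else 0))) = 0"
    using pseudo_inverse_vector[OF fin, of dmat "\<lambda>i. if i = K then 1 else 0"] by blast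
  define n :: "'g form" where "n = (\<lambda>J x. if J \<in> A then u J else 0)"
  have n_FS: "n \<in> FS A"
    by (rule FS_I) (auto simp: n_def Cinf_const A_def split: if_splits)
  have n_Forms: "n \<in> Forms S" by (rule FS_Forms[OF n_FS])
  have n_transpose: "n J x = (\<Sum>i\<in>B. dmat i J * y i)" if "J \<in> Pow N" for J x
  proof (cases "J \<in> A")
    case False
    then have "dmat i J = 0" if "i \<in> B" for i using block[OF \<open>J \<in> Pow N\<close>] that by blast
    with False show ?thesis by (simp add: n_def)
  qed (simp add: n_def u)
  have dn: "d0op n i x = (\<Sum>l\<in>A. dmat i l * u l)" for i x
  proof -
    have "d0op n i x = (\<Sum>l\<in>Pow N. if l \<in> A then dmat i l * u l else 0)"
      unfolding d0op_matrix[OF n_Forms] by (intro sum.cong refl) (simp add: n_def)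
    also have "\<dots> = (\<Sum>l\<in>A. dmat i l * u l)"
      by (rule sum.mono_neutral_cong_right) (use AN in auto)
    finally show ?thesis .
  qed
  have n_perp: "fip S n \<gamma> x = 0" if g: "\<gamma> \<in> Forms S" "d0op \<gamma> = 0" for \<gamma> x
  proof -
    have "fip S n \<gamma> x = (\<Sum>J\<in>Pow N. \<Sum>i\<in>B. y i * (dmat i J * \<gamma> J x))"
      unfolding fip_apply
    proof (rule sum.cong[OF refl])
      fix J assume J: "J \<in> Pow N"
      show "n J x * \<gamma> J x = (\<Sum>i\<in>B. y i * (dmat i J * \<gamma> J x))"
        unfolding n_transpose[OF J] sum_distrib_right by (simp add: mult_ac)
    qed
    also have "\<dots> = (\<Sum>i\<in>B. \<Sum>J\<in>Pow N. y i * (dmat i J * \<gamma> J x))" by (rule sum.swap)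
    also have "\<dots> = (\<Sum>i\<in>B. y i * d0op \<gamma> i x)"
      by (simp only: d0op_matrix[OF g(1)] sum_distrib_left)
    also have "\<dots> = 0" by (simp add: g(2))
    finally show ?thesis .
  qed
  have normal': "(\<Sum>i\<in>Pow N. dmat i J * (d0op n i x - theta K i x)) = 0" if J: "J \<in> Pow N" for J x
  proof (cases "J \<in> A")
    case True
    have "(\<Sum>i\<in>Pow N. dmat i J * (d0op n i x - theta K i x)) = (\<Sum>i\<in>B. dmat i J * (d0op n i x - theta K i x))"
      using BN True block[OF J] by (intro sum.mono_neutral_right) auto
    also have "\<dots> = (\<Sum>i\<in>B. dmat i J * ((\<Sum>l\<in>A. dmat i l * u l) - (if i = K then 1 else 0)))"
      by (intro sum.cong refl) (simp add: dn theta_def)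
    finally show ?thesis using normal True by simp
  next
    case False
    show ?thesis
    proof (intro sum.neutral ballI)
      fix i
      show "dmat i J * (d0op n i x - theta K i x) = 0"
      proof (cases "dmat i J = 0")
        case nz: False
        then have iB: "i \<notin> B" using block[OF J] False by blast
        have "K \<in> B" using K by (simp add: B_def)
        then have "theta K i x = 0" using iB by (auto simp: theta_def)
        moreover have "dmat i l = 0" if "l \<in> A" for l using block[of l i] iB that AN by blast
        ultimately show ?thesis by (simp add: dn)
      qed simp
    qed
  qed
  have n_normal: "fip S (d0op n - theta K) (d0op \<gamma>) x = 0" if g: "\<gamma> \<in> Forms S" for \<gamma> x
  proof -
    have "fip S (d0op n - theta K) (d0op \<gamma>) x
       = (\<Sum>i\<in>Pow N. \<Sum>J\<in>Pow N. \<gamma> J x * (dmat i J * (d0op n i x - theta K i x)))"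
      unfolding fip_apply d0op_matrix[OF g] sum_distrib_left by (simp add: mult_ac)
    also have "\<dots> = (\<Sum>J\<in>Pow N. \<Sum>i\<in>Pow N. \<gamma> J x * (dmat i J * (d0op n i x - theta K i x)))"
      by (rule sum.swap)
    also have "\<dots> = (\<Sum>J\<in>Pow N. \<gamma> J x * (\<Sum>i\<in>Pow N. dmat i J * (d0op n i x - theta K i x)))"
      by (simp only: sum_distrib_left)
    also have "\<dots> = 0" by (intro sum.neutral ballI) (subst normal', assumption, rule mult_zero_right)
    finally show ?thesis .
  qed
  have n_Linv: "n \<in> Linv_deg S h"
  proof -
    have "n \<in> Forms_deg S h" unfolding Forms_deg_FS by (rule FS_mono[OF n_FS]) (auto simp: A_def)
    then show ?thesis by (auto simp: Linv_deg_def n_def)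
  qed
  have LF: "\<alpha> \<in> Forms S" if "\<alpha> \<in> Linv_deg S h" for \<alpha>
    using that by (simp add: Linv_deg_def Forms_deg_def)
  have "\<nu> = n"
    unfolding \<nu>_def h_def[symmetric] d0inv_cov_def
  proof (rule the_equality, intro conjI ballI impI)
    show "n \<in> Linv_deg S h" by (rule n_Linv)
    fix \<gamma> assume g: "\<gamma> \<in> Linv_deg S h"
    show "fip S n \<gamma> = 0" if "dw S 0 \<gamma> = 0"
      using that n_perp[OF LF[OF g]] by (auto simp: dw_0[OF LF[OF g]] fun_eq_iff)
    show "fip S (dw S 0 n - theta K) (dw S 0 \<gamma>) = 0"
      using n_normal[OF LF[OF g]] unfolding dw_0[OF LF[OF g]] dw_0[OF n_Forms] by (auto simp: fun_eq_iff)
  next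
    fix \<alpha> assume a: "\<alpha> \<in> Linv_deg S h \<and> (\<forall>\<gamma>\<in>Linv_deg S h. dw S 0 \<gamma> = 0 \<longrightarrow> fip S \<alpha> \<gamma> = 0) \<and>
      (\<forall>\<gamma>\<in>Linv_deg S h. fip S (dw S 0 \<alpha> - theta K) (dw S 0 \<gamma>) = 0)"
    then have aL: "\<alpha> \<in> Linv_deg S h" by (rule conjunct1)
    have aperp: "fip S \<alpha> \<gamma> = 0" if "\<gamma> \<in> Linv_deg S h" "dw S 0 \<gamma> = 0" for \<gamma>
      using a[THEN conjunct2, THEN conjunct1] that by simp
    have anorm: "fip S (dw S 0 \<alpha> - theta K) (dw S 0 \<gamma>) = 0" if "\<gamma> \<in> Linv_deg S h" for \<gamma>
      using a[THEN conjunct2, THEN conjunct2] that by simp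
    define e where "e = \<alpha> - n"
    have eL: "e \<in> Linv_deg S h"
    proof -
      have "e \<in> Forms_deg S h"
        using aL n_Linv unfolding e_def Linv_deg_def by (intro Forms_deg_diff) simp_all
      moreover have "\<exists>c. e J = (\<lambda>x. c)" for J
      proof -
        obtain c where "\<alpha> J = (\<lambda>x. c)" using aL by (auto simp: Linv_deg_def)
        then have "e J = (\<lambda>x. c - (if J \<in> A then u J else 0))"
          by (simp add: e_def n_def fun_eq_iff)
        then show ?thesis by blast
      qed
      ultimately show ?thesis by (simp add: Linv_deg_def)
    qed
    note eF = LF[OF eL] and aF = LF[OF aL]
    have dle: "d0op e = (d0op \<alpha> - theta K) - (d0op n - theta K)"
      using lin_op_diff[OF dw_lin aF n_Forms, of 0]
      unfolding e_def[symmetric] dw_0[OF eF] dw_0[OF aF] dw_0[OF n_Forms] by simp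
    have "fip S (d0op e) (d0op e) x = 0" for x
    proof -
      have "fip S (d0op \<alpha> - theta K) (d0op e) x = 0"
        using anorm[OF eL] unfolding dw_0[OF eF] dw_0[OF aF] by simp
      moreover have "fip S (d0op n - theta K) (d0op e) x = 0" by (rule n_normal[OF eF])
      moreover have "fip S (d0op e) (d0op e) x = fip S (d0op \<alpha> - theta K) (d0op e) x - fip S (d0op n - theta K) (d0op e) x"
        by (subst (1) dle) (rule fip_diff_left)
      ultimately show ?thesis by simp
    qed
    then have dle0: "d0op e = 0" by (rule fip_definite[OF Forms_d0op[OF eF]])
    have "fip S e e x = 0" for x
    proof -
      have "fip S \<alpha> e x = 0" using aperp[OF eL] dle0 unfolding dw_0[OF eF] by simp
      moreover have "fip S n e x = 0" by (rule n_perp[OF eF dle0])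
      moreover have "fip S e e x = fip S \<alpha> e x - fip S n e x"
        by (subst (1) e_def) (rule fip_diff_left)
      ultimately show ?thesis by simp
    qed
    then have "e = 0" by (rule fip_definite[OF eF])
    then show "\<alpha> = n" by (simp add: e_def)
  qed
  show "\<exists>u. \<forall>J x. \<nu> J x = u J"
    unfolding \<open>\<nu> = n\<close> n_def by (intro exI[of _ "\<lambda>J. if J \<in> A then u J else 0"] allI refl)
  show "\<nu> \<in> FS {J. Suc (card J) = card K \<and> wtset S J = wtset S K}"
    unfolding \<open>\<nu> = n\<close> by (rule FS_mono[OF n_FS]) (auto simp: A_def h)
  show "fip S \<nu> \<gamma> x = 0" if "\<gamma> \<in> Forms S" "d0op \<gamma> = 0" for \<gamma> x
    unfolding \<open>\<nu> = n\<close> by (rule n_perp[OF that])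
  show "fip S (d0op \<nu> - theta K) (d0op \<gamma>) x = 0" if "\<gamma> \<in> Forms S" for \<gamma> x
    unfolding \<open>\<nu> = n\<close> by (rule n_normal[OF that])
qed

lemma d0inv_FS:
  assumes "\<beta> \<in> FS B" "\<And>K J. \<lbrakk>K \<in> B; K \<subseteq> N; Suc (card J) = card K; wtset S J = wtset S K\<rbrakk> \<Longrightarrow> J \<in> C"
  shows "d0inv S \<beta> \<in> FS C"
  unfolding d0inv_def
proof (rule FS_sum)
  fix K assume K: "K \<in> Pow N - {{}}"
  let ?\<nu> = "d0inv_cov S (card K - 1) (theta K)"
  obtain u where u: "\<And>J x. ?\<nu> J x = u J" using d0inv_cov_theta(1)[of K] K by blast
  have nF: "?\<nu> \<in> FS {J. Suc (card J) = card K \<and> wtset S J = wtset S K}"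
    using K by (intro d0inv_cov_theta(2)) auto
  show "fmul (\<beta> K) ?\<nu> \<in> FS C"
  proof (rule FS_I)
    fix J x
    have "fmul (\<beta> K) ?\<nu> J = (\<lambda>x. u J * \<beta> K x)" by (simp only: fmul_def times_fun_def u mult.commute)
    then show "fmul (\<beta> K) ?\<nu> J \<in> Csm" using Cinf_cmult[OF FS_Csm[OF assms(1)]] by (simp only:)
    assume "fmul (\<beta> K) ?\<nu> J x \<noteq> 0"
    then have "\<beta> K x \<noteq> 0" "?\<nu> J x \<noteq> 0" by (simp_all add: fmul_def)
    from FS_D[OF assms(1) this(1)] FS_D[OF nF this(2)] assms(2)[of K J]
    show "J \<subseteq> N \<and> J \<in> C" by blast
  qed
qed

lemma Forms_d0inv: "\<beta> \<in> Forms S \<Longrightarrow> d0inv S \<beta> \<in> Forms S"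
  unfolding FS_UNIV by (rule d0inv_FS) auto

lemma d0inv_wt: "\<beta> \<in> Forms_wt S p \<Longrightarrow> d0inv S \<beta> \<in> Forms_wt S p"
  unfolding Forms_wt_FS by (rule d0inv_FS) auto

lemma d0inv_deg: "\<beta> \<in> Forms_deg S (Suc h) \<Longrightarrow> d0inv S \<beta> \<in> Forms_deg S h"
  unfolding Forms_deg_FS by (rule d0inv_FS) auto

text \<open>
  For functions the definition of \<open>d\<^sub>0\<^sup>-\<^sup>1\<close> has no term at all.
\<close>
lemma d0inv_deg0: assumes "\<beta> \<in> Forms_deg S 0" shows "d0inv S \<beta> = 0"
proof -
  have "d0inv S \<beta> \<in> FS {}" using assms unfolding Forms_deg_FS by (rule d0inv_FS) auto
  then show ?thesis using FS_D[of "d0inv S \<beta>" "{}"] by (auto simp: fun_eq_iff)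
qed

lemma raises_d0inv: "raises 0 (d0inv S)"
  unfolding raises_def lin_op_def
proof (intro conjI allI ballI)
  fix \<alpha> \<beta> :: "'g form" and c
  show "d0inv S (\<alpha> + \<beta>) = d0inv S \<alpha> + d0inv S \<beta>"
    unfolding d0inv_def sum.distrib[symmetric]
    by (intro sum.cong refl) (simp add: fmul_def fun_eq_iff algebra_simps)
  show "d0inv S (scl c \<alpha>) = scl c (d0inv S \<alpha>)"
    unfolding d0inv_def vf.scale_sum_right
    by (intro sum.cong refl) (simp add: fmul_def scl_def fun_eq_iff)
  show "\<alpha> \<in> Forms S \<Longrightarrow> d0inv S \<alpha> \<in> Forms S" by (rule Forms_d0inv)
  fix p show "\<alpha> \<in> Forms_wt S p \<Longrightarrow> d0inv S \<alpha> \<in> Forms_wt S (p + int 0)" by (simp add: d0inv_wt)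
qed

lemmas d0inv_lin = raises_lin[OF raises_d0inv]

lemma d0inv_perp:
  assumes "\<gamma> \<in> Forms S" "d0op \<gamma> = 0" shows "fip S (d0inv S \<beta>) \<gamma> x = 0"
  unfolding d0inv_def fip_sum_left fip_fmul_left
proof (intro sum.neutral ballI)
  fix K assume "K \<in> Pow N - {{}}"
  then have "fip S (d0inv_cov S (card K - 1) (theta K)) \<gamma> x = 0"
    by (intro d0inv_cov_theta(3)[OF _ _ assms]) auto
  then show "\<beta> K x * fip S (d0inv_cov S (card K - 1) (theta K)) \<gamma> x = 0"
    by (simp only: mult_zero_right)
qed

lemma d0inv_normal:
  assumes "\<beta> \<in> Forms S" "\<gamma> \<in> Forms S" shows "fip S (d0op (d0inv S \<beta>) - \<beta>) (d0op \<gamma>) x = 0"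
proof -
  let ?\<nu> = "\<lambda>K. d0inv_cov S (card K - 1) (theta K)"
  have "d0op (d0inv S \<beta>) = (\<Sum>K\<in>Pow N - {{}}. fmul (\<beta> K) (d0op (?\<nu> K)))"
    unfolding d0inv_def by (simp only: d0op_sum d0op_fmul)
  moreover have "\<beta> = fmul (\<beta> {}) (theta {}) + (\<Sum>K\<in>Pow N - {{}}. fmul (\<beta> K) (theta K))"
    by (subst form_expand[OF assms(1), symmetric]) (rule sum.remove, auto)
  ultimately have "d0op (d0inv S \<beta>) - \<beta>
      = (\<Sum>K\<in>Pow N - {{}}. fmul (\<beta> K) (d0op (?\<nu> K))) - (fmul (\<beta> {}) (theta {}) + (\<Sum>K\<in>Pow N - {{}}. fmul (\<beta> K) (theta K)))"
    by metis
  also have "\<dots> = (\<Sum>K\<in>Pow N - {{}}. fmul (\<beta> K) (d0op (?\<nu> K) - theta K)) - fmul (\<beta> {}) (theta {})"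
  proof -
    have "fmul f (a - b) = fmul f a - fmul f b" for f and a b :: "'g form"
      by (simp add: fmul_def fun_eq_iff algebra_simps)
    then show ?thesis by (simp only: sum_subtractf) (simp only: diff_diff_eq add.commute)
  qed
  finally have "fip S (d0op (d0inv S \<beta>) - \<beta>) (d0op \<gamma>) x
      = (\<Sum>K\<in>Pow N - {{}}. \<beta> K x * fip S (d0op (?\<nu> K) - theta K) (d0op \<gamma>) x) - \<beta> {} x * fip S (theta {}) (d0op \<gamma>) x"
    by (simp only: fip_diff_left[of "sum _ _"] fip_sum_left fip_fmul_left)
  moreover have "(\<Sum>K\<in>Pow N - {{}}. \<beta> K x * fip S (d0op (?\<nu> K) - theta K) (d0op \<gamma>) x) = 0"
  proof (intro sum.neutral ballI)
    fix K assume "K \<in> Pow N - {{}}"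
    then have "fip S (d0op (?\<nu> K) - theta K) (d0op \<gamma>) x = 0"
      by (intro d0inv_cov_theta(4)[OF _ _ assms(2)]) auto
    then show "\<beta> K x * fip S (d0op (?\<nu> K) - theta K) (d0op \<gamma>) x = 0"
      by (simp only: mult_zero_right)
  qed
  moreover have "fip S (theta {}) (d0op \<gamma>) x = 0"
    unfolding fip_apply
  proof (intro sum.neutral ballI)
    fix J
    have "dmat {} I = 0" if "I \<in> Pow N" for I using dmat_support[of I "{}"] that by auto
    then have "d0op \<gamma> {} x = 0" unfolding d0op_matrix[OF assms(2)] by simp
    then show "theta {} J x * d0op \<gamma> J x = 0" by (simp add: theta_def)
  qed
  ultimately show ?thesis by simp
qed

text \<open>
  If \<open>\<beta>\<close> is orthogonal to the image of \<open>d\<^sub>0\<close>, then \<open>d\<^sub>0d\<^sub>0\<^sup>-\<^sup>1\<beta>\<close>, the projection of \<open>\<beta>\<close> to that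
  image, is \<open>0\<close>, so \<open>d\<^sub>0\<^sup>-\<^sup>1\<beta>\<close> lies both in the kernel of \<open>d\<^sub>0\<close> and in its orthogonal complement.
\<close>
lemma d0inv_eq_0:
  assumes "\<beta> \<in> Forms S" "\<And>\<gamma> x. \<gamma> \<in> Forms S \<Longrightarrow> fip S \<beta> (d0op \<gamma>) x = 0"
  shows "d0inv S \<beta> = 0"
proof -
  let ?e = "d0inv S \<beta>"
  have eF: "?e \<in> Forms S" by (rule Forms_d0inv[OF assms(1)])
  have "fip S (d0op ?e) (d0op ?e) x = 0" for x
    using d0inv_normal[OF assms(1) eF, of x] assms(2)[OF eF, of x] by (simp add: fip_diff_left)
  then have "d0op ?e = 0" by (rule fip_definite[OF Forms_d0op[OF eF]])
  then have "fip S ?e ?e x = 0" for x by (rule d0inv_perp[OF eF])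
  then show ?thesis by (rule fip_definite[OF eF])
qed

text \<open>
  \<open>d\<^sub>0\<^sup>-\<^sup>1\<beta>\<close> is orthogonal to the kernel of \<open>d\<^sub>0\<close>, which contains the image of \<open>d\<^sub>0\<close>.
\<close>
lemma d0inv_d0inv: "\<beta> \<in> Forms S \<Longrightarrow> d0inv S (d0inv S \<beta>) = 0"
  by (rule d0inv_eq_0[OF Forms_d0inv d0inv_perp[OF Forms_d0op d0op_d0op]])

lemma d0op_diff: "d0op (\<alpha> - \<beta>) = d0op \<alpha> - d0op \<beta>"
  using d0op_add[of "\<alpha> - \<beta>" \<beta>] by (simp add: eq_diff_eq)

lemma d0op_d0inv_d0op:
  assumes "\<gamma> \<in> Forms S" shows "d0op (d0inv S (d0op \<gamma>)) = d0op \<gamma>"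
proof -
  let ?e = "d0inv S (d0op \<gamma>) - \<gamma>"
  have eF: "?e \<in> Forms S" by (rule Forms_diff[OF Forms_d0inv[OF Forms_d0op[OF assms]] assms])
  have "fip S (d0op ?e) (d0op ?e) x = 0" for x
    using d0inv_normal[OF Forms_d0op[OF assms] eF, of x] unfolding d0op_diff[of "d0inv S (d0op \<gamma>)" \<gamma>] .
  then have "d0op ?e = 0" by (rule fip_definite[OF Forms_d0op[OF eF]])
  then show ?thesis unfolding d0op_diff by (rule right_minus_eq[THEN iffD1])
qed

text \<open>
  \<open>d\<^sub>0\<^sup>-\<^sup>1d\<^sub>0z - z\<close> lies both in the kernel of \<open>d\<^sub>0\<close> and in its orthogonal complement.
\<close>
lemma d0inv_d0op_id:
  assumes "z \<in> Ker_d0_perp S" shows "d0inv S (d0op z) = z"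
proof -
  have zF: "z \<in> Forms S" and zp: "\<And>\<gamma> x. \<gamma> \<in> Forms S \<Longrightarrow> d0op \<gamma> = 0 \<Longrightarrow> fip S z \<gamma> x = 0"
    using assms by (auto simp: Ker_d0_perp_def dw_0)
  let ?e = "d0inv S (d0op z) - z"
  have eF: "?e \<in> Forms S" by (rule Forms_diff[OF Forms_d0inv[OF Forms_d0op[OF zF]] zF])
  have "d0op ?e = 0" unfolding d0op_diff d0op_d0inv_d0op[OF zF] by (rule diff_self)
  then have "fip S ?e ?e x = 0" for x
    unfolding fip_diff_left[of _ _ ?e] using d0inv_perp[OF eF] zp[OF eF] by simp
  then have "?e = 0" by (rule fip_definite[OF eF])
  then show ?thesis by (rule right_minus_eq[THEN iffD1])
qed

lemma d0inv_Ker_perp: "\<beta> \<in> Forms S \<Longrightarrow> d0inv S \<beta> \<in> Ker_d0_perp S"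
  unfolding Ker_d0_perp_def using d0inv_perp by (auto simp: Forms_d0inv dw_0 fun_eq_iff)

end

section \<open>Compositions\<close>

lemma finite_compositions: "finite (compositions m n)"
proof (rule finite_subset)
  show "compositions m n \<subseteq> {is. set is \<subseteq> {..n} \<and> length is = m}"
    unfolding compositions_def using member_le_sum_list by auto
qed (rule finite_lists_length_eq, simp)

lemma compositions_0: "compositions 0 n = (if n = 0 then {[]} else {})"
  by (auto simp: compositions_def)

lemma compositions_Suc:
  "compositions (Suc m) n = (\<lambda>(i, is). i # is) ` (SIGMA i:{1..n}. compositions m (n - i))"
proof (intro equalityI subsetI)
  fix js assume "js \<in> compositions (Suc m) n"
  then obtain i "is" where "js = i # is" "length is = m" "1 \<le> i" "\<forall>i\<in>set is. 1 \<le> i" "i + sum_list is = n"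
    unfolding compositions_def by (auto simp: length_Suc_conv)
  then show "js \<in> (\<lambda>(i, is). i # is) ` (SIGMA i:{1..n}. compositions m (n - i))"
    by (intro image_eqI[of _ _ "(i, is)"]) (auto simp: compositions_def)
qed (auto simp: compositions_def)

lemma compositions_empty:
  assumes "n < m" shows "compositions m n = {}"
proof -
  have "length is \<le> sum_list is" if "\<forall>i\<in>set is. 1 \<le> i" for "is" :: "nat list"
    using that by (induction "is") auto
  then show ?thesis using assms by (fastforce simp: compositions_def)
qed

context carnot_frame
begin

section \<open>The explicit lifts\<close>

definition step_op :: "nat \<Rightarrow> 'g form \<Rightarrow> 'g form" where
  "step_op i \<alpha> = d0inv S (dw S i \<alpha>)"

lemma raises_step: "raises i (step_op i)"
  using raises_comp[OF raises_d0inv raises_dw[of i]] unfolding step_op_def[abs_def] by (simp only: add_0_right)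

lemmas step_lin = raises_lin[OF raises_step]
lemmas Forms_step = lin_op_Forms[OF step_lin]

lemma step_deg: "\<alpha> \<in> Forms_deg S h \<Longrightarrow> step_op i \<alpha> \<in> Forms_deg S h"
  unfolding step_op_def by (intro d0inv_deg dw_deg)

lemma d0inv_word_Nil: "d0inv_word S [] \<alpha> = \<alpha>"
  by (simp add: d0inv_word_def)

lemma d0inv_word_Cons: "d0inv_word S (i # is) \<alpha> = step_op i (d0inv_word S is \<alpha>)"
  by (simp add: d0inv_word_def step_op_def)

lemma raises_id: "raises 0 (\<lambda>\<alpha>. \<alpha>)"
  by (simp add: raises_def lin_op_def)

lemma raises_word: "raises (sum_list is) (d0inv_word S is)"
proof (induction "is")
  case Nil
  show ?case using raises_id by (simp add: d0inv_word_Nil[abs_def])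
next
  case (Cons i "is")
  have "raises (sum_list is + i) (\<lambda>\<alpha>. step_op i (d0inv_word S is \<alpha>))"
    by (rule raises_comp[OF raises_step Cons])
  then show ?case unfolding d0inv_word_Cons[abs_def] by (simp only: sum_list.Cons add.commute)
qed

text \<open>
  The words are grouped by their length \<open>m\<close>, along which the recursion runs.
\<close>
definition word_sum :: "nat \<Rightarrow> nat \<Rightarrow> 'g form \<Rightarrow> 'g form" where
  "word_sum m n \<alpha> = (\<Sum>is\<in>compositions m n. d0inv_word S is \<alpha>)"

text \<open>
  The inner sum of the explicit formula for \<open>\<partial>\<^sub>r\<close>. It sends \<open>x\<close> to the lift \<open>z\<^bsub>p+n\<^esub>\<close>.
\<close>
definition lift_op :: "nat \<Rightarrow> 'g form \<Rightarrow> 'g form" where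
  "lift_op n \<alpha> = (\<Sum>m=1..n. scl ((-1) ^ (m - 1)) (word_sum m n \<alpha>))"

lemma partial_op_lift:
  "partial_op S r \<alpha> = dw S r \<alpha> - (\<Sum>i=1..r-1. dw S i (lift_op (r - i) \<alpha>))"
  unfolding partial_op_def lift_op_def word_sum_def ..

lemma raises_word_sum: "raises n (word_sum m n)"
  unfolding word_sum_def[abs_def]
proof (rule raises_sum)
  fix "is" assume "is \<in> compositions m n"
  then have "sum_list is = n" by (simp add: compositions_def)
  then show "raises n (d0inv_word S is)" using raises_word[of "is"] by simp
qed

lemma raises_lift: "raises n (lift_op n)"
  unfolding lift_op_def[abs_def] by (rule raises_sum[OF raises_scl[OF raises_word_sum]])

lemmas Forms_word_sum = lin_op_Forms[OF raises_lin[OF raises_word_sum]]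
lemmas Forms_lift = lin_op_Forms[OF raises_lin[OF raises_lift]]

lemma word_sum_0: "word_sum 0 n \<alpha> = (if n = 0 then \<alpha> else 0)"
  by (simp add: word_sum_def compositions_0 d0inv_word_Nil)

lemma word_sum_vanish: "n < m \<Longrightarrow> word_sum m n \<alpha> = 0"
  by (simp add: word_sum_def compositions_empty)

lemma word_sum_Suc:
  assumes "\<alpha> \<in> Forms S"
  shows "word_sum (Suc m) n \<alpha> = (\<Sum>i=1..n. step_op i (word_sum m (n - i) \<alpha>))"
proof -
  have "word_sum (Suc m) n \<alpha> = (\<Sum>(i, is)\<in>(SIGMA i:{1..n}. compositions m (n - i)). d0inv_word S (i # is) \<alpha>)"
    unfolding word_sum_def compositions_Suc
    by (subst sum.reindex) (auto simp: inj_on_def case_prod_unfold)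
  also have "\<dots> = (\<Sum>i=1..n. \<Sum>is\<in>compositions m (n - i). step_op i (d0inv_word S is \<alpha>))"
    unfolding d0inv_word_Cons by (rule sum.Sigma[symmetric]) (auto simp: finite_compositions)
  also have "\<dots> = (\<Sum>i=1..n. step_op i (word_sum m (n - i) \<alpha>))"
    unfolding word_sum_def
    by (rule sum.cong[OF refl]) (rule lin_op_sum[OF step_lin lin_op_Forms[OF raises_lin[OF raises_word] assms], symmetric])
  finally show ?thesis .
qed

text \<open>
  Words of length \<open>m + 1\<close> are a first letter \<open>i\<close> followed by a word of length \<open>m\<close> and weight \<open>n - i\<close>. The word
  of length one contributes \<open>d\<^sub>0\<^sup>-\<^sup>1d\<^sub>n\<close>; in the longer ones, the sign changes by one factor \<open>-1\<close>.
\<close>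
lemma lift_op_recursion:
  assumes "\<alpha> \<in> Forms S" "1 \<le> n"
  shows "lift_op n \<alpha> = step_op n \<alpha> - (\<Sum>i=1..n-1. step_op i (lift_op (n - i) \<alpha>))"
proof -
  let ?g = "\<lambda>m. scl ((-1) ^ m) (word_sum (Suc m) n \<alpha>)"
  let ?h = "\<lambda>i. \<Sum>m=1..n-1. scl ((-1) ^ m) (word_sum m (n - i) \<alpha>)"
  have "lift_op n \<alpha> = (\<Sum>m=0..n-1. ?g m)"
    unfolding lift_op_def
    by (rule sum.reindex_bij_witness[of _ Suc "\<lambda>m. m - 1"]) (use assms(2) in auto)
  also have "\<dots> = ?g 0 + (\<Sum>m=1..n-1. ?g m)"
    unfolding sum.atLeast_Suc_atMost[OF le0] One_nat_def ..
  also have "?g 0 = step_op n \<alpha>"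
  proof -
    have "word_sum (Suc 0) n \<alpha> = (\<Sum>i=1..n. if i = n then step_op n \<alpha> else 0)"
      unfolding word_sum_Suc[OF assms(1)] word_sum_0
      by (rule sum.cong[OF refl]) (auto simp: lin_op_0[OF step_lin])
    also have "\<dots> = step_op n \<alpha>" using assms(2) by (simp add: sum.delta)
    finally show ?thesis by (simp only: power_0 vf.scale_one)
  qed
  also have "(\<Sum>m=1..n-1. ?g m) = (\<Sum>i=1..n. step_op i (?h i))"
  proof -
    have "(\<Sum>m=1..n-1. ?g m) = (\<Sum>m=1..n-1. \<Sum>i=1..n. step_op i (scl ((-1) ^ m) (word_sum m (n - i) \<alpha>)))"
      unfolding word_sum_Suc[OF assms(1)] vf.scale_sum_right
      by (rule sum.cong[OF refl], rule sum.cong[OF refl]) (rule lin_op_scl[OF step_lin Forms_word_sum[OF assms(1)], symmetric])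
    also have "\<dots> = (\<Sum>i=1..n. \<Sum>m=1..n-1. step_op i (scl ((-1) ^ m) (word_sum m (n - i) \<alpha>)))"
      by (rule sum.swap)
    also have "\<dots> = (\<Sum>i=1..n. step_op i (?h i))"
      by (rule sum.cong[OF refl]) (rule lin_op_sum[OF step_lin Forms_scl[OF Forms_word_sum[OF assms(1)]], symmetric])
    finally show ?thesis .
  qed
  also have "\<dots> = (\<Sum>i=1..n-1. step_op i (- lift_op (n - i) \<alpha>))"
  proof (rule sum.mono_neutral_cong_right)
    show "\<forall>i\<in>{1..n} - {1..n-1}. step_op i (?h i) = 0"
    proof
      fix i assume "i \<in> {1..n} - {1..n-1}"
      then have "n - i = 0" by auto
      then have "?h i = 0"
        by (intro sum.neutral ballI) (auto simp: word_sum_vanish)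
      then show "step_op i (?h i) = 0"
        by (simp only: lin_op_0[OF step_lin])
    qed
  next
    fix i assume i: "i \<in> {1..n-1}"
    have "?h i = (\<Sum>m=1..n-i. scl ((-1) ^ m) (word_sum m (n - i) \<alpha>))"
      by (rule sum.mono_neutral_right) (use i in \<open>auto simp: word_sum_vanish\<close>)
    also have "\<dots> = (\<Sum>m=1..n-i. - scl ((-1) ^ (m - 1)) (word_sum m (n - i) \<alpha>))"
    proof (rule sum.cong[OF refl])
      fix m assume "m \<in> {1..n-i}"
      then have "(-1::real) ^ m = - ((-1) ^ (m - 1))" by (cases m) simp_all
      then show "scl ((-1) ^ m) (word_sum m (n - i) \<alpha>) = - scl ((-1) ^ (m - 1)) (word_sum m (n - i) \<alpha>)"
        by (simp only: vf.scale_minus_left)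
    qed
    also have "\<dots> = - lift_op (n - i) \<alpha>" unfolding lift_op_def by (rule sum_negf)
    finally show "step_op i (?h i) = step_op i (- lift_op (n - i) \<alpha>)"
      by (rule arg_cong)
  qed auto
  also have "\<dots> = (\<Sum>i=1..n-1. - step_op i (lift_op (n - i) \<alpha>))"
    by (rule sum.cong[OF refl]) (rule lin_op_minus[OF step_lin Forms_lift[OF assms(1)]])
  also have "\<dots> = - (\<Sum>i=1..n-1. step_op i (lift_op (n - i) \<alpha>))" by (rule sum_negf)
  finally show ?thesis unfolding diff_conv_add_uminus .
qed

section \<open>The spectral sequence of the weight filtration\<close>

lemma Z_liftD:
  assumes "Z_lift S r p x z"
  shows "x \<in> Forms_wt S p" "j \<in> {1..<r} \<Longrightarrow> z j \<in> Forms_wt S (p + int j)" "dw S 0 x = 0"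
    "n \<in> {1..<r} \<Longrightarrow> dw S n x = (\<Sum>i=0..n-1. dw S i (z (n - i)))"
  using assms unfolding Z_lift_def by simp_all

text \<open>
  The condition on \<open>z\<^bsub>p+n\<^esub>\<close> prescribes \<open>d\<^sub>0z\<^bsub>p+n\<^esub>\<close> in terms of the earlier lifts, and \<open>d\<^sub>0\<^sup>-\<^sup>1d\<^sub>0\<close> is the identity
  on \<open>(Ker d\<^sub>0)\<^sup>\<bottom>\<close>.
\<close>
lemma lift_unique:
  assumes Z: "Z_lift S r p x z" and perp: "\<And>j. j \<in> {1..<r} \<Longrightarrow> z j \<in> Ker_d0_perp S" and "n \<in> {1..<r}"
  shows "z n = lift_op n x"
  using assms(3)
proof (induction n rule: less_induct)
  case (less n)
  note xF = Forms_wt_Forms[OF Z_liftD(1)[OF Z]]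
  have zF: "z j \<in> Forms S" if "j \<in> {1..<r}" for j using Forms_wt_Forms[OF Z_liftD(2)[OF Z that]] .
  have "dw S n x = dw S 0 (z (n - 0)) + (\<Sum>i=1..n-1. dw S i (z (n - i)))"
    unfolding Z_liftD(4)[OF Z less.prems] sum.atLeast_Suc_atMost[OF le0] One_nat_def ..
  also have "\<dots> = d0op (z n) + (\<Sum>i=1..n-1. dw S i (z (n - i)))"
    unfolding diff_zero dw_0[OF zF[OF less.prems]] ..
  also have "(\<Sum>i=1..n-1. dw S i (z (n - i))) = (\<Sum>i=1..n-1. dw S i (lift_op (n - i) x))"
  proof (rule sum.cong[OF refl])
    fix i assume "i \<in> {1..n-1}"
    then have "n - i < n" "n - i \<in> {1..<r}" using less.prems by auto
    then show "dw S i (z (n - i)) = dw S i (lift_op (n - i) x)" using less.IH by simp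
  qed
  finally have "d0op (z n) = dw S n x - (\<Sum>i=1..n-1. dw S i (lift_op (n - i) x))"
    unfolding eq_diff_eq by (rule sym)
  then have "z n = d0inv S (dw S n x - (\<Sum>i=1..n-1. dw S i (lift_op (n - i) x)))"
    using d0inv_d0op_id[OF perp[OF less.prems]] by (simp only:)
  also have "\<dots> = step_op n x - (\<Sum>i=1..n-1. step_op i (lift_op (n - i) x))"
    unfolding step_op_def
      lin_op_diff[OF d0inv_lin Forms_dw[OF xF] Forms_sum[OF Forms_dw[OF Forms_lift[OF xF]]]]
      lin_op_sum[OF d0inv_lin Forms_dw[OF Forms_lift[OF xF]]] ..
  also have "\<dots> = lift_op n x"
    by (rule lift_op_recursion[OF xF, symmetric]) (use less.prems in simp)
  finally show ?case .
qed

lemma BrI: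
  assumes "x \<in> Forms_wt S p" "\<And>k. k \<in> {0..<r} \<Longrightarrow> c k \<in> Forms_wt S (p - int k)"
    "x = (\<Sum>k\<in>{0..<r}. dw S k (c k))" "\<And>l. l \<in> {1..<r} \<Longrightarrow> (\<Sum>k\<in>{l..<r}. dw S (k - l) (c k)) = 0"
  shows "x \<in> Br S r p"
  unfolding Br_def mem_Collect_eq
  by (intro conjI exI[of _ c] ballI assms(1) assms(2) assms(3) assms(4)[symmetric])

lemma BrE:
  assumes "x \<in> Br S r p"
  obtains c where "x \<in> Forms_wt S p" "\<And>k. k \<in> {0..<r} \<Longrightarrow> c k \<in> Forms_wt S (p - int k)"
    "x = (\<Sum>k\<in>{0..<r}. dw S k (c k))" "\<And>l. l \<in> {1..<r} \<Longrightarrow> (\<Sum>k\<in>{l..<r}. dw S (k - l) (c k)) = 0"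
proof -
  obtain c where "x \<in> Forms_wt S p" "\<forall>k\<in>{0..<r}. c k \<in> Forms_wt S (p - int k)"
    "x = (\<Sum>k\<in>{0..<r}. dw S k (c k))" "\<forall>l\<in>{1..<r}. 0 = (\<Sum>k\<in>{l..<r}. dw S (k - l) (c k))"
    using assms unfolding Br_def mem_Collect_eq by (elim conjE exE)
  then show thesis by (intro that[of c]) (auto simp only:)
qed

lemma Br_0: "0 \<in> Br S r p"
proof (rule BrI[of _ _ _ "\<lambda>k. 0"])
  show "(0 :: 'g form) = (\<Sum>k\<in>{0..<r}. dw S k 0)" by (simp only: lin_op_0[OF dw_lin] sum.neutral_const)
  show "(\<Sum>k\<in>{l..<r}. dw S (k - l) 0) = 0" for l by (simp only: lin_op_0[OF dw_lin] sum.neutral_const)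
qed (rule Forms_wt_0)+

lemma Br_diff:
  assumes "x \<in> Br S r p" "y \<in> Br S r p" shows "x - y \<in> Br S r p"
proof -
  obtain a where a: "x \<in> Forms_wt S p" "\<And>k. k \<in> {0..<r} \<Longrightarrow> a k \<in> Forms_wt S (p - int k)"
    "x = (\<Sum>k\<in>{0..<r}. dw S k (a k))" "\<And>l. l \<in> {1..<r} \<Longrightarrow> (\<Sum>k\<in>{l..<r}. dw S (k - l) (a k)) = 0"
    using assms(1) by (rule BrE) blast
  obtain b where b: "y \<in> Forms_wt S p" "\<And>k. k \<in> {0..<r} \<Longrightarrow> b k \<in> Forms_wt S (p - int k)"
    "y = (\<Sum>k\<in>{0..<r}. dw S k (b k))" "\<And>l. l \<in> {1..<r} \<Longrightarrow> (\<Sum>k\<in>{l..<r}. dw S (k - l) (b k)) = 0"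
    using assms(2) by (rule BrE) blast
  have d: "dw S m (a k - b k) = dw S m (a k) - dw S m (b k)" if "k \<in> {0..<r}" for m k
    by (rule lin_op_diff[OF dw_lin Forms_wt_Forms[OF a(2)[OF that]] Forms_wt_Forms[OF b(2)[OF that]]])
  show ?thesis
  proof (rule BrI[of _ _ _ "\<lambda>k. a k - b k"])
    show "x - y \<in> Forms_wt S p" by (rule Forms_wt_diff[OF a(1) b(1)])
    show "a k - b k \<in> Forms_wt S (p - int k)" if "k \<in> {0..<r}" for k
      by (rule Forms_wt_diff[OF a(2)[OF that] b(2)[OF that]])
    have "(\<Sum>k\<in>{0..<r}. dw S k (a k - b k)) = (\<Sum>k\<in>{0..<r}. dw S k (a k) - dw S k (b k))"
      by (rule sum.cong[OF refl]) (rule d)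
    then show "x - y = (\<Sum>k\<in>{0..<r}. dw S k (a k - b k))"
      unfolding sum_subtractf a(3)[symmetric] b(3)[symmetric] by (rule sym)
    fix l assume l: "l \<in> {1..<r}"
    have "(\<Sum>k\<in>{l..<r}. dw S (k - l) (a k - b k)) = (\<Sum>k\<in>{l..<r}. dw S (k - l) (a k) - dw S (k - l) (b k))"
      by (rule sum.cong[OF refl]) (rule d, simp)
    then show "(\<Sum>k\<in>{l..<r}. dw S (k - l) (a k - b k)) = 0"
      unfolding sum_subtractf a(4)[OF l] b(4)[OF l] diff_self .
  qed
qed

lemma cls_eq_iff: "cls S r p x = cls S r p y \<longleftrightarrow> x - y \<in> Br S r p"
proof
  assume "cls S r p x = cls S r p y"
  moreover have "x \<in> cls S r p x"
    unfolding cls_def mem_Collect_eq by (rule exI[of _ 0]) (simp add: Br_0)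
  ultimately obtain b where "x = y + b" "b \<in> Br S r p" unfolding cls_def by auto
  then show "x - y \<in> Br S r p" by simp
next
  assume xy: "x - y \<in> Br S r p"
  have sub: "cls S r p x' \<subseteq> cls S r p y'" if "y' - x' \<in> Br S r p" for x' y'
  proof
    fix w assume "w \<in> cls S r p x'"
    then obtain b where b: "w = x' + b" "b \<in> Br S r p" unfolding cls_def by auto
    have "w = y' + (b - (y' - x'))" using b(1) by simp
    with Br_diff[OF b(2) that] show "w \<in> cls S r p y'" unfolding cls_def by blast
  qed
  have "y - x \<in> Br S r p" using Br_diff[OF Br_0 xy] by simp
  then show "cls S r p x = cls S r p y" by (intro equalityI sub xy)
qed

text \<open>
  Let \<open>W\<close> be the total lift \<open>u - \<Sum>\<^sub>j w\<^sub>j\<close> of \<open>u\<close>, whose differential starts in weight \<open>p + r\<close> with the form on the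
  left-hand side, and let \<open>c\<close> be the sum of the forms witnessing that \<open>u\<close> is in \<open>B\<^sub>r\<close>. Then
  \<open>d(W - dc) = dW\<close>, while \<open>W - dc\<close> has no components of weight at most \<open>p\<close>. Its components \<open>e j\<close> of weight
  \<open>p + j\<close> with \<open>1 \<le> j \<le> r\<close> witness the claim.
\<close>
lemma boundary_descends:
  assumes Z: "Z_lift S r p u w" and u: "u \<in> Br S r p" and r: "1 \<le> r"
  shows "dw S r u - (\<Sum>i\<in>{1..<r}. dw S i (w (r - i))) \<in> Br S r (p + int r)"
proof -
  obtain c where c: "\<And>k. k \<in> {0..<r} \<Longrightarrow> c k \<in> Forms_wt S (p - int k)"
    and uc: "u = (\<Sum>k\<in>{0..<r}. dw S k (c k))"
    and rel: "\<And>l. l \<in> {1..<r} \<Longrightarrow> (\<Sum>k\<in>{l..<r}. dw S (k - l) (c k)) = 0"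
    using u by (rule BrE) blast
  have cF: "c k \<in> Forms S" if "k \<in> {0..<r}" for k by (rule Forms_wt_Forms[OF c[OF that]])
  \<comment> \<open>There is no lift of weight \<open>p + r\<close>, but \<open>w r\<close> is arbitrary.\<close>
  define v where "v j = (if j < r then w j else 0)" for j
  have v: "v j \<in> Forms_wt S (p + int j)" if "1 \<le> j" for j
    using Z_liftD(2)[OF Z, of j] that Forms_wt_0 by (simp add: v_def)
  \<comment> \<open>the component of \<open>dc\<close> of weight \<open>p + j\<close>\<close>
  define D where "D j = (\<Sum>k\<in>{0..<r}. dw S (k + j) (c k))" for j
  have D: "D j \<in> Forms_wt S (p + int j)" for j
    unfolding D_def
  proof (rule Forms_wt_sum)
    fix k assume "k \<in> {0..<r}"
    from raises_wt[OF raises_dw c[OF this], of "k + j"]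
    show "dw S (k + j) (c k) \<in> Forms_wt S (p + int j)" by simp
  qed
  define e where "e j = - v j - D j" for j
  have e: "e j \<in> Forms_wt S (p + int j)" if "1 \<le> j" for j
    unfolding e_def by (rule Forms_wt_diff[OF Forms_wt_minus[OF v[OF that]] D])
  \<comment> \<open>This is \<open>d\<^sup>2c = 0\<close> in weight \<open>p + s\<close>, as \<open>dc\<close> is \<open>u\<close> plus terms of weight above \<open>p\<close>.\<close>
  have sum_D: "(\<Sum>i\<in>{0..<s}. dw S i (D (s - i))) = - dw S s u" for s
  proof -
    let ?T = "\<lambda>k. \<Sum>t\<in>{t\<in>{0..<r}. t \<le> k}. dw S (s + t) (dw S (k - t) (c k))"
    let ?R = "\<lambda>k. \<Sum>i\<in>{0..<s}. dw S i (dw S (k + (s - i)) (c k))"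
    have per_k: "?R k = - ?T k"
      if k: "k \<in> {0..<r}" for k
    proof -
      let ?A = "\<Sum>i\<in>{0..<s}. dw S i (dw S (k + s - i) (c k))"
      let ?B = "\<Sum>i\<in>{s..k + s}. dw S i (dw S (k + s - i) (c k))"
      have "?R k = ?A"
        by (rule sum.cong[OF refl]) simp
      moreover have "?T k = ?B"
        by (rule sum.reindex_bij_witness[of _ "\<lambda>i. i - s" "\<lambda>t. s + t"]) (use k in auto)
      moreover have "?A + ?B = 0"
      proof -
        have "{0..k + s} = {0..<s} \<union> {s..k + s}" by auto
        then have "(\<Sum>i=0..k + s. dw S i (dw S (k + s - i) (c k))) = (\<Sum>i\<in>{0..<s} \<union> {s..k + s}. dw S i (dw S (k + s - i) (c k)))"
          by (rule arg_cong)
        also have "\<dots> = ?A + ?B"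
          by (rule sum.union_disjoint) auto
        finally show ?thesis unfolding multicomplex[OF c[OF k]] by (rule sym)
      qed
      ultimately show ?thesis unfolding eq_neg_iff_add_eq_0 by (simp only:)
    qed
    have "(\<Sum>i\<in>{0..<s}. dw S i (D (s - i))) = (\<Sum>i\<in>{0..<s}. \<Sum>k\<in>{0..<r}. dw S i (dw S (k + (s - i)) (c k)))"
      unfolding D_def by (rule sum.cong[OF refl]) (rule lin_op_sum[OF dw_lin Forms_dw[OF cF]])
    also have "\<dots> = (\<Sum>k\<in>{0..<r}. \<Sum>i\<in>{0..<s}. dw S i (dw S (k + (s - i)) (c k)))" by (rule sum.swap)
    also have "\<dots> = (\<Sum>k\<in>{0..<r}. - ?T k)"
      by (rule sum.cong[OF refl]) (rule per_k)
    also have "\<dots> = - (\<Sum>k\<in>{0..<r}. \<Sum>t\<in>{t\<in>{0..<r}. t \<le> k}. dw S (s + t) (dw S (k - t) (c k)))"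
      by (rule sum_negf)
    also have "(\<Sum>k\<in>{0..<r}. \<Sum>t\<in>{t\<in>{0..<r}. t \<le> k}. dw S (s + t) (dw S (k - t) (c k)))
       = (\<Sum>t\<in>{0..<r}. \<Sum>k\<in>{k\<in>{0..<r}. t \<le> k}. dw S (s + t) (dw S (k - t) (c k)))"
      by (rule sum.swap_restrict) simp_all
    also have "\<dots> = (\<Sum>t\<in>{0..<r}. if t = 0 then dw S s u else 0)"
    proof (rule sum.cong[OF refl])
      fix t assume t: "t \<in> {0..<r}"
      have "{k\<in>{0..<r}. t \<le> k} = {t..<r}" by auto
      then have "(\<Sum>k\<in>{k\<in>{0..<r}. t \<le> k}. dw S (s + t) (dw S (k - t) (c k))) = (\<Sum>k\<in>{t..<r}. dw S (s + t) (dw S (k - t) (c k)))"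
        by (rule arg_cong)
      also have "\<dots> = dw S (s + t) (\<Sum>k\<in>{t..<r}. dw S (k - t) (c k))"
        by (rule lin_op_sum[OF dw_lin Forms_dw[OF cF], symmetric]) simp
      also have "\<dots> = (if t = 0 then dw S s u else 0)"
      proof (cases "t = 0")
        case True
        then show ?thesis by (simp only: uc add_0_right diff_zero if_True simp_thms)
      next
        case False
        with t have "t \<in> {1..<r}" by auto
        from rel[OF this] False show ?thesis by (simp only: lin_op_0[OF dw_lin] if_False simp_thms)
      qed
      finally show "(\<Sum>k\<in>{k\<in>{0..<r}. t \<le> k}. dw S (s + t) (dw S (k - t) (c k))) = (if t = 0 then dw S s u else 0)" .
    qed
    also have "\<dots> = dw S s u" using r by (simp add: sum.delta)
    finally show ?thesis .
  qed
  have sum_e: "(\<Sum>i\<in>{0..<s}. dw S i (e (s - i))) = dw S s u - (\<Sum>i\<in>{0..<s}. dw S i (v (s - i)))" for s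
  proof -
    have "(\<Sum>i\<in>{0..<s}. dw S i (e (s - i))) = (\<Sum>i\<in>{0..<s}. - dw S i (v (s - i)) - dw S i (D (s - i)))"
    proof (rule sum.cong[OF refl])
      fix i assume "i \<in> {0..<s}"
      then have "1 \<le> s - i" by auto
      note vF = Forms_wt_Forms[OF v[OF this]] and DF = Forms_wt_Forms[OF D[of "s - i"]]
      show "dw S i (e (s - i)) = - dw S i (v (s - i)) - dw S i (D (s - i))"
        unfolding e_def lin_op_diff[OF dw_lin Forms_minus[OF vF] DF] lin_op_minus[OF dw_lin vF] ..
    qed
    also have "\<dots> = - (\<Sum>i\<in>{0..<s}. dw S i (v (s - i))) - - dw S s u"
      unfolding sum_subtractf sum_negf sum_D ..
    finally show ?thesis by simp
  qed
  have v_sum: "(\<Sum>i\<in>{0..<s}. dw S i (v (s - i))) = dw S s u" if "s \<in> {1..<r}" for s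
  proof -
    have "(\<Sum>i\<in>{0..<s}. dw S i (v (s - i))) = (\<Sum>i=0..s-1. dw S i (w (s - i)))"
      by (rule sum.cong) (use that in \<open>auto simp: v_def\<close>)
    then show ?thesis using Z_liftD(4)[OF Z that] by (simp only:)
  qed
  have v_top: "(\<Sum>i\<in>{0..<r}. dw S i (v (r - i))) = (\<Sum>i\<in>{1..<r}. dw S i (w (r - i)))"
  proof (rule sum.mono_neutral_cong_right)
    show "\<forall>i\<in>{0..<r} - {1..<r}. dw S i (v (r - i)) = 0"
      by (auto simp: v_def lin_op_0[OF dw_lin])
    show "dw S i (v (r - i)) = dw S i (w (r - i))" if "i \<in> {1..<r}" for i
      using that by (simp add: v_def)
  qed auto
  show ?thesis
  proof (rule BrI[of _ _ _ "\<lambda>k. e (r - k)"])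
    show ek: "e (r - k) \<in> Forms_wt S (p + int r - int k)" if "k \<in> {0..<r}" for k
    proof -
      have "1 \<le> r - k" "p + int (r - k) = p + int r - int k" using that by auto
      then show ?thesis using e[of "r - k"] by (simp only:)
    qed
    show eq: "dw S r u - (\<Sum>i\<in>{1..<r}. dw S i (w (r - i))) = (\<Sum>k\<in>{0..<r}. dw S k (e (r - k)))"
      unfolding sum_e v_top ..
    show "dw S r u - (\<Sum>i\<in>{1..<r}. dw S i (w (r - i))) \<in> Forms_wt S (p + int r)"
      unfolding eq
    proof (rule Forms_wt_sum)
      fix k assume "k \<in> {0..<r}"
      from raises_wt[OF raises_dw ek[OF this], of k]
      show "dw S k (e (r - k)) \<in> Forms_wt S (p + int r)" by simp
    qed
    fix l assume l: "l \<in> {1..<r}"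
    have "(\<Sum>k\<in>{l..<r}. dw S (k - l) (e (r - k))) = (\<Sum>i\<in>{0..<r - l}. dw S i (e (r - l - i)))"
      by (rule sum.reindex_bij_witness[of _ "\<lambda>i. i + l" "\<lambda>k. k - l"]) (use l in auto)
    also have "\<dots> = 0"
      unfolding sum_e by (subst v_sum) (use l in auto)
    finally show "(\<Sum>k\<in>{l..<r}. dw S (k - l) (e (r - k))) = 0" .
  qed
qed

lemma Z_lift_diff:
  assumes "Z_lift S r p x z" "Z_lift S r p x' z'"
  shows "Z_lift S r p (x - x') (\<lambda>j. z j - z' j)"
  unfolding Z_lift_def
proof (intro conjI ballI)
  note a = Z_liftD[OF assms(1)] and b = Z_liftD[OF assms(2)]
  note xF = Forms_wt_Forms[OF a(1)] and xF' = Forms_wt_Forms[OF b(1)]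
  show "x - x' \<in> Forms_wt S p" by (rule Forms_wt_diff[OF a(1) b(1)])
  show "z j - z' j \<in> Forms_wt S (p + int j)" if "j \<in> {1..<r}" for j
    by (rule Forms_wt_diff[OF a(2)[OF that] b(2)[OF that]])
  show "dw S 0 (x - x') = 0" unfolding lin_op_diff[OF dw_lin xF xF'] a(3) b(3) by (rule diff_self)
  fix n assume n: "n \<in> {1..<r}"
  have "(\<Sum>i=0..n-1. dw S i (z (n - i) - z' (n - i))) = (\<Sum>i=0..n-1. dw S i (z (n - i)) - dw S i (z' (n - i)))"
  proof (rule sum.cong[OF refl])
    fix i assume "i \<in> {0..n-1}"
    then have "n - i \<in> {1..<r}" using n by auto
    from lin_op_diff[OF dw_lin Forms_wt_Forms[OF a(2)[OF this]] Forms_wt_Forms[OF b(2)[OF this]]]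
    show "dw S i (z (n - i) - z' (n - i)) = dw S i (z (n - i)) - dw S i (z' (n - i))" .
  qed
  then show "dw S n (x - x') = (\<Sum>i=0..n-1. dw S i (z (n - i) - z' (n - i)))"
    unfolding lin_op_diff[OF dw_lin xF xF'] a(4)[OF n] b(4)[OF n] sum_subtractf by (rule sym)
qed

text \<open>
  The definite description in \<open>partial\<close> is justified: two representatives with their lifts differ by a
  lift of an element of \<open>B\<^sub>r\<close>.
\<close>
lemma partial_cls:
  assumes "1 \<le> r" and Z: "Z_lift S r p x z"
  shows "partial S r p (cls S r p x) = cls S r (p + int r) (dw S r x - (\<Sum>i\<in>{1..<r}. dw S i (z (r - i))))"
  unfolding partial_def
proof (rule the_equality)
  show "\<exists>x' z'. Z_lift S r p x' z' \<and> cls S r p x = cls S r p x' \<and>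
     cls S r (p + int r) (dw S r x - (\<Sum>i\<in>{1..<r}. dw S i (z (r - i)))) =
     cls S r (p + int r) (dw S r x' - (\<Sum>i\<in>{1..<r}. dw S i (z' (r - i))))"
    by (rule exI[of _ x], rule exI[of _ z]) (intro conjI Z refl)
next
  fix D assume "\<exists>x' z'. Z_lift S r p x' z' \<and> cls S r p x = cls S r p x' \<and>
     D = cls S r (p + int r) (dw S r x' - (\<Sum>i\<in>{1..<r}. dw S i (z' (r - i))))"
  then obtain x' z' where Z': "Z_lift S r p x' z'" and eq: "cls S r p x = cls S r p x'"
    and D: "D = cls S r (p + int r) (dw S r x' - (\<Sum>i\<in>{1..<r}. dw S i (z' (r - i))))"
    by (elim exE conjE)
  have "x' - x \<in> Br S r p" using eq[symmetric] unfolding cls_eq_iff .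
  from boundary_descends[OF Z_lift_diff[OF Z' Z] this assms(1)]
  have "dw S r (x' - x) - (\<Sum>i\<in>{1..<r}. dw S i (z' (r - i) - z (r - i))) \<in> Br S r (p + int r)" .
  moreover have "(\<Sum>i\<in>{1..<r}. dw S i (z' (r - i) - z (r - i)))
      = (\<Sum>i\<in>{1..<r}. dw S i (z' (r - i)) - dw S i (z (r - i)))"
  proof (rule sum.cong[OF refl])
    fix i assume "i \<in> {1..<r}"
    then have "r - i \<in> {1..<r}" by auto
    from lin_op_diff[OF dw_lin Forms_wt_Forms[OF Z_liftD(2)[OF Z' this]] Forms_wt_Forms[OF Z_liftD(2)[OF Z this]]]
    show "dw S i (z' (r - i) - z (r - i)) = dw S i (z' (r - i)) - dw S i (z (r - i))" .
  qed
  moreover have "dw S r (x' - x) = dw S r x' - dw S r x"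
    by (rule lin_op_diff[OF dw_lin Forms_wt_Forms[OF Z_liftD(1)[OF Z']] Forms_wt_Forms[OF Z_liftD(1)[OF Z]]])
  ultimately have "(dw S r x' - dw S r x) - ((\<Sum>i\<in>{1..<r}. dw S i (z' (r - i))) - (\<Sum>i\<in>{1..<r}. dw S i (z (r - i)))) \<in> Br S r (p + int r)"
    by (simp only: sum_subtractf)
  then show "D = cls S r (p + int r) (dw S r x - (\<Sum>i\<in>{1..<r}. dw S i (z (r - i))))"
    unfolding D cls_eq_iff by (simp only: diff_diff_add diff_diff_eq2 add_diff_eq diff_add_eq add.commute add.left_commute)
qed

lemma partial_explicit:
  assumes "1 \<le> r" "Z_lift S r p x z" "\<And>j. j \<in> {1..<r} \<Longrightarrow> z j \<in> Ker_d0_perp S"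
  shows "partial S r p (cls S r p x) = cls S r (p + int r) (partial_op S r x)"
proof -
  have "(\<Sum>i\<in>{1..<r}. dw S i (z (r - i))) = (\<Sum>i=1..r-1. dw S i (lift_op (r - i) x))"
  proof (rule sum.cong)
    show "{1..<r} = {1..r-1}" using assms(1) by auto
    fix i assume "i \<in> {1..r-1}"
    then have "r - i \<in> {1..<r}" by auto
    from lift_unique[OF assms(2,3) this] show "dw S i (z (r - i)) = dw S i (lift_op (r - i) x)"
      by (simp only:)
  qed
  then show ?thesis unfolding partial_cls[OF assms(1,2)] partial_op_lift by (simp only:)
qed

lemma raises_partial_op: "raises r (partial_op S r)"
proof -
  have "raises r (\<lambda>\<alpha>. dw S r \<alpha> - (\<Sum>i\<in>{1..r-1}. dw S i (lift_op (r - i) \<alpha>)))"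
  proof (rule raises_diff[OF raises_dw], rule raises_sum)
    fix i assume "i \<in> {1..r-1}"
    then have "r - i + i = r" by auto
    with raises_comp[OF raises_dw[of i] raises_lift[of "r - i"]]
    show "raises r (\<lambda>\<alpha>. dw S i (lift_op (r - i) \<alpha>))" by (simp only:)
  qed
  then show ?thesis unfolding partial_op_lift[abs_def] .
qed

lemma partial_op_vanish: "r > Q \<Longrightarrow> \<alpha> \<in> Forms S \<Longrightarrow> partial_op S r \<alpha> = 0"
  by (rule raises_vanish[OF raises_partial_op])

text \<open>
  Since \<open>d\<^sub>0\<close> preserves the weight and raises the degree by one, orthogonality of a form of weight \<open>p\<close> and
  degree \<open>h\<close> to all of the image of \<open>d\<^sub>0\<close> only needs to be tested on \<open>d\<^sub>0\<beta>'\<close>, where \<open>\<beta>'\<close> is the part of weight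
  \<open>p\<close> and degree \<open>h - 1\<close>.
\<close>
lemma E0_first_page:
  "E0_deg S h \<inter> Forms_wt S p = {x \<in> Zr S 1 p \<inter> Forms_deg S h. \<forall>b\<in>Br S 1 p \<inter> Forms_deg S h. fip S x b = 0}"
proof (intro equalityI subsetI)
  fix x assume x: "x \<in> E0_deg S h \<inter> Forms_wt S p"
  then have "x \<in> Zr S 1 p \<inter> Forms_deg S h"
    by (auto simp: E0_deg_def Zr_def Z_lift_def)
  moreover have "fip S x b = 0" if b: "b \<in> Br S 1 p \<inter> Forms_deg S h" for b
  proof -
    obtain c where "c 0 \<in> Forms_wt S p" "b = dw S 0 (c 0)"
      using b by (auto simp: Br_def)
    then show ?thesis using x Forms_wt_Forms by (auto simp: E0_deg_def)
  qed
  ultimately show "x \<in> {x \<in> Zr S 1 p \<inter> Forms_deg S h. \<forall>b\<in>Br S 1 p \<inter> Forms_deg S h. fip S x b = 0}"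
    by blast
next
  fix x assume x: "x \<in> {x \<in> Zr S 1 p \<inter> Forms_deg S h. \<forall>b\<in>Br S 1 p \<inter> Forms_deg S h. fip S x b = 0}"
  then have xp: "x \<in> Forms_wt S p" and dx: "dw S 0 x = 0" and xh: "x \<in> Forms_deg S h"
    and orth: "\<And>b. b \<in> Br S 1 p \<Longrightarrow> b \<in> Forms_deg S h \<Longrightarrow> fip S x b = 0"
    by (auto simp: Zr_def Z_lift_def)
  have "fip S x (dw S 0 \<beta>) = 0" if \<beta>: "\<beta> \<in> Forms S" for \<beta>
  proof -
    define \<beta>' where "\<beta>' = (\<lambda>J. if int (wtset S J) = p \<and> Suc (card J) = h then \<beta> J else 0)"
    have \<beta>'FS: "\<beta>' \<in> FS {J. int (wtset S J) = p \<and> Suc (card J) = h}"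
      using \<beta> Cinf_0 by (auto simp: FS_iff \<beta>'_def Forms_def)
    have F': "\<beta>' \<in> Forms S" by (rule FS_Forms[OF \<beta>'FS])
    have wp: "\<beta>' \<in> Forms_wt S p" unfolding Forms_wt_FS by (rule FS_mono[OF \<beta>'FS]) auto
    have deg: "d0op \<beta>' \<in> Forms_deg S h"
    proof (cases h)
      case 0
      then have "\<beta>' = 0" by (simp add: \<beta>'_def fun_eq_iff)
      then show ?thesis using d0op_scl[of 0 0] FS_0 by (simp add: Forms_deg_FS)
    next
      case (Suc h')
      have "\<beta>' \<in> Forms_deg S h'" unfolding Forms_deg_FS by (rule FS_mono[OF \<beta>'FS]) (auto simp: Suc)
      then show ?thesis using d0op_deg Suc by simp
    qed
    have "d0op \<beta>' \<in> Br S 1 p"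
    proof (rule BrI[of _ _ _ "\<lambda>k. \<beta>'"])
      show "d0op \<beta>' \<in> Forms_wt S p" by (rule d0op_wt[OF wp])
      show "\<beta>' \<in> Forms_wt S (p - int k)" if "k \<in> {0..<1}" for k using that wp by simp
      show "d0op \<beta>' = (\<Sum>k\<in>{0..<1}. dw S k \<beta>')" by (simp add: dw_0[OF F'])
    qed simp
    then have o: "fip S x (d0op \<beta>') = 0" by (rule orth[OF _ deg])
    have "fip S x (d0op \<beta>) y = fip S x (d0op \<beta>') y" for y
      unfolding fip_apply
    proof (rule sum.cong[OF refl])
      fix K
      show "x K y * d0op \<beta> K y = x K y * d0op \<beta>' K y"
      proof (cases "x K y = 0")
        case False
        then have K: "int (wtset S K) = p" "card K = h"
          using FS_D[of x "{J. int (wtset S J) = p}" K y] FS_D[of x "{J. card J = h}" K y] xp xh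
          unfolding Forms_wt_FS Forms_deg_FS by auto
        have "(\<Sum>J\<in>Pow N. dmat K J * \<beta> J y) = (\<Sum>J\<in>Pow N. dmat K J * \<beta>' J y)"
        proof (rule sum.cong[OF refl])
          fix J assume "J \<in> Pow N"
          then show "dmat K J * \<beta> J y = dmat K J * \<beta>' J y"
            using dmat_support[of J K] K by (cases "dmat K J = 0") (auto simp: \<beta>'_def)
        qed
        then show ?thesis by (simp only: d0op_matrix[OF \<beta>] d0op_matrix[OF F'])
      qed simp
    qed
    then show ?thesis using o unfolding dw_0[OF \<beta>] by (simp add: fun_eq_iff)
  qed
  then show "x \<in> E0_deg S h \<inter> Forms_wt S p" using xp dx xh by (simp add: E0_deg_def)
qed


section \<open>The Rumin complex\<close>

lemma Pi_E0_eq: "\<alpha> \<in> Forms S \<Longrightarrow> Pi_E0 S \<alpha> = \<alpha> - d0op (d0inv S \<alpha>) - d0inv S (d0op \<alpha>)"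
  unfolding Pi_E0_def by (simp only: dw_0 Forms_d0inv)

lemma Forms_Pi_E0: "\<alpha> \<in> Forms S \<Longrightarrow> Pi_E0 S \<alpha> \<in> Forms S"
  unfolding Pi_E0_eq by (intro Forms_diff Forms_d0op Forms_d0inv)

lemma Pi_E0_add:
  assumes "\<alpha> \<in> Forms S" "\<beta> \<in> Forms S" shows "Pi_E0 S (\<alpha> + \<beta>) = Pi_E0 S \<alpha> + Pi_E0 S \<beta>"
  unfolding Pi_E0_eq[OF assms(1)] Pi_E0_eq[OF assms(2)] Pi_E0_eq[OF Forms_add[OF assms]]
    lin_op_add[OF d0inv_lin assms] d0op_add lin_op_add[OF d0inv_lin Forms_d0op[OF assms(1)] Forms_d0op[OF assms(2)]]
  by (simp only: add_diff_add)

lemma Pi_E0_d0op: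
  assumes "\<alpha> \<in> Forms S" shows "Pi_E0 S (d0op \<alpha>) = 0"
  unfolding Pi_E0_eq[OF Forms_d0op[OF assms]] d0op_d0inv_d0op[OF assms] d0op_d0op lin_op_0[OF d0inv_lin]
  by (simp only: diff_self)

lemma d0op_Pi_E0:
  assumes "\<alpha> \<in> Forms S" shows "d0op (Pi_E0 S \<alpha>) = 0"
  unfolding Pi_E0_eq[OF assms] d0op_diff d0op_d0op d0op_d0inv_d0op[OF assms] by (simp only: diff_zero diff_self)

text \<open>
  With \<open>d\<^sub>0x = 0\<close>, this is what reduces \<open>\<Pi>\<^sub>E x\<close> to \<open>x - PTx\<close> for \<open>x\<close> in \<open>E\<^sub>0\<close>.
\<close>
lemma d0inv_Pi_E0:
  assumes "\<alpha> \<in> Forms S" shows "d0inv S (Pi_E0 S \<alpha>) = 0"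
proof -
  note F = Forms_d0op[OF Forms_d0inv[OF assms]]
  show ?thesis
    unfolding Pi_E0_eq[OF assms]
      lin_op_diff[OF d0inv_lin Forms_diff[OF assms F] Forms_d0inv[OF Forms_d0op[OF assms]]]
      lin_op_diff[OF d0inv_lin assms F] d0inv_d0op_id[OF d0inv_Ker_perp[OF assms]]
      d0inv_d0inv[OF Forms_d0op[OF assms]]
    by (simp only: diff_zero diff_self)
qed

lemma Pi_E0_deg:
  assumes "\<alpha> \<in> Forms_deg S h" shows "Pi_E0 S \<alpha> \<in> Forms_deg S h"
proof -
  have "d0op (d0inv S \<alpha>) \<in> Forms_deg S h"
  proof (cases h)
    case 0
    then have "d0op (d0inv S \<alpha>) = 0" using d0inv_deg0 assms d0op_scl[of 0 0] by simp
    then show ?thesis using FS_0 by (simp add: Forms_deg_FS)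
  next
    case (Suc h')
    then show ?thesis using d0op_deg d0inv_deg assms by simp
  qed
  moreover have "d0inv S (d0op \<alpha>) \<in> Forms_deg S h" by (rule d0inv_deg[OF d0op_deg[OF assms]])
  ultimately show ?thesis
    unfolding Pi_E0_eq[OF Forms_deg_Forms[OF assms]] by (intro Forms_deg_diff assms)
qed

lemma Pi_E0_E0:
  assumes "\<alpha> \<in> Forms_deg S h" shows "Pi_E0 S \<alpha> \<in> E0_deg S h"
proof -
  note F = Forms_deg_Forms[OF assms]
  have "fip S (Pi_E0 S \<alpha>) (dw S 0 \<beta>) = 0" if b: "\<beta> \<in> Forms S" for \<beta>
  proof
    fix x
    have "fip S (Pi_E0 S \<alpha>) (d0op \<beta>) x
        = - fip S (d0op (d0inv S \<alpha>) - \<alpha>) (d0op \<beta>) x - fip S (d0inv S (d0op \<alpha>)) (d0op \<beta>) x"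
      unfolding Pi_E0_eq[OF F] fip_diff_left by simp
    then show "fip S (Pi_E0 S \<alpha>) (dw S 0 \<beta>) x = 0 x"
      unfolding dw_0[OF b] d0inv_normal[OF F b] d0inv_perp[OF Forms_d0op[OF b] d0op_d0op] by simp
  qed
  then show ?thesis
    unfolding E0_deg_def mem_Collect_eq dw_0[OF Forms_Pi_E0[OF F]] d0op_Pi_E0[OF F]
    by (intro conjI ballI Pi_E0_deg assms refl)
qed

lemma T_op_sum:
  assumes "\<alpha> \<in> Forms S" shows "T_op S \<alpha> = (\<Sum>m=1..Q. step_op m \<alpha>)"
  unfolding T_op_def ext_d_minus_dw0[OF assms] step_op_def
  by (rule lin_op_sum[OF d0inv_lin Forms_dw[OF assms]])

lemma T_op_lin: "lin_op (T_op S)"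
  unfolding lin_op_def
proof (intro conjI allI ballI)
  fix \<alpha> \<beta> c assume a: "\<alpha> \<in> Forms S"
  show "T_op S \<alpha> \<in> Forms S" unfolding T_op_sum[OF a] by (rule Forms_sum[OF Forms_step[OF a]])
  show "T_op S (scl c \<alpha>) = scl c (T_op S \<alpha>)"
    unfolding T_op_sum[OF a] T_op_sum[OF Forms_scl[OF a]] vf.scale_sum_right
    by (rule sum.cong[OF refl]) (rule lin_op_scl[OF step_lin a])
  assume b: "\<beta> \<in> Forms S"
  show "T_op S (\<alpha> + \<beta>) = T_op S \<alpha> + T_op S \<beta>"
    unfolding T_op_sum[OF a] T_op_sum[OF b] T_op_sum[OF Forms_add[OF a b]] sum.distrib[symmetric]
    by (rule sum.cong[OF refl]) (rule lin_op_add[OF step_lin a b])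
qed

lemma T_op_deg: "\<alpha> \<in> Forms_deg S h \<Longrightarrow> T_op S \<alpha> \<in> Forms_deg S h"
  unfolding T_op_sum[OF Forms_deg_Forms] by (intro Forms_deg_sum step_deg)

lemma Forms_T_pow: "\<alpha> \<in> Forms S \<Longrightarrow> (T_op S ^^ k) \<alpha> \<in> Forms S"
  by (induction k) (simp_all add: lin_op_Forms[OF T_op_lin])

lemma T_pow_deg: "\<alpha> \<in> Forms_deg S h \<Longrightarrow> (T_op S ^^ k) \<alpha> \<in> Forms_deg S h"
  by (induction k) (simp_all add: T_op_deg)

text \<open>
  \<open>T\<close> has no part of weight \<open>0\<close>, so it maps each step of the weight filtration to the next.
\<close>
lemma T_op_filtration:
  assumes "\<alpha> \<in> FS {J. q \<le> wtset S J}" shows "T_op S \<alpha> \<in> FS {J. Suc q \<le> wtset S J}"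
proof -
  note F = FS_Forms[OF assms]
  have "T_op S (\<Sum>a=0..Q. wpart S a \<alpha>) = (\<Sum>a=0..Q. T_op S (wpart S a \<alpha>))"
    by (rule lin_op_sum[OF T_op_lin Forms_wt_Forms[OF wpart_wt[OF F]]])
  then have eq: "T_op S \<alpha> = (\<Sum>a=0..Q. T_op S (wpart S a \<alpha>))" unfolding wpart_total[OF F] .
  show ?thesis
    unfolding eq
  proof (rule FS_sum)
    fix a
    note P = wpart_wt[OF F, of a]
    show "T_op S (wpart S a \<alpha>) \<in> FS {J. Suc q \<le> wtset S J}"
    proof (cases "q \<le> a")
      case True
      have "step_op m (wpart S a \<alpha>) \<in> FS {J. Suc q \<le> wtset S J}" if "m \<in> {1..Q}" for m
        by (rule FS_mono[OF raises_wt[OF raises_step P, unfolded Forms_wt_FS]]) (use True that in auto)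
      then show ?thesis unfolding T_op_sum[OF Forms_wt_Forms[OF P]] by (rule FS_sum)
    next
      case False
      have "wpart S a \<alpha> = 0"
      proof (intro ext)
        fix J x show "wpart S a \<alpha> J x = 0 J x"
          using FS_D[OF assms, of J x] False by (cases "\<alpha> J x = 0") (auto simp: wpart_def)
      qed
      then show ?thesis by (simp only: lin_op_0[OF T_op_lin] FS_0)
    qed
  qed
qed

lemma T_nilpotent_homdim: "T_nilpotent S (Suc Q)"
  unfolding T_nilpotent_def
proof
  fix \<alpha> assume a: "\<alpha> \<in> Forms S"
  have "(T_op S ^^ k) \<alpha> \<in> FS {J. k \<le> wtset S J}" for k
  proof (induction k)
    case 0
    show ?case using a by (simp add: FS_UNIV)
  next
    case (Suc k)
    from T_op_filtration[OF this] show ?case by simp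
  qed
  from this[of "Suc Q"] show "(T_op S ^^ Suc Q) \<alpha> = 0"
  proof -
    assume *: "(T_op S ^^ Suc Q) \<alpha> \<in> FS {J. Suc Q \<le> wtset S J}"
    show ?thesis
    proof (intro ext, rule ccontr)
      fix J x assume "(T_op S ^^ Suc Q) \<alpha> J x \<noteq> 0 J x"
      then have "(T_op S ^^ Suc Q) \<alpha> J x \<noteq> 0" by (simp only: zero_fun_apply simp_thms)
      from FS_D[OF * this] wtset_le[of J] show False by simp
    qed
  qed
qed

text \<open>
  The terms of the square \<open>{1..Q}\<^sup>2\<close> with \<open>i + n > Q\<close> raise the weight beyond \<open>Q\<close> and vanish; the remaining
  triangle is summed along \<open>r = i + n\<close>.
\<close>
lemma sum_lift_triangle:
  assumes "\<And>i. raises i (F i)" "\<alpha> \<in> Forms S"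
  shows "(\<Sum>i=1..Q. \<Sum>n=1..Q. F i (lift_op n \<alpha>)) = (\<Sum>r=1..Q. \<Sum>i=1..r-1. F i (lift_op (r - i) \<alpha>))"
proof -
  have "(\<Sum>i=1..Q. \<Sum>n=1..Q. F i (lift_op n \<alpha>)) = (\<Sum>(i, n)\<in>{1..Q} \<times> {1..Q}. F i (lift_op n \<alpha>))"
    by (rule sum.cartesian_product)
  also have "\<dots> = (\<Sum>(i, n)\<in>{(i, n). i \<in> {1..Q} \<and> n \<in> {1..Q} \<and> i + n \<le> Q}. F i (lift_op n \<alpha>))"
  proof (rule sum.mono_neutral_right)
    show "\<forall>x\<in>{1..Q} \<times> {1..Q} - {(i, n). i \<in> {1..Q} \<and> n \<in> {1..Q} \<and> i + n \<le> Q}. (case x of (i, n) \<Rightarrow> F i (lift_op n \<alpha>)) = 0"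
    proof
      fix x assume x: "x \<in> {1..Q} \<times> {1..Q} - {(i, n). i \<in> {1..Q} \<and> n \<in> {1..Q} \<and> i + n \<le> Q}"
      obtain i n where "x = (i, n)" by (cases x)
      have "Q < n + i" using x \<open>x = (i, n)\<close> by auto
      from raises_vanish[OF raises_comp[OF assms(1) raises_lift] this assms(2)]
      show "(case x of (i, n) \<Rightarrow> F i (lift_op n \<alpha>)) = 0" by (simp only: \<open>x = (i, n)\<close> prod.case)
    qed
  qed auto
  also have "\<dots> = (\<Sum>(r, i)\<in>(SIGMA r:{1..Q}. {1..r-1}). F i (lift_op (r - i) \<alpha>))"
    by (rule sum.reindex_bij_witness[of _ "\<lambda>(r, i). (i, r - i)" "\<lambda>(i, n). (i + n, i)"]) auto
  also have "\<dots> = (\<Sum>r=1..Q. \<Sum>i=1..r-1. F i (lift_op (r - i) \<alpha>))"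
    by (rule sum.Sigma[symmetric]) auto
  finally show ?thesis .
qed

definition lift_total :: "'g form \<Rightarrow> 'g form" where
  "lift_total \<alpha> = (\<Sum>n=1..Q. lift_op n \<alpha>)"

lemma Forms_lift_total: "\<alpha> \<in> Forms S \<Longrightarrow> lift_total \<alpha> \<in> Forms S"
  unfolding lift_total_def by (rule Forms_sum[OF Forms_lift])

lemma sum_lift_total:
  assumes "\<And>i. raises i (F i)" "\<alpha> \<in> Forms S"
  shows "(\<Sum>i=1..Q. F i (lift_total \<alpha>)) = (\<Sum>r=1..Q. \<Sum>i=1..r-1. F i (lift_op (r - i) \<alpha>))"
  unfolding sum_lift_triangle[OF assms, symmetric] lift_total_def
  by (rule sum.cong[OF refl]) (rule lin_op_sum[OF raises_lin[OF assms(1)] Forms_lift[OF assms(2)]])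

text \<open>
  The sum of the recursions of the lifts over all \<open>n\<close>.
\<close>
lemma lift_total_equation:
  assumes "\<alpha> \<in> Forms S" shows "lift_total \<alpha> = T_op S \<alpha> - T_op S (lift_total \<alpha>)"
proof -
  have "lift_total \<alpha> = (\<Sum>r=1..Q. step_op r \<alpha> - (\<Sum>i=1..r-1. step_op i (lift_op (r - i) \<alpha>)))"
    unfolding lift_total_def by (rule sum.cong[OF refl]) (rule lift_op_recursion[OF assms], simp)
  then show ?thesis
    unfolding T_op_sum[OF assms] T_op_sum[OF Forms_lift_total[OF assms]]
      sum_lift_total[OF raises_step assms] sum_subtractf .
qed

text \<open>
  Telescoping of \<open>\<Sum>\<^sub>k (-1)\<^sup>kT\<^sup>k\<close> against \<open>1 + T\<close>; the last term vanishes by nilpotency.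
\<close>
lemma P_op_T_equation:
  assumes nil: "T_nilpotent S M" and "\<alpha> \<in> Forms S"
  shows "P_op S M (T_op S \<alpha>) = T_op S \<alpha> - T_op S (P_op S M (T_op S \<alpha>))"
proof -
  let ?y = "T_op S \<alpha>"
  let ?V = "\<lambda>K. \<Sum>k=0..K. scl ((-1) ^ k) ((T_op S ^^ k) ?y)"
  have y: "?y \<in> Forms S" by (rule lin_op_Forms[OF T_op_lin assms(2)])
  have TV: "T_op S (?V K) = (\<Sum>k=0..K. scl ((-1) ^ k) ((T_op S ^^ Suc k) ?y))" for K
    unfolding lin_op_sum[OF T_op_lin Forms_scl[OF Forms_T_pow[OF y]]]
    by (rule sum.cong[OF refl]) (simp only: lin_op_scl[OF T_op_lin Forms_T_pow[OF y]] funpow.simps o_apply)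
  have "?V K + T_op S (?V K) = ?y + scl ((-1) ^ K) ((T_op S ^^ Suc K) ?y)" for K
  proof (induction K)
    case 0
    show ?case unfolding TV by simp
  next
    case (Suc K)
    let ?t = "(T_op S ^^ Suc K) ?y"
    have "?V (Suc K) + T_op S (?V (Suc K))
       = (?V K + T_op S (?V K)) + (scl ((-1) ^ Suc K) ?t + scl ((-1) ^ Suc K) ((T_op S ^^ Suc (Suc K)) ?y))"
      unfolding TV by (simp only: sum.atLeast0_atMost_Suc add_ac)
    also have "\<dots> = ?y + scl ((-1) ^ Suc K) ((T_op S ^^ Suc (Suc K)) ?y)"
      unfolding Suc.IH by (simp add: scl_def fun_eq_iff)
    finally show ?case .
  qed
  from this[of M] have "?V M + T_op S (?V M) = ?y + scl ((-1) ^ M) ((T_op S ^^ Suc M) ?y)" .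
  moreover have "(T_op S ^^ Suc M) ?y = 0"
    using nil y lin_op_0[OF T_op_lin] by (simp add: T_nilpotent_def)
  ultimately have "?V M + T_op S (?V M) = ?y" by (simp only: vf.scale_zero_right add_0_right)
  then show ?thesis unfolding P_op_def eq_diff_eq .
qed

text \<open>
  The difference \<open>e\<close> of two solutions satisfies \<open>Te = -e\<close>, hence \<open>T\<^sup>ke = (-1)\<^sup>ke\<close>, which is \<open>0\<close> for large \<open>k\<close>.
\<close>
lemma T_equation_unique:
  assumes nil: "T_nilpotent S M" and F: "\<beta> \<in> Forms S" "v \<in> Forms S" "w \<in> Forms S"
    and v: "v = \<beta> - T_op S v" and w: "w = \<beta> - T_op S w"
  shows "v = w"
proof -
  define e where "e = v - w"
  have eF: "e \<in> Forms S" unfolding e_def by (rule Forms_diff[OF F(2,3)])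
  have "T_op S v = \<beta> - v" "T_op S w = \<beta> - w" using v w by (metis add_diff_cancel_left' diff_eq_eq add.commute)+
  then have Te: "T_op S e = - e"
    unfolding e_def lin_op_diff[OF T_op_lin F(2,3)] by simp
  have "(T_op S ^^ k) e = scl ((-1) ^ k) e" for k
  proof (induction k)
    case (Suc k)
    have "(T_op S ^^ Suc k) e = T_op S (scl ((-1) ^ k) e)" by (simp only: funpow.simps o_apply Suc)
    also have "\<dots> = scl ((-1) ^ k) (- e)" unfolding lin_op_scl[OF T_op_lin eF] Te ..
    finally show ?case by (simp add: scl_def fun_eq_iff)
  qed simp
  moreover have "(T_op S ^^ M) e = 0" using nil eF by (simp add: T_nilpotent_def)
  ultimately have "scl ((-1) ^ M) e = 0" by simp
  then have "e = 0" by (simp add: scl_def fun_eq_iff)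
  then show ?thesis unfolding e_def by simp
qed

lemma Forms_P_op: "\<alpha> \<in> Forms S \<Longrightarrow> P_op S M \<alpha> \<in> Forms S"
  unfolding P_op_def by (intro Forms_sum Forms_scl Forms_T_pow)

lemma P_op_0: "P_op S M 0 = 0"
proof -
  have "(T_op S ^^ k) 0 = 0" for k by (induction k) (simp_all only: funpow.simps o_apply id_apply lin_op_0[OF T_op_lin])
  then show ?thesis unfolding P_op_def by (simp only: vf.scale_zero_right sum.neutral_const)
qed

lemma Pi_E_lift_total:
  assumes "T_nilpotent S M" "x \<in> Forms S" "d0op x = 0" "d0inv S x = 0"
  shows "Pi_E S M x = x - lift_total x" "P_op S M (T_op S x) = lift_total x"
proof -
  have Tx: "T_op S x \<in> Forms S" by (rule lin_op_Forms[OF T_op_lin assms(2)])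
  show P: "P_op S M (T_op S x) = lift_total x"
    by (rule T_equation_unique[OF assms(1) Tx Forms_P_op[OF Tx] Forms_lift_total[OF assms(2)]
        P_op_T_equation[OF assms(1,2)] lift_total_equation[OF assms(2)]])
  have "ext_d S 0 = 0"
    unfolding ext_d_dw[OF Forms_0 order_refl] by (simp only: lin_op_0[OF dw_lin] sum.neutral_const)
  moreover have "d0inv S (ext_d S x) = T_op S x"
    unfolding T_op_def dw_0[OF assms(2)] assms(3) diff_zero ..
  ultimately show "Pi_E S M x = x - lift_total x"
    unfolding Pi_E_def assms(4) P_op_0 by (simp only: P diff_zero)
qed

lemma differential_part_eq:
  assumes "T_nilpotent S M" "x \<in> Forms S" "d0op x = 0" "d0inv S x = 0"
  shows "differential_part S M x = (\<Sum>r=1..Q. partial_op S r x)"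
proof -
  note W = Forms_lift_total[OF assms(2)]
  have "differential_part S M x = (\<Sum>m=1..Q. dw S m (x - lift_total x))"
    unfolding differential_part_def Pi_E_lift_total(1)[OF assms]
    by (rule ext_d_minus_dw0[OF Forms_diff[OF assms(2) W]])
  also have "\<dots> = (\<Sum>m=1..Q. dw S m x) - (\<Sum>m=1..Q. dw S m (lift_total x))"
    unfolding lin_op_diff[OF dw_lin assms(2) W] by (rule sum_subtractf)
  also have "\<dots> = (\<Sum>r=1..Q. partial_op S r x)"
    unfolding sum_lift_total[OF raises_dw assms(2)] sum_subtractf[symmetric] partial_op_lift ..
  finally show ?thesis .
qed

lemma Rumin_differential:
  assumes nil: "T_nilpotent S M" and \<alpha>: "\<alpha> \<in> Forms_deg S h"
  shows "d_c S M (Pi_E0 S \<alpha>) \<in> E0_deg S (Suc h)"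
    and "differential_part S M (Pi_E0 S \<alpha>) = (\<Sum>r=1..Q. partial_op S r (Pi_E0 S \<alpha>))"
    and "d_c S M (Pi_E0 S \<alpha>) = Pi_E0 S (\<Sum>r=1..Q. partial_op S r (Pi_E0 S \<alpha>))"
proof -
  let ?x = "Pi_E0 S \<alpha>"
  note F = Forms_deg_Forms[OF \<alpha>]
  note x = Forms_Pi_E0[OF F] d0op_Pi_E0[OF F] d0inv_Pi_E0[OF F]
  note E = Pi_E_lift_total[OF nil x]
  have yd: "Pi_E S M ?x \<in> Forms_deg S h"
    unfolding E(1) E(2)[symmetric] P_op_def
    by (intro Forms_deg_diff Forms_deg_sum Forms_deg_scl T_pow_deg T_op_deg Pi_E0_deg \<alpha>)
  note yF = Forms_deg_Forms[OF yd]
  show part: "differential_part S M ?x = (\<Sum>r=1..Q. partial_op S r ?x)"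
    by (rule differential_part_eq[OF nil x])
  have "ext_d S (Pi_E S M ?x) \<in> Forms_deg S (Suc h)"
    unfolding ext_d_dw[OF yF order_refl] by (intro Forms_deg_sum dw_deg yd)
  then show "d_c S M ?x \<in> E0_deg S (Suc h)" unfolding d_c_def by (rule Pi_E0_E0)
  have "ext_d S (Pi_E S M ?x) = differential_part S M ?x + d0op (Pi_E S M ?x)"
    unfolding differential_part_def dw_0[OF yF] by (rule diff_add_cancel[symmetric])
  moreover have "differential_part S M ?x \<in> Forms S"
    unfolding part by (rule Forms_sum[OF lin_op_Forms[OF raises_lin[OF raises_partial_op] x(1)]])
  ultimately have "d_c S M ?x = Pi_E0 S (differential_part S M ?x) + Pi_E0 S (d0op (Pi_E S M ?x))"
    unfolding d_c_def by (simp only: Pi_E0_add[OF _ Forms_d0op[OF yF]])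
  then show "d_c S M ?x = Pi_E0 S (\<Sum>r=1..Q. partial_op S r ?x)"
    unfolding Pi_E0_d0op[OF yF] part add_0_right .
qed

end

theorem theorem4p6:
  fixes S :: "('g::{t2_space, second_countable_topology}, 'e::euclidean_space) carnot"
  assumes "carnot_group S"
  shows
    "(\<exists>N. T_nilpotent S N) \<and>
     (\<forall>r p x z. 1 \<le> r \<longrightarrow> Z_lift S r p x z \<longrightarrow> (\<forall>j\<in>{1..<r}. z j \<in> Ker_d0_perp S) \<longrightarrow>
        partial S r p (cls S r p x) = cls S r (p + int r) (partial_op S r x)) \<and>
     (\<forall>h p. E0_deg S h \<inter> Forms_wt S p =
        {x \<in> Zr S 1 p \<inter> Forms_deg S h. \<forall>b\<in>Br S 1 p \<inter> Forms_deg S h. fip S x b = 0}) \<and>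
     (\<forall>r>homdim S. \<forall>\<alpha>\<in>Forms S. partial_op S r \<alpha> = 0) \<and>
     (\<forall>N h. \<forall>\<alpha>\<in>Forms_deg S h. T_nilpotent S N \<longrightarrow>
        Pi_E0 S \<alpha> \<in> E0_deg S h \<and>
        d_c S N (Pi_E0 S \<alpha>) \<in> E0_deg S (Suc h) \<and>
        differential_part S N (Pi_E0 S \<alpha>) = (\<Sum>r=1..homdim S. partial_op S r (Pi_E0 S \<alpha>)) \<and>
        d_c S N (Pi_E0 S \<alpha>) = Pi_E0 S (\<Sum>r=1..homdim S. partial_op S r (Pi_E0 S \<alpha>)))"
proof -
  interpret carnot_frame S by (rule carnot_frame.intro[OF assms])
  show ?thesis
  proof (intro conjI allI impI ballI)
    show "\<exists>N. T_nilpotent S N" by (rule exI[of _ "Suc (homdim S)"]) (rule T_nilpotent_homdim)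
  next
    fix r p x z
    assume r: "1 \<le> r" and Z: "Z_lift S r p x z" and perp: "\<forall>j\<in>{1..<r}. z j \<in> Ker_d0_perp S"
    show "partial S r p (cls S r p x) = cls S r (p + int r) (partial_op S r x)"
      by (rule partial_explicit[OF r Z]) (rule bspec[OF perp])
  next
    fix h p
    show "E0_deg S h \<inter> Forms_wt S p =
        {x \<in> Zr S 1 p \<inter> Forms_deg S h. \<forall>b\<in>Br S 1 p \<inter> Forms_deg S h. fip S x b = 0}"
      by (rule E0_first_page)
  next
    fix r \<alpha> assume "r > homdim S" "\<alpha> \<in> Forms S"
    then show "partial_op S r \<alpha> = 0" by (rule partial_op_vanish)
  next
    fix N h \<alpha> assume a: "\<alpha> \<in> Forms_deg S h" and nil: "T_nilpotent S N"
    show "Pi_E0 S \<alpha> \<in> E0_deg S h" by (rule Pi_E0_E0[OF a])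
    show "d_c S N (Pi_E0 S \<alpha>) \<in> E0_deg S (Suc h)"
      "differential_part S N (Pi_E0 S \<alpha>) = (\<Sum>r=1..homdim S. partial_op S r (Pi_E0 S \<alpha>))"
      "d_c S N (Pi_E0 S \<alpha>) = Pi_E0 S (\<Sum>r=1..homdim S. partial_op S r (Pi_E0 S \<alpha>))"
      by (rule Rumin_differential[OF nil a])+
  qed
qed

end
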